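(* If $\mathbf T=(T_1,\ldots,T_k)\in\mathbf B^c_{\mathbf n}(\mathcal H)$ has finite rank and a (constrained) characteristic function, then the curvature $\mathrm{curv}_c(\mathbf T)$ exists (i.e. the limit defining it exists) and satisfies the asymptotic formulas $$\mathrm{curv}_c(\mathbf T)=\lim_{m\to\infty}\frac1{\binom{m+k}{k}}\sum_{\substack{q_1\ge0,\ldots,q_k\ge0\\ q_1+\cdots+q_k\le m}}\frac{\mathrm{trace}\left[\Phi_{T_1}^{q_1}\circ\cdots\circ\Phi_{T_k}^{q_k}(\mathbf\Delta_{\mathbf T}(I))\right]}{\prod_{i=1}^k\mathrm{trace}(Q^{(i)}_{q_i})}$$ $$=\lim_{m\to\infty}\frac1{\binom{m+k-1}{k-1}}\sum_{\substack{q_1\ge0,\ldots,q_k\ge0\\ q_1+\cdots+q_k=m}}\frac{\mathrm{trace}\left[\Phi_{T_1}^{q_1}\circ\cdots\circ\Phi_{T_k}^{q_k}(\mathbf\Delta_{\mathbf T}(I))\right]}{\prod_{i=1}^k\mathrm{trace}(Q^{(i)}_{q_i})}$$ $$=\lim_{(q_1,\ldots,q_k)\in\mathbb Z_+^k}\frac{\mathrm{trace}\left[\Phi_{T_1}^{q_1}\circ\cdots\circ\Phi_{T_k}^{q_k}(\mathbf\Delta_{\mathbf T}(I))\right]}{\prod_{i=1}^k\mathrm{trace}(Q^{(i)}_{q_i})}$$ $$=n_1!\cdots n_k!\lim_{q_1\to\infty}\cdots\lim_{q_k\to\infty}\frac{\mathrm{trace}\left[(id-\Phi_{T_1}^{q_1+1})\circ\cdots\circ(id-\Phi_{T_k}^{q_k+1})(I)\right]}{q_1^{n_1}\cdots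 q_k^{n_k}}.$$
   Context: All Hilbert spaces are complex; $\mathbb N=\{1,2,\ldots\}$, $\mathbb Z_+=\{0,1,\ldots\}$. Fix $k\in\mathbb N$ and $\mathbf n=(n_1,\ldots,n_k)\in\mathbb N^k$ with at least one $n_i\ge2$. For $X_i=(X_{i,1},\ldots,X_{i,n_i})\in B(\mathcal H)^{n_i}$ let $\Phi_{X_i}(Y)=\sum_{j=1}^{n_i}X_{i,j}YX_{i,j}^*$. The regular polyball $\mathbf B_{\mathbf n}(\mathcal H)$ is the set of all $\mathbf X=(X_1,\ldots,X_k)$ with $X_i\in B(\mathcal H)^{n_i}$ such that every entry of $X_s$ commutes with every entry of $X_t$ whenever $s\ne t$ and $(id-\Phi_{X_1})^{p_1}\circ\cdots\circ(id-\Phi_{X_k})^{p_k}(I)\ge0$ for all $(p_1,\ldots,p_k)\in\{0,1\}^k$. The commutative polyball $\mathbf B^c_{\mathbf n}(\mathcal H)$ is the set of $\mathbf X\in\mathbf B_{\mathbf n}(\mathcal H)$ all of whose entries $X_{i,j}$ commute. Put $\mathbf\Delta_{\mathbf X}=(id-\Phi_{X_1})\circ\cdots\circ(id-\Phi_{X_k})$; $\mathbf T$ has finite rank if $\mathbf\Delta_{\mathbf T}(I)$ does. Put $\mathcal D_{\mathbf T}=\overline{\mathbf\Delta_{\mathbf T}(I)\mathcal H}$. $F^2(H_{n_i})=\mathbb C1\oplus\bigoplus_{p\ge1}H_{n_i}^{\otimes p}$ is the full Fock space of an $n_i$-dimensional Hilbert space $H_{n_i}$ with orthonormal basis $e^i_1,\ldots,e^i_{n_i}$,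 and $F^2_s(H_{n_i})\subset F^2(H_{n_i})$ is the symmetric Fock space (closed span of symmetric tensors). $\mathbb F_{n_i}^+$ is the free unital semigroup on generators $g_1^i,\ldots,g_{n_i}^i$; for $\alpha=g^i_{j_1}\cdots g^i_{j_p}$ put $e^i_\alpha=e^i_{j_1}\otimes\cdots\otimes e^i_{j_p}$, $T_{i,\alpha}=T_{i,j_1}\cdots T_{i,j_p}$, and $e^i_\alpha=1$, $T_{i,\alpha}=I$ for the neutral element. Let $S_{i,j}e^i_\alpha=e^i_{g^i_j\alpha}$, $B_{i,j}=P_{F^2_s(H_{n_i})}S_{i,j}|_{F^2_s(H_{n_i})}$, and $\mathbf B_{i,j}=I\otimes\cdots\otimes B_{i,j}\otimes\cdots\otimes I$ ($B_{i,j}$ in position $i$) on $\bigotimes_{i=1}^kF_s^2(H_{n_i})$. $Q^{(i)}_q$ is the orthogonal projection of $F^2_s(H_{n_i})$ onto its homogeneous component of degree $q$, so $\mathrm{trace}\,Q^{(i)}_q=\binom{q+n_i-1}{n_i-1}$. The constrained Berezin kernel of $\mathbf T\in\mathbf B^c_{\mathbf n}(\mathcal H)$ is $\widetilde{\mathbf K}_{\mathbf T}=(P_{\bigotimes_iF^2_s(H_{n_i})}\otimes I_{\mathcal D_{\mathbf T}})\mathbf K_{\mathbf T}:\mathcal H\to\bigotimes_iF^2_s(H_{n_i})\otimes\mathcal D_{\mathbf T}$, where $$\mathbf K_{\mathbf T}h=\sum_{\beta_i\in\mathbb F_{n_i}^+,\,i=1,\ldots,k}e^1_{\beta_1}\otimes\cdots\otimes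 e^k_{\beta_k}\otimes\mathbf\Delta_{\mathbf T}(I)^{1/2}T_{1,\beta_1}^*\cdots T_{k,\beta_k}^*h.$$ $\mathbf T$ has a constrained characteristic function if there are a Hilbert space $\mathcal E$ and a bounded operator $\widetilde\Theta_{\mathbf T}:\bigotimes_iF^2_s(H_{n_i})\otimes\mathcal E\to\bigotimes_iF^2_s(H_{n_i})\otimes\mathcal D_{\mathbf T}$ with $\widetilde\Theta_{\mathbf T}(\mathbf B_{i,j}\otimes I_{\mathcal E})=(\mathbf B_{i,j}\otimes I_{\mathcal D_{\mathbf T}})\widetilde\Theta_{\mathbf T}$ for all $i,j$ and $\widetilde{\mathbf K}_{\mathbf T}\widetilde{\mathbf K}_{\mathbf T}^*+\widetilde\Theta_{\mathbf T}\widetilde\Theta_{\mathbf T}^*=I$. For $\mathbf T$ of finite rank with constrained characteristic function, the curvature is defined by $$\mathrm{curv}_c(\mathbf T):=\lim_{m\to\infty}\frac1{\binom{m+k}{k}}\sum_{\substack{q_1\ge0,\ldots,q_k\ge0\\ q_1+\cdots+q_k\le m}}\frac{\mathrm{trace}\left[\widetilde{\mathbf K}_{\mathbf T}^*(Q^{(1)}_{q_1}\otimes\cdots\otimes Q^{(k)}_{q_k}\otimes I_{\mathcal D_{\mathbf T}})\widetilde{\mathbf K}_{\mathbf T}\right]}{\mathrm{trace}\left[Q^{(1)}_{q_1}\otimes\cdots\otimes Q^{(k)}_{q_k}\right]}.$$ Limits over $\mathbb Z_+^k$ are limits of nets for the coordinatewise order. *)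

theory Defs
  imports "HOL-Analysis.Analysis" "HOL-Combinatorics.List_Permutation"
begin

section \<open>Complex Hilbert spaces\<close>

text \<open>
  The inner product is linear in the first argument.  The real structure (hence norm, metric and
  topology) is the one of the library, obtained from the real part of the complex inner product.
\<close>

class complex_inner = real_inner +
  fixes scaleC :: "complex \<Rightarrow> 'a \<Rightarrow> 'a" (infixr "*\<^sub>C" 75)
    and cinner :: "'a \<Rightarrow> 'a \<Rightarrow> complex"
  assumes scaleC_add_right: "c *\<^sub>C (x + y) = c *\<^sub>C x + c *\<^sub>C y"
    and scaleC_add_left: "(c + d) *\<^sub>C x = c *\<^sub>C x + d *\<^sub>C x"
    and scaleC_scaleC: "c *\<^sub>C d *\<^sub>C x = (c * d) *\<^sub>C x"
    and scaleR_eq_scaleC: "r *\<^sub>R x = complex_of_real r *\<^sub>C x"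
    and cinner_commute: "cinner x y = cnj (cinner y x)"
    and cinner_add_left: "cinner (x + y) z = cinner x z + cinner y z"
    and cinner_scaleC_left: "cinner (c *\<^sub>C x) y = c * cinner x y"
    and inner_eq_Re_cinner: "inner x y = Re (cinner x y)"

class chilbert_space = complex_inner + complete_space

lemma scaleC_one [simp]: "1 *\<^sub>C x = (x :: 'a :: complex_inner)"
  using scaleR_eq_scaleC[of 1 x] by simp

global_interpretation complex_vector:
  vector_space "scaleC :: complex \<Rightarrow> 'a \<Rightarrow> 'a :: complex_inner"
  defines cspan_raw_def: cspan = complex_vector.span
    and csubspace_raw_def: csubspace = complex_vector.subspace
  by unfold_locales (auto simp: scaleC_add_right scaleC_add_left scaleC_scaleC)

lemma cinner_scaleC_right: "cinner x (c *\<^sub>C y) = cnj c * cinner (x :: 'a :: complex_inner) y"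
  by (metis cinner_commute cinner_scaleC_left complex_cnj_mult)

lemma cinner_self: "cinner x x = complex_of_real ((norm (x :: 'a :: complex_inner))\<^sup>2)"
proof -
  have "Im (cinner x x) = 0"
    using cinner_commute[of x x] by (metis Reals_cnj_iff complex_is_Real_iff)
  then show ?thesis
    by (simp add: complex_eq_iff power2_norm_eq_inner inner_eq_Re_cinner)
qed

lemma norm_scaleC: "norm (c *\<^sub>C x) = cmod c * norm (x :: 'a :: complex_inner)"
proof -
  have "cinner (c *\<^sub>C x) (c *\<^sub>C x) = (c * cnj c) * cinner x x"
    by (simp add: cinner_scaleC_left cinner_scaleC_right)
  also have "\<dots> = complex_of_real ((cmod c * norm x)\<^sup>2)"
    by (simp add: cinner_self complex_norm_square[symmetric] power_mult_distrib)
  finally have "(norm (c *\<^sub>C x))\<^sup>2 = (cmod c * norm x)\<^sup>2"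
    unfolding cinner_self of_real_eq_iff .
  then show ?thesis by (simp add: power2_eq_iff_nonneg)
qed

lemma cmod_cinner_le: "cmod (cinner x y) \<le> norm x * norm (y :: 'a :: complex_inner)"
proof -
  define z where "z = cinner x y"
  define c where "c = (if z = 0 then 1 else cnj z / cmod z)"
  have c: "cmod c = 1" "c * z = cmod z"
    by (auto simp: c_def norm_divide complex_norm_square[symmetric] power2_eq_square
        mult.commute[of "cnj z"])
  have "cmod z = inner (c *\<^sub>C x) y"
    using c(2) by (simp add: inner_eq_Re_cinner cinner_scaleC_left z_def)
  also have "\<dots> \<le> norm (c *\<^sub>C x) * norm y" by (rule norm_cauchy_schwarz)
  finally show ?thesis by (simp add: norm_scaleC c z_def)
qed

instantiation complex :: chilbert_space
begin
definition scaleC_complex :: "complex \<Rightarrow> complex \<Rightarrow> complex" where "scaleC_complex c z = c * z"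
definition cinner_complex :: "complex \<Rightarrow> complex \<Rightarrow> complex" where "cinner_complex z w = z * cnj w"
instance
  by standard (auto simp: scaleC_complex_def cinner_complex_def algebra_simps inner_complex_def
      scaleR_conv_of_real)
end


section \<open>Square-summable families\<close>

text \<open>
  The Hilbert space of square-summable families of vectors of \<open>'e\<close> indexed by \<open>'i\<close>; it is the Hilbert
  tensor product of scalar square-summable families with \<open>'e\<close>.
\<close>

typedef (overloaded) ('i, 'e :: complex_inner) ell2 =
  "{f :: 'i \<Rightarrow> 'e. (\<lambda>i. (norm (f i))\<^sup>2) summable_on UNIV}"
  by (rule exI[of _ "\<lambda>_. 0"]) simp

lemma ell2_summable: "(\<lambda>i. (norm (Rep_ell2 f i))\<^sup>2) summable_on UNIV"
  using Rep_ell2[of f] by simp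

lemma ell2_memI:
  assumes "g summable_on UNIV" "\<And>i. (norm (f i))\<^sup>2 \<le> (g i :: real)"
  shows "f \<in> {f. (\<lambda>i. (norm (f i))\<^sup>2) summable_on UNIV}"
  unfolding mem_Collect_eq by (rule summable_on_comparison_test[OF assms(1)]) (use assms(2) in auto)

lemma ell2_mem_add:
  fixes f g :: "'i \<Rightarrow> 'e :: real_inner"
  assumes f: "f \<in> {f. (\<lambda>i. (norm (f i))\<^sup>2) summable_on UNIV}"
    and g: "g \<in> {f. (\<lambda>i. (norm (f i))\<^sup>2) summable_on UNIV}"
  shows "(\<lambda>i. f i + g i) \<in> {f. (\<lambda>i. (norm (f i))\<^sup>2) summable_on UNIV}"
proof (rule ell2_memI)
  show "(\<lambda>i. 2 * ((norm (f i))\<^sup>2 + (norm (g i))\<^sup>2)) summable_on UNIV"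
    using f g by (intro summable_on_cmult_right summable_on_add) auto
  fix i
  have "(norm (f i + g i))\<^sup>2 \<le> (norm (f i) + norm (g i))\<^sup>2"
    by (intro power_mono norm_triangle_ineq) simp
  also have "\<dots> \<le> 2 * ((norm (f i))\<^sup>2 + (norm (g i))\<^sup>2)"
    using sum_squares_bound[of "norm (f i)" "norm (g i)"] by (simp add: power2_sum)
  finally show "(norm (f i + g i))\<^sup>2 \<le> 2 * ((norm (f i))\<^sup>2 + (norm (g i))\<^sup>2)" .
qed

lemma ell2_mem_scaleC:
  assumes f: "f \<in> {f. (\<lambda>i. (norm (f i))\<^sup>2) summable_on UNIV}"
  shows "(\<lambda>i. c *\<^sub>C f i) \<in> {f. (\<lambda>i. (norm (f i))\<^sup>2) summable_on UNIV}"
  using f by (simp add: norm_scaleC power_mult_distrib summable_on_cmult_right)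

lemma ell2_cinner_summable: "(\<lambda>i. cinner (Rep_ell2 f i) (Rep_ell2 g i)) summable_on UNIV"
proof (rule abs_summable_summable, rule summable_on_comparison_test)
  show "(\<lambda>i. (norm (Rep_ell2 f i))\<^sup>2 + (norm (Rep_ell2 g i))\<^sup>2) summable_on UNIV"
    by (intro summable_on_add ell2_summable)
  fix i
  have "cmod (cinner (Rep_ell2 f i) (Rep_ell2 g i)) \<le> norm (Rep_ell2 f i) * norm (Rep_ell2 g i)"
    by (rule cmod_cinner_le)
  also have "\<dots> \<le> (norm (Rep_ell2 f i))\<^sup>2 + (norm (Rep_ell2 g i))\<^sup>2"
    using sum_squares_bound[of "norm (Rep_ell2 f i)" "norm (Rep_ell2 g i)"]
      mult_nonneg_nonneg[of "norm (Rep_ell2 f i)" "norm (Rep_ell2 g i)"]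
    by (simp del: mult_nonneg_nonneg)
  finally show "norm (cinner (Rep_ell2 f i) (Rep_ell2 g i))
      \<le> (norm (Rep_ell2 f i))\<^sup>2 + (norm (Rep_ell2 g i))\<^sup>2" .
qed simp

instantiation ell2 :: (type, complex_inner) complex_inner
begin

definition zero_ell2 :: "('a, 'b) ell2" where "0 = Abs_ell2 (\<lambda>_. 0)"
definition plus_ell2 :: "('a, 'b) ell2 \<Rightarrow> ('a, 'b) ell2 \<Rightarrow> ('a, 'b) ell2"
  where "f + g = Abs_ell2 (\<lambda>i. Rep_ell2 f i + Rep_ell2 g i)"
definition scaleC_ell2 :: "complex \<Rightarrow> ('a, 'b) ell2 \<Rightarrow> ('a, 'b) ell2"
  where "c *\<^sub>C f = Abs_ell2 (\<lambda>i. c *\<^sub>C Rep_ell2 f i)"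
definition scaleR_ell2 :: "real \<Rightarrow> ('a, 'b) ell2 \<Rightarrow> ('a, 'b) ell2"
  where "r *\<^sub>R (f :: ('a, 'b) ell2) = complex_of_real r *\<^sub>C f"
definition uminus_ell2 :: "('a, 'b) ell2 \<Rightarrow> ('a, 'b) ell2"
  where "- f = (- 1) *\<^sub>C (f :: ('a, 'b) ell2)"
definition minus_ell2 :: "('a, 'b) ell2 \<Rightarrow> ('a, 'b) ell2 \<Rightarrow> ('a, 'b) ell2"
  where "f - g = f + - (g :: ('a, 'b) ell2)"
definition cinner_ell2 :: "('a, 'b) ell2 \<Rightarrow> ('a, 'b) ell2 \<Rightarrow> complex"
  where "cinner f g = (\<Sum>\<^sub>\<infinity>i. cinner (Rep_ell2 f i) (Rep_ell2 g i))"
definition inner_ell2 :: "('a, 'b) ell2 \<Rightarrow> ('a, 'b) ell2 \<Rightarrow> real"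
  where "inner f g = Re (cinner f (g :: ('a, 'b) ell2))"
definition norm_ell2 :: "('a, 'b) ell2 \<Rightarrow> real"
  where "norm f = sqrt (inner f (f :: ('a, 'b) ell2))"
definition sgn_ell2 :: "('a, 'b) ell2 \<Rightarrow> ('a, 'b) ell2"
  where "sgn f = inverse (norm f) *\<^sub>R (f :: ('a, 'b) ell2)"
definition dist_ell2 :: "('a, 'b) ell2 \<Rightarrow> ('a, 'b) ell2 \<Rightarrow> real"
  where "dist f g = norm (f - (g :: ('a, 'b) ell2))"
definition uniformity_ell2 :: "(('a, 'b) ell2 \<times> ('a, 'b) ell2) filter"
  where "uniformity_ell2 = (INF e\<in>{0<..}. principal {(x, y :: ('a, 'b) ell2). dist x y < e})"
definition open_ell2 :: "('a, 'b) ell2 set \<Rightarrow> bool"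
  where "open_ell2 U = (\<forall>x\<in>U. eventually (\<lambda>(x', y). x' = x \<longrightarrow> y \<in> U) uniformity)"

lemma Rep_zero_ell2: "Rep_ell2 (0 :: ('a, 'b) ell2) = (\<lambda>_. 0)"
  unfolding zero_ell2_def by (rule Abs_ell2_inverse) simp

lemma Rep_plus_ell2: "Rep_ell2 (f + g :: ('a, 'b) ell2) = (\<lambda>i. Rep_ell2 f i + Rep_ell2 g i)"
  unfolding plus_ell2_def by (rule Abs_ell2_inverse) (intro ell2_mem_add Rep_ell2)

lemma Rep_scaleC_ell2: "Rep_ell2 (c *\<^sub>C f :: ('a, 'b) ell2) = (\<lambda>i. c *\<^sub>C Rep_ell2 f i)"
  unfolding scaleC_ell2_def by (rule Abs_ell2_inverse) (intro ell2_mem_scaleC Rep_ell2)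

lemma inner_ell2_self: "inner f (f :: ('a, 'b) ell2) = (\<Sum>\<^sub>\<infinity>i. (norm (Rep_ell2 f i))\<^sup>2)"
proof -
  have "inner f f = (\<Sum>\<^sub>\<infinity>i. Re (cinner (Rep_ell2 f i) (Rep_ell2 f i)))"
    unfolding inner_ell2_def cinner_ell2_def by (rule infsum_Re[OF ell2_cinner_summable, symmetric])
  then show ?thesis by (simp add: cinner_self)
qed

instance
proof
  fix x y z :: "('a, 'b) ell2" and c d :: complex and a b r :: real
  have neg: "- v = (- 1) *\<^sub>C (v :: 'b)" for v
    using scaleR_eq_scaleC[of "- 1" v] by simp
  have zero: "0 *\<^sub>C v = (0 :: 'b)" for v using scaleR_eq_scaleC[of 0 v] by simp
  note rep = Rep_ell2_inject[symmetric] Rep_zero_ell2 Rep_plus_ell2 Rep_scaleC_ell2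
  show "x + y + z = x + (y + z)" "x + y = y + x" "0 + x = x"
    by (simp_all add: rep add_ac)
  show "- x + x = 0" by (simp add: rep uminus_ell2_def neg[symmetric])
  show "x - y = x + - y" by (simp add: minus_ell2_def)
  show sC: "c *\<^sub>C (x + y) = c *\<^sub>C x + c *\<^sub>C y" "(c + d) *\<^sub>C x = c *\<^sub>C x + d *\<^sub>C x"
      "c *\<^sub>C d *\<^sub>C x = (c * d) *\<^sub>C x" for c d and x y :: "('a, 'b) ell2"
    by (simp_all add: rep scaleC_add_right scaleC_add_left scaleC_scaleC)
  show "a *\<^sub>R (x + y) = a *\<^sub>R x + a *\<^sub>R y" "(a + b) *\<^sub>R x = a *\<^sub>R x + b *\<^sub>R x"
      "a *\<^sub>R b *\<^sub>R x = (a * b) *\<^sub>R x" "1 *\<^sub>R x = x"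
    by (simp_all add: scaleR_ell2_def sC rep)
  show "r *\<^sub>R x = complex_of_real r *\<^sub>C x" by (simp add: scaleR_ell2_def)
  show "sgn x = inverse (norm x) *\<^sub>R x" by (simp add: sgn_ell2_def)
  show "dist x y = norm (x - y)" by (simp add: dist_ell2_def)
  show "uniformity = (INF e\<in>{0<..}. principal {(x, y :: ('a, 'b) ell2). dist x y < e})"
    by (rule uniformity_ell2_def)
  show "open U = (\<forall>x\<in>U. \<forall>\<^sub>F (x', y) in uniformity. x' = x \<longrightarrow> y \<in> U)" for U :: "('a, 'b) ell2 set"
    by (rule open_ell2_def)
  show cc: "cinner x y = cnj (cinner y x)" for x y :: "('a, 'b) ell2"
    unfolding cinner_ell2_def infsum_cnj[symmetric] by (simp add: cinner_commute[symmetric])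
  show cadd: "cinner (x + y) z = cinner x z + cinner y z" for x y z :: "('a, 'b) ell2"
    unfolding cinner_ell2_def
    by (simp add: Rep_plus_ell2 cinner_add_left infsum_add ell2_cinner_summable)
  show cs: "cinner (c *\<^sub>C x) y = c * cinner x y" for c and x y :: "('a, 'b) ell2"
    unfolding cinner_ell2_def
    by (simp add: Rep_scaleC_ell2 cinner_scaleC_left infsum_cmult_right ell2_cinner_summable)
  show "inner x y = Re (cinner x y)" by (rule inner_ell2_def)
  show "inner x y = inner y x" using cc[of x y] by (simp add: inner_ell2_def)
  show "inner (x + y) z = inner x z + inner y z" by (simp add: inner_ell2_def cadd)
  show "inner (a *\<^sub>R x) y = a * inner x y" by (simp add: inner_ell2_def scaleR_ell2_def cs)
  show "0 \<le> inner x x" unfolding inner_ell2_self by (rule infsum_nonneg) simp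
  show "norm x = sqrt (inner x x)" by (rule norm_ell2_def)
  show "inner x x = 0 \<longleftrightarrow> x = 0"
  proof
    assume "inner x x = 0"
    then have "(norm (Rep_ell2 x i))\<^sup>2 = 0" for i
      using nonneg_infsum_le_0D[OF _ ell2_summable, of x i] by (simp add: inner_ell2_self)
    then show "x = 0" by (simp add: rep fun_eq_iff)
  next
    assume "x = 0" then show "inner x x = 0" by (simp add: inner_ell2_self Rep_zero_ell2)
  qed
qed

end

lemma norm_ell2_sq: "(norm f)\<^sup>2 = (\<Sum>\<^sub>\<infinity>i. (norm (Rep_ell2 f i))\<^sup>2)"
  by (simp add: power2_norm_eq_inner inner_ell2_self)

lemma Rep_minus_ell2: "Rep_ell2 (f - g) = (\<lambda>i. Rep_ell2 f i - Rep_ell2 g i)"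
  by (metis (no_types, lifting) Rep_plus_ell2 add_diff_cancel_right' diff_add_cancel ext)

lemma sum_norm_ell2_le:
  assumes "finite I" shows "(\<Sum>i\<in>I. (norm (Rep_ell2 f i))\<^sup>2) \<le> (norm f)\<^sup>2"
  unfolding norm_ell2_sq by (rule finite_sum_le_infsum) (use assms ell2_summable in auto)

lemma norm_Rep_ell2_le: "norm (Rep_ell2 f i) \<le> norm f"
  using sum_norm_ell2_le[of "{i}" f] by (simp add: power2_le_iff_abs_le)

instance ell2 :: (type, chilbert_space) chilbert_space
proof
  fix F :: "nat \<Rightarrow> ('a, 'b) ell2"
  assume F: "Cauchy F"
  have "Cauchy (\<lambda>n. Rep_ell2 (F n) i)" for i
  proof (rule metric_CauchyI)
    fix e :: real assume "e > 0"
    then obtain N where N: "\<And>m n. m \<ge> N \<Longrightarrow> n \<ge> N \<Longrightarrow> dist (F m) (F n) < e"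
      using metric_CauchyD[OF F] by blast
    have "dist (Rep_ell2 (F m) i) (Rep_ell2 (F n) i) < e" if "m \<ge> N" "n \<ge> N" for m n
      using norm_Rep_ell2_le[of "F m - F n" i] N[OF that] by (simp add: dist_norm Rep_minus_ell2)
    then show "\<exists>M. \<forall>m\<ge>M. \<forall>n\<ge>M. dist (Rep_ell2 (F m) i) (Rep_ell2 (F n) i) < e" by blast
  qed
  then have "\<forall>i. \<exists>l. (\<lambda>n. Rep_ell2 (F n) i) \<longlonglongrightarrow> l"
    using Cauchy_convergent_iff convergent_def by blast
  then obtain g where g: "\<And>i. (\<lambda>n. Rep_ell2 (F n) i) \<longlonglongrightarrow> g i" by metis
  have bound: "\<exists>N. \<forall>n\<ge>N. \<forall>I. finite I \<longrightarrow> (\<Sum>i\<in>I. (norm (Rep_ell2 (F n) i - g i))\<^sup>2) \<le> e\<^sup>2"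
    if "e > 0" for e :: real
  proof -
    obtain N where N: "\<And>m n. m \<ge> N \<Longrightarrow> n \<ge> N \<Longrightarrow> dist (F m) (F n) < e"
      using metric_CauchyD[OF F] \<open>e > 0\<close> by blast
    have "(\<Sum>i\<in>I. (norm (Rep_ell2 (F n) i - g i))\<^sup>2) \<le> e\<^sup>2" if "n \<ge> N" "finite I" for n I
    proof (rule LIMSEQ_le_const2)
      show "(\<lambda>m. \<Sum>i\<in>I. (norm (Rep_ell2 (F n) i - Rep_ell2 (F m) i))\<^sup>2)
          \<longlonglongrightarrow> (\<Sum>i\<in>I. (norm (Rep_ell2 (F n) i - g i))\<^sup>2)"
        by (intro tendsto_intros g)
      have "(\<Sum>i\<in>I. (norm (Rep_ell2 (F n) i - Rep_ell2 (F m) i))\<^sup>2) \<le> e\<^sup>2" if "m \<ge> N" for m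
      proof -
        have "(\<Sum>i\<in>I. (norm (Rep_ell2 (F n) i - Rep_ell2 (F m) i))\<^sup>2) \<le> (norm (F n - F m))\<^sup>2"
          using sum_norm_ell2_le[OF \<open>finite I\<close>, of "F n - F m"] by (simp add: Rep_minus_ell2)
        also have "\<dots> \<le> e\<^sup>2"
          using N[OF \<open>n \<ge> N\<close> that] by (intro power_mono) (auto simp: dist_norm)
        finally show ?thesis .
      qed
      then show "\<exists>M. \<forall>m\<ge>M. (\<Sum>i\<in>I. (norm (Rep_ell2 (F n) i - Rep_ell2 (F m) i))\<^sup>2) \<le> e\<^sup>2"
        by blast
    qed
    then show ?thesis by blast
  qed
  have memd: "(\<lambda>i. Rep_ell2 (F n) i - g i) \<in> {f. (\<lambda>i. (norm (f i))\<^sup>2) summable_on UNIV}"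
    if "\<forall>I. finite I \<longrightarrow> (\<Sum>i\<in>I. (norm (Rep_ell2 (F n) i - g i))\<^sup>2) \<le> e\<^sup>2" for n e
    unfolding mem_Collect_eq
    by (rule nonneg_bdd_above_summable_on) (use that in \<open>auto simp: bdd_above_def\<close>)
  obtain N where N: "\<forall>n\<ge>N. \<forall>I. finite I \<longrightarrow> (\<Sum>i\<in>I. (norm (Rep_ell2 (F n) i - g i))\<^sup>2) \<le> 1\<^sup>2"
    using bound[of 1] by auto
  obtain D where D: "Rep_ell2 D = (\<lambda>i. Rep_ell2 (F N) i - g i)"
    using Abs_ell2_inverse[OF memd[of N 1]] N by blast
  have G: "Rep_ell2 (F N - D) = g" by (simp add: Rep_minus_ell2 D)
  have "F \<longlonglongrightarrow> F N - D"
  proof (rule metric_LIMSEQ_I)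
    fix e :: real assume "e > 0"
    then obtain M where
      M: "\<forall>n\<ge>M. \<forall>I. finite I \<longrightarrow> (\<Sum>i\<in>I. (norm (Rep_ell2 (F n) i - g i))\<^sup>2) \<le> (e / 2)\<^sup>2"
      using bound[of "e / 2"] by auto
    have "dist (F n) (F N - D) < e" if "n \<ge> M" for n
    proof -
      have "(norm (F n - (F N - D)))\<^sup>2 \<le> (e / 2)\<^sup>2"
        unfolding norm_ell2_sq
        by (rule infsum_le_finite_sums[OF ell2_summable])
          (use M that G in \<open>simp add: Rep_minus_ell2[of "F n" "F N - D"]\<close>)
      then have "norm (F n - (F N - D)) \<le> e / 2"
        by (rule power2_le_imp_le) (use \<open>e > 0\<close> in simp)
      then show ?thesis using \<open>e > 0\<close> by (simp add: dist_norm)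
    qed
    then show "\<exists>no. \<forall>n\<ge>no. dist (F n) (F N - D) < e" by blast
  qed
  then show "convergent F" by (auto simp: convergent_def)
qed


section \<open>Operators\<close>

text \<open>
  Operators are functions; an operator between closed subspaces \<open>M\<close> and \<open>N\<close> of the ambient spaces is
  only relevant on \<open>M\<close>.
\<close>

definition bounded_op_on ::
  "'a :: complex_inner set \<Rightarrow> 'b :: complex_inner set \<Rightarrow> ('a \<Rightarrow> 'b) \<Rightarrow> bool" where
  "bounded_op_on M N A \<longleftrightarrow>
     (\<forall>x\<in>M. A x \<in> N) \<and> (\<forall>x\<in>M. \<forall>y\<in>M. A (x + y) = A x + A y) \<and>
     (\<forall>c. \<forall>x\<in>M. A (c *\<^sub>C x) = c *\<^sub>C A x) \<and> (\<exists>C. \<forall>x\<in>M. norm (A x) \<le> C * norm x)"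

abbreviation bounded_op :: "('a :: complex_inner \<Rightarrow> 'b :: complex_inner) \<Rightarrow> bool" where
  "bounded_op \<equiv> bounded_op_on UNIV UNIV"

text \<open>The adjoint of an operator with domain \<open>M\<close>.\<close>

definition adj_on ::
  "'a :: complex_inner set \<Rightarrow> ('a \<Rightarrow> 'b :: complex_inner) \<Rightarrow> 'b \<Rightarrow> 'a" where
  "adj_on M A y = (THE x. x \<in> M \<and> (\<forall>z\<in>M. cinner (A z) y = cinner z x))"

abbreviation adj :: "('a :: complex_inner \<Rightarrow> 'b :: complex_inner) \<Rightarrow> 'b \<Rightarrow> 'a" where
  "adj \<equiv> adj_on UNIV"

definition proj :: "'a :: complex_inner set \<Rightarrow> 'a \<Rightarrow> 'a" where
  "proj M x = (THE y. y \<in> M \<and> (\<forall>z\<in>M. cinner (x - y) z = 0))"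

definition positive_op :: "('a :: complex_inner \<Rightarrow> 'a) \<Rightarrow> bool" where
  "positive_op A \<longleftrightarrow> bounded_op A \<and> (\<forall>h. cinner (A h) h \<in> \<real>\<^sub>\<ge>\<^sub>0)"

definition sqrt_op :: "('a :: complex_inner \<Rightarrow> 'a) \<Rightarrow> 'a \<Rightarrow> 'a" where
  "sqrt_op A = (THE R. positive_op R \<and> R \<circ> R = A)"

definition finite_rank_op :: "('a :: complex_inner \<Rightarrow> 'b :: complex_inner) \<Rightarrow> bool" where
  "finite_rank_op A \<longleftrightarrow> (\<exists>B. finite B \<and> range A \<subseteq> cspan B)"

definition orthonormal_basis_of :: "'a :: complex_inner set \<Rightarrow> 'a set \<Rightarrow> bool" where
  "orthonormal_basis_of M B \<longleftrightarrow>
     (\<forall>x\<in>B. \<forall>y\<in>B. cinner x y = (if x = y then 1 else 0)) \<and> closure (cspan B) = M"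

text \<open>
  The trace of an operator on the closed subspace \<open>M\<close>.  For trace-class operators the sum does not
  depend on the chosen orthonormal basis; only finite-rank operators occur below.
\<close>

definition trace_on :: "'a :: complex_inner set \<Rightarrow> ('a \<Rightarrow> 'a) \<Rightarrow> complex" where
  "trace_on M A = (\<Sum>\<^sub>\<infinity>e \<in> (SOME B. orthonormal_basis_of M B). cinner (A e) e)"

text \<open>\<open>comp_upto k A = A 1 \<circ> \<dots> \<circ> A k\<close>\<close>

definition comp_upto :: "nat \<Rightarrow> (nat \<Rightarrow> 'x \<Rightarrow> 'x) \<Rightarrow> 'x \<Rightarrow> 'x" where
  "comp_upto k A = foldr (\<lambda>i R. A i \<circ> R) [1..<Suc k] id"


section \<open>Tensor products\<close>

text \<open>The elementary tensor \<open>f \<otimes> x\<close>.\<close>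

definition etensor :: "('i, complex) ell2 \<Rightarrow> 'e :: complex_inner \<Rightarrow> ('i, 'e) ell2" where
  "etensor f x = Abs_ell2 (\<lambda>\<beta>. Rep_ell2 f \<beta> *\<^sub>C x)"

lemma Rep_etensor: "Rep_ell2 (etensor f x) \<beta> = Rep_ell2 f \<beta> *\<^sub>C x"
proof -
  have "(\<lambda>\<beta>. Rep_ell2 f \<beta> *\<^sub>C x) \<in> {f. (\<lambda>i. (norm (f i))\<^sup>2) summable_on UNIV}"
    by (simp add: norm_scaleC power_mult_distrib summable_on_cmult_left ell2_summable)
  then show ?thesis unfolding etensor_def by (subst Abs_ell2_inverse) auto
qed

lemma cinner_etensor: "cinner (etensor f x) (etensor g y) = cinner f g * cinner x y"
proof -
  have "cinner (etensor f x) (etensor g y)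
      = (\<Sum>\<^sub>\<infinity>i. cinner (Rep_ell2 f i) (Rep_ell2 g i) * cinner x y)"
    unfolding cinner_ell2_def
    by (simp add: Rep_etensor cinner_scaleC_left cinner_scaleC_right cinner_complex_def mult_ac)
  then show ?thesis
    by (simp add: infsum_cmult_left ell2_cinner_summable cinner_ell2_def)
qed

definition tensor_space ::
  "('i, complex) ell2 set \<Rightarrow> 'e :: complex_inner set \<Rightarrow> ('i, 'e) ell2 set" where
  "tensor_space M D = closure (cspan {etensor f x | f x. f \<in> M \<and> x \<in> D})"

text \<open>The ampliation \<open>A \<otimes> I\<^sub>D\<close> of an operator \<open>A\<close> on \<open>M\<close>; it is determined on \<open>tensor_space M D\<close>.\<close>

definition ampliation ::
  "('i, complex) ell2 set \<Rightarrow> 'e :: complex_inner set \<Rightarrow>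
   (('i, complex) ell2 \<Rightarrow> ('i, complex) ell2) \<Rightarrow> ('i, 'e) ell2 \<Rightarrow> ('i, 'e) ell2" where
  "ampliation M D A = (SOME R. bounded_op_on (tensor_space M D) (tensor_space M D) R \<and>
     (\<forall>f\<in>M. \<forall>x\<in>D. R (etensor f x) = etensor (A f) x))"

text \<open>
  The elementary tensor \<open>f 1 \<otimes> \<dots> \<otimes> f k\<close>.  A tuple of indices is a function on \<open>{1..k}\<close>, extended
  by \<open>undefined\<close> outside.
\<close>

definition ptensor ::
  "nat \<Rightarrow> (nat \<Rightarrow> ('w, complex) ell2) \<Rightarrow> (nat \<Rightarrow> 'w, complex) ell2" where
  "ptensor k f = Abs_ell2 (\<lambda>\<beta>. if \<beta> \<in> extensional {1..k} then \<Prod>i=1..k. Rep_ell2 (f i) (\<beta> i) else 0)"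

lemma Rep_ptensor:
  "Rep_ell2 (ptensor k f) \<beta> =
     (if \<beta> \<in> extensional {1..k} then \<Prod>i=1..k. Rep_ell2 (f i) (\<beta> i) else 0)"
proof -
  let ?g = "\<lambda>\<beta>. if \<beta> \<in> extensional {1..k} then \<Prod>i=1..k. Rep_ell2 (f i) (\<beta> i) else 0"
  have bd: "(\<Sum>\<beta>\<in>I. (norm (?g \<beta>))\<^sup>2) \<le> (\<Prod>i=1..k. (norm (f i))\<^sup>2)" if "finite I" for I
  proof -
    define J where "J i = (\<lambda>\<beta>. \<beta> i) ` I" for i
    have fin: "finite (J i)" for i using that by (simp add: J_def)
    have "(\<Sum>\<beta>\<in>I. (norm (?g \<beta>))\<^sup>2) = (\<Sum>\<beta>\<in>I \<inter> extensional {1..k}. (norm (?g \<beta>))\<^sup>2)"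
      by (rule sum.mono_neutral_right) (use that in auto)
    also have "\<dots> = (\<Sum>\<beta>\<in>I \<inter> extensional {1..k}. \<Prod>i=1..k. (norm (Rep_ell2 (f i) (\<beta> i)))\<^sup>2)"
      by (rule sum.cong) (auto simp: prod_norm[symmetric] prod_power_distrib)
    also have "\<dots> \<le> (\<Sum>\<beta>\<in>PiE {1..k} J. \<Prod>i=1..k. (norm (Rep_ell2 (f i) (\<beta> i)))\<^sup>2)"
    proof (rule sum_mono2)
      show "finite (PiE {1..k} J)" using fin by (intro finite_PiE) auto
      show "I \<inter> extensional {1..k} \<subseteq> PiE {1..k} J" by (auto simp: J_def PiE_def)
    qed (auto intro: prod_nonneg)
    also have "\<dots> = (\<Prod>i=1..k. \<Sum>w\<in>J i. (norm (Rep_ell2 (f i) w))\<^sup>2)"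
      by (rule prod_sum_PiE[symmetric]) (use fin in auto)
    also have "\<dots> \<le> (\<Prod>i=1..k. (norm (f i))\<^sup>2)"
      by (rule prod_mono) (auto intro!: sum_nonneg sum_norm_ell2_le fin)
    finally show ?thesis .
  qed
  have "?g \<in> {f. (\<lambda>i. (norm (f i))\<^sup>2) summable_on UNIV}"
    unfolding mem_Collect_eq
    by (rule nonneg_bdd_above_summable_on) (use bd in \<open>auto simp only: bdd_above_def zero_le_power2\<close>)
  then show ?thesis unfolding ptensor_def by (subst Abs_ell2_inverse) auto
qed

definition ptensor_space ::
  "nat \<Rightarrow> (nat \<Rightarrow> ('w, complex) ell2 set) \<Rightarrow> (nat \<Rightarrow> 'w, complex) ell2 set" where
  "ptensor_space k M = closure (cspan {ptensor k f | f. \<forall>i\<in>{1..k}. f i \<in> M i})"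

text \<open>
  The operator \<open>A 1 \<otimes> \<dots> \<otimes> A k\<close>, where \<open>A i\<close> is an operator on \<open>M i\<close>; it is determined on
  \<open>ptensor_space k M\<close>.
\<close>

definition ptensor_op ::
  "nat \<Rightarrow> (nat \<Rightarrow> ('w, complex) ell2 set) \<Rightarrow>
   (nat \<Rightarrow> ('w, complex) ell2 \<Rightarrow> ('w, complex) ell2) \<Rightarrow>
   (nat \<Rightarrow> 'w, complex) ell2 \<Rightarrow> (nat \<Rightarrow> 'w, complex) ell2" where
  "ptensor_op k M A = (SOME R. bounded_op_on (ptensor_space k M) (ptensor_space k M) R \<and>
     (\<forall>f. (\<forall>i\<in>{1..k}. f i \<in> M i) \<longrightarrow> R (ptensor k f) = ptensor k (\<lambda>i. A i (f i))))"


section \<open>Fock spaces\<close>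

text \<open>
  Words in the free semigroup on \<open>n\<close> generators are lists over \<open>{1..n}\<close>; \<open>ebasis \<alpha>\<close> is \<open>e\<^sub>\<alpha>\<close>.
\<close>

definition ebasis :: "'i \<Rightarrow> ('i, complex) ell2" where
  "ebasis \<alpha> = Abs_ell2 (\<lambda>\<beta>. if \<beta> = \<alpha> then 1 else 0)"

lemma Rep_ebasis: "Rep_ell2 (ebasis \<alpha>) \<beta> = (if \<beta> = \<alpha> then 1 else 0)"
proof -
  have "(\<lambda>\<beta>. (norm (if \<beta> = \<alpha> then 1 else 0 :: complex))\<^sup>2) summable_on {\<alpha>}" by simp
  then have "(\<lambda>\<beta>. (norm (if \<beta> = \<alpha> then 1 else 0 :: complex))\<^sup>2) summable_on UNIV"
    by (rule summable_on_cong_neutral[THEN iffD1, rotated -1]) auto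
  then show ?thesis unfolding ebasis_def by (subst Abs_ell2_inverse) auto
qed

definition fock :: "nat \<Rightarrow> (nat list, complex) ell2 set" where
  "fock n = closure (cspan (ebasis ` lists {1..n}))"

definition homogeneous :: "nat \<Rightarrow> (nat list, complex) ell2 \<Rightarrow> bool" where
  "homogeneous p f \<longleftrightarrow> (\<forall>\<alpha>. length \<alpha> \<noteq> p \<longrightarrow> Rep_ell2 f \<alpha> = 0)"

text \<open>Symmetric tensors of degree \<open>p\<close>: invariance under permutations of the \<open>p\<close> tensor factors.\<close>

definition symmetric_tensor :: "nat \<Rightarrow> nat \<Rightarrow> (nat list, complex) ell2 \<Rightarrow> bool" where
  "symmetric_tensor n p f \<longleftrightarrow> f \<in> fock n \<and> homogeneous p f \<and>
     (\<forall>\<pi> \<alpha>. \<pi> permutes {..<p} \<longrightarrow> length \<alpha> = p \<longrightarrow> Rep_ell2 f (permute_list \<pi> \<alpha>) = Rep_ell2 f \<alpha>)"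

definition sym_fock :: "nat \<Rightarrow> (nat list, complex) ell2 set" where
  "sym_fock n = closure (cspan {f. \<exists>p. symmetric_tensor n p f})"

text \<open>The left creation operator, \<open>S\<^sub>j e\<^sub>\<alpha> = e\<^bsub>j\<alpha>\<^esub>\<close>.\<close>

definition creation :: "nat \<Rightarrow> (nat list, complex) ell2 \<Rightarrow> (nat list, complex) ell2" where
  "creation j f =
     Abs_ell2 (\<lambda>\<alpha>. case \<alpha> of [] \<Rightarrow> 0 | a # \<alpha>' \<Rightarrow> if a = j then Rep_ell2 f \<alpha>' else 0)"

lemma Rep_creation:
  "Rep_ell2 (creation j f) =
     (\<lambda>\<alpha>. case \<alpha> of [] \<Rightarrow> 0 | a # \<alpha>' \<Rightarrow> if a = j then Rep_ell2 f \<alpha>' else 0)"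
  (is "_ = ?g")
proof -
  have "(\<lambda>\<alpha>. (norm (?g \<alpha>))\<^sup>2) summable_on range ((#) j)"
    by (subst summable_on_reindex) (auto simp: o_def ell2_summable inj_on_def)
  then have "(\<lambda>\<alpha>. (norm (?g \<alpha>))\<^sup>2) summable_on UNIV"
    by (rule summable_on_cong_neutral[THEN iffD1, rotated -1]) (auto split: list.splits)
  then show ?thesis unfolding creation_def by (subst Abs_ell2_inverse) auto
qed

lemma creation_ebasis: "creation j (ebasis \<alpha>) = ebasis (j # \<alpha>)"
  by (rule Rep_ell2_inject[THEN iffD1])
    (auto simp: fun_eq_iff Rep_creation Rep_ebasis split: list.splits)

text \<open>The compression \<open>B\<^sub>j\<close> of \<open>S\<^sub>j\<close> to the symmetric Fock space.\<close>

definition sym_creation :: "nat \<Rightarrow> nat \<Rightarrow> (nat list, complex) ell2 \<Rightarrow> (nat list, complex) ell2" where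
  "sym_creation n j f = proj (sym_fock n) (creation j f)"

text \<open>\<open>Q\<^sub>q\<close>\<close>

definition degree_proj :: "nat \<Rightarrow> nat \<Rightarrow> (nat list, complex) ell2 \<Rightarrow> (nat list, complex) ell2" where
  "degree_proj n q = proj {f \<in> sym_fock n. homogeneous q f}"

definition fock_tensor :: "nat \<Rightarrow> (nat \<Rightarrow> nat) \<Rightarrow> (nat \<Rightarrow> nat list, complex) ell2 set" where
  "fock_tensor k n = ptensor_space k (\<lambda>i. fock (n i))"

definition sym_fock_tensor :: "nat \<Rightarrow> (nat \<Rightarrow> nat) \<Rightarrow> (nat \<Rightarrow> nat list, complex) ell2 set" where
  "sym_fock_tensor k n = ptensor_space k (\<lambda>i. sym_fock (n i))"

text \<open>The operator \<open>I \<otimes> \<dots> \<otimes> B\<^sub>i\<^sub>,\<^sub>j \<otimes> \<dots> \<otimes> I\<close>.\<close>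

definition sym_shift ::
  "nat \<Rightarrow> (nat \<Rightarrow> nat) \<Rightarrow> nat \<Rightarrow> nat \<Rightarrow>
   (nat \<Rightarrow> nat list, complex) ell2 \<Rightarrow> (nat \<Rightarrow> nat list, complex) ell2" where
  "sym_shift k n i j =
     ptensor_op k (\<lambda>l. sym_fock (n l)) (\<lambda>l. if l = i then sym_creation (n i) j else id)"

text \<open>\<open>Q\<^bsub>q 1\<^esub> \<otimes> \<dots> \<otimes> Q\<^bsub>q k\<^esub>\<close>\<close>

definition multidegree_proj ::
  "nat \<Rightarrow> (nat \<Rightarrow> nat) \<Rightarrow> (nat \<Rightarrow> nat) \<Rightarrow>
   (nat \<Rightarrow> nat list, complex) ell2 \<Rightarrow> (nat \<Rightarrow> nat list, complex) ell2" where
  "multidegree_proj k n q =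
     ptensor_op k (\<lambda>i. sym_fock (n i)) (\<lambda>i. degree_proj (n i) (q i))"


section \<open>Regular polyballs\<close>

text \<open>Tuples \<open>X\<close> are families \<open>X i j\<close> with \<open>i \<in> {1..k}\<close> and \<open>j \<in> {1..n i}\<close>.\<close>

type_synonym 'h operator_tuple = "nat \<Rightarrow> nat \<Rightarrow> 'h \<Rightarrow> 'h"

text \<open>\<open>cp_map m X\<close> is \<open>\<Phi>\<^sub>X\<close> for a row \<open>X\<close> of length \<open>m\<close>.\<close>

definition cp_map :: "nat \<Rightarrow> (nat \<Rightarrow> 'h \<Rightarrow> 'h) \<Rightarrow> ('h \<Rightarrow> 'h) \<Rightarrow> 'h \<Rightarrow> 'h :: complex_inner" where
  "cp_map m X Y = (\<lambda>h. \<Sum>j=1..m. X j (Y (adj (X j) h)))"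

definition id_minus :: "(('h \<Rightarrow> 'h) \<Rightarrow> 'h \<Rightarrow> 'h) \<Rightarrow> ('h \<Rightarrow> 'h) \<Rightarrow> 'h \<Rightarrow> 'h :: complex_inner" where
  "id_minus F Y = (\<lambda>h. Y h - F Y h)"

definition polyball :: "nat \<Rightarrow> (nat \<Rightarrow> nat) \<Rightarrow> 'h :: chilbert_space operator_tuple set" where
  "polyball k n = {X.
     (\<forall>i\<in>{1..k}. \<forall>j\<in>{1..n i}. bounded_op (X i j)) \<and>
     (\<forall>s\<in>{1..k}. \<forall>t\<in>{1..k}. s \<noteq> t \<longrightarrow>
        (\<forall>i\<in>{1..n s}. \<forall>j\<in>{1..n t}. X s i \<circ> X t j = X t j \<circ> X s i)) \<and>
     (\<forall>p. (\<forall>i\<in>{1..k}. p i \<in> {0, 1 :: nat}) \<longrightarrow>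
        positive_op (comp_upto k (\<lambda>i. id_minus (cp_map (n i) (X i)) ^^ p i) id))}"

definition comm_polyball :: "nat \<Rightarrow> (nat \<Rightarrow> nat) \<Rightarrow> 'h :: chilbert_space operator_tuple set" where
  "comm_polyball k n = {X \<in> polyball k n.
     \<forall>s\<in>{1..k}. \<forall>t\<in>{1..k}. \<forall>i\<in>{1..n s}. \<forall>j\<in>{1..n t}. X s i \<circ> X t j = X t j \<circ> X s i}"

text \<open>The defect operator \<open>\<Delta>\<^sub>T(I)\<close> and the space \<open>D\<^sub>T\<close>.\<close>

definition defect_op :: "nat \<Rightarrow> (nat \<Rightarrow> nat) \<Rightarrow> 'h :: chilbert_space operator_tuple \<Rightarrow> 'h \<Rightarrow> 'h" where
  "defect_op k n T = comp_upto k (\<lambda>i. id_minus (cp_map (n i) (T i))) id"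

definition has_finite_rank ::
  "nat \<Rightarrow> (nat \<Rightarrow> nat) \<Rightarrow> 'h :: chilbert_space operator_tuple \<Rightarrow> bool" where
  "has_finite_rank k n T \<longleftrightarrow> finite_rank_op (defect_op k n T)"

definition defect_space ::
  "nat \<Rightarrow> (nat \<Rightarrow> nat) \<Rightarrow> 'h :: chilbert_space operator_tuple \<Rightarrow> 'h set" where
  "defect_space k n T = closure (range (defect_op k n T))"

definition word_op :: "(nat \<Rightarrow> 'h \<Rightarrow> 'h) \<Rightarrow> nat list \<Rightarrow> 'h \<Rightarrow> 'h" where
  "word_op X \<alpha> = foldr (\<lambda>j R. X j \<circ> R) \<alpha> id"

definition berezin_kernel ::
  "nat \<Rightarrow> (nat \<Rightarrow> nat) \<Rightarrow> 'h :: chilbert_space operator_tuple \<Rightarrow>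
   'h \<Rightarrow> (nat \<Rightarrow> nat list, 'h) ell2" where
  "berezin_kernel k n T h =
     (\<Sum>\<^sub>\<infinity>\<beta> \<in> PiE {1..k} (\<lambda>i. lists {1..n i}).
        etensor (ptensor k (\<lambda>i. ebasis (\<beta> i)))
          (sqrt_op (defect_op k n T) (comp_upto k (\<lambda>i. adj (word_op (T i) (\<beta> i))) h)))"

definition constrained_berezin_kernel ::
  "nat \<Rightarrow> (nat \<Rightarrow> nat) \<Rightarrow> 'h :: chilbert_space operator_tuple \<Rightarrow>
   'h \<Rightarrow> (nat \<Rightarrow> nat list, 'h) ell2" where
  "constrained_berezin_kernel k n T h =
     ampliation (fock_tensor k n) (defect_space k n T) (proj (sym_fock_tensor k n))
       (berezin_kernel k n T h)"

text \<open>
  The auxiliary Hilbert space is a type parameter: HOL has no quantification over types inside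
  formulas, but as a hypothesis the existence of some Hilbert space is expressed by a free type
  variable.
\<close>

definition has_constrained_char_fun ::
  "'e :: chilbert_space itself \<Rightarrow> nat \<Rightarrow> (nat \<Rightarrow> nat) \<Rightarrow> 'h :: chilbert_space operator_tuple \<Rightarrow> bool"
  where
  "has_constrained_char_fun _ k n T \<longleftrightarrow>
     (let F = sym_fock_tensor k n; D = defect_space k n T; K = constrained_berezin_kernel k n T in
      \<exists>\<Theta> :: (nat \<Rightarrow> nat list, 'e) ell2 \<Rightarrow> (nat \<Rightarrow> nat list, 'h) ell2.
        bounded_op_on (tensor_space F UNIV) (tensor_space F D) \<Theta> \<and>
        (\<forall>i\<in>{1..k}. \<forall>j\<in>{1..n i}. \<forall>x\<in>tensor_space F UNIV.
           \<Theta> (ampliation F UNIV (sym_shift k n i j) x)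
             = ampliation F D (sym_shift k n i j) (\<Theta> x)) \<and>
        (\<forall>y\<in>tensor_space F D. K (adj K y) + \<Theta> (adj_on (tensor_space F UNIV) \<Theta> y) = y))"


section \<open>Curvature\<close>

text \<open>Elements of \<open>\<int>\<^sub>+\<^sup>k\<close> are extensional functions on \<open>{1..k}\<close>.\<close>

definition multi_indices :: "nat \<Rightarrow> (nat \<Rightarrow> nat) set" where
  "multi_indices k = PiE {1..k} (\<lambda>_. UNIV)"

definition curv_mean ::
  "nat \<Rightarrow> (nat \<Rightarrow> nat) \<Rightarrow> 'h :: chilbert_space operator_tuple \<Rightarrow> nat \<Rightarrow> complex" where
  "curv_mean k n T m =
     1 / of_nat ((m + k) choose k) *
     (\<Sum>q | q \<in> multi_indices k \<and> (\<Sum>i=1..k. q i) \<le> m.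
        trace_on UNIV (\<lambda>h.
          adj (constrained_berezin_kernel k n T)
            (ampliation (sym_fock_tensor k n) (defect_space k n T) (multidegree_proj k n q)
              (constrained_berezin_kernel k n T h)))
        / trace_on (sym_fock_tensor k n) (multidegree_proj k n q))"

definition curv_c ::
  "nat \<Rightarrow> (nat \<Rightarrow> nat) \<Rightarrow> 'h :: chilbert_space operator_tuple \<Rightarrow> complex" where
  "curv_c k n T = lim (curv_mean k n T)"

text \<open>\<open>(\<Phi>\<^bsub>T 1\<^esub>\<^bsup>q 1\<^esup> \<circ> \<dots> \<circ> \<Phi>\<^bsub>T k\<^esub>\<^bsup>q k\<^esup>)(\<Delta>\<^sub>T(I))\<close>, and the quotient of its trace by the product of the traces
  of the projections \<open>Q\<^bsub>q i\<^esub>\<close>.\<close>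

definition iterated_defect ::
  "nat \<Rightarrow> (nat \<Rightarrow> nat) \<Rightarrow> 'h :: chilbert_space operator_tuple \<Rightarrow> (nat \<Rightarrow> nat) \<Rightarrow> 'h \<Rightarrow> 'h" where
  "iterated_defect k n T q =
     comp_upto k (\<lambda>i. cp_map (n i) (T i) ^^ q i) (defect_op k n T)"

definition defect_ratio ::
  "nat \<Rightarrow> (nat \<Rightarrow> nat) \<Rightarrow> 'h :: chilbert_space operator_tuple \<Rightarrow> (nat \<Rightarrow> nat) \<Rightarrow> complex" where
  "defect_ratio k n T q =
     trace_on UNIV (iterated_defect k n T q)
     / (\<Prod>i=1..k. trace_on (sym_fock (n i)) (degree_proj (n i) (q i)))"

definition coordinatewise_at_top :: "nat \<Rightarrow> (nat \<Rightarrow> nat) filter" where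
  "coordinatewise_at_top k =
     (INF p\<in>multi_indices k. principal {q \<in> multi_indices k. \<forall>i\<in>{1..k}. p i \<le> q i})"

text \<open>
  Iterated limit of a function of \<open>k\<close> integer arguments, given as a list; the limit in the first
  argument is the outermost one.
\<close>

fun has_iterated_limit :: "nat \<Rightarrow> (nat list \<Rightarrow> complex) \<Rightarrow> complex \<Rightarrow> bool" where
  "has_iterated_limit 0 f L \<longleftrightarrow> f [] = L"
| "has_iterated_limit (Suc k) f L \<longleftrightarrow>
     (\<exists>g. (\<forall>\<^sub>F q in sequentially. has_iterated_limit k (\<lambda>qs. f (q # qs)) (g q)) \<and> g \<longlonglongrightarrow> L)"

end

theory Submission
  imports Defs "HOL-Library.Function_Algebras" "HOL-Combinatorics.Multiset_Permutations"
begin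

text \<open>
  For a tuple \<open>a\<close> of multisets of letters let \<open>v\<^sub>a\<close> be the sum of the basis vectors of the \<open>N\<^sub>a\<close> tuples of
  words with these letters.  The \<open>v\<^sub>a\<close> form an orthogonal basis of the product of the symmetric Fock
  spaces, and commutativity of the entries of \<open>T\<close> makes the trace of \<open>K\<^sup>* Q\<^sub>q K\<close> equal to that of
  \<open>\<Phi>\<^sup>q(\<Delta>)\<close>, both being the sum of \<open>\<parallel>K\<^sup>*(v\<^sub>a \<otimes> u)\<parallel>\<^sup>2 / N\<^sub>a\<close> over all \<open>a\<close> of multidegree \<open>q\<close> and all \<open>u\<close> in
  an orthonormal eigenbasis of the defect operator.

  Put \<open>y\<^sub>a = \<Theta>\<^sup>*(v\<^sub>a \<otimes> u)\<close>.  The identity \<open>K K\<^sup>* + \<Theta> \<Theta>\<^sup>* = I\<close> gives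
  \<open>\<parallel>K\<^sup>*(v\<^sub>a \<otimes> u)\<parallel>\<^sup>2 = N\<^sub>a - \<parallel>y\<^sub>a\<parallel>\<^sup>2\<close>, the intertwining relation gives \<open>B\<^sub>j\<^sup>* y\<^sub>a = y\<close> at \<open>a\<close> with one letter \<open>j\<close>
  removed, and since the \<open>B\<^sub>j\<close> form a row contraction, \<open>\<parallel>y\<^sub>a\<parallel>\<^sup>2\<close> dominates the sum of the squared norms of
  these vectors.  Summing over \<open>a\<close> with the weights \<open>1 / N\<^sub>a\<close> reproduces exactly the growth factor
  \<open>(q + n) / (q + 1)\<close> of the trace of \<open>Q\<^sub>q\<close>.  Hence the quotient of the trace of \<open>\<Phi>\<^sup>q(\<Delta>)\<close> by the trace of
  \<open>Q\<^sub>q\<close> is nonnegative and decreasing in every \<open>q\<^sub>i\<close>, and all the limits equal its infimum.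
\<close>

section \<open>Hilbert space geometry\<close>

text \<open>Contractivity of the entries bounds the trace of \<open>\<Phi> i\<close> at a positive
  finite rank operator only by n_i times its trace, far from the factor (q + n) / (q + 1). The sharp
  bound comes from the complementary vectors, on which backward shifts act without coefficients
  because the v_a are left unnormalised.

  Another obstacle is that the operators of the statement are not given by formulas:
  \<open>trace_on\<close> fixes an arbitrary basis, \<open>ampliation\<close> and
  \<open>ptensor_op\<close> choose an operator, the Berezin kernel is an infinite sum. Each is
  identified with an explicit expression, by density of elementary tensors, by Parseval for finite
  rank, and by a Bessel inequality drawn from the positivity conditions of the polyball for initial
  segments of rows.

  For the last formula, telescoping gives the sum of all traces of multidegree at most q. The
  dimensions in this box add up to the product of the binomials (q_i + n_i choose n_i), each
  asymptotic to q_i^n_i / n_i!. The means converge because compositions with a small entry are a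
  fraction of order at most 1/m.\<close>

lemma cinner_add_right: "cinner x (y + z) = cinner x y + cinner x (z :: 'a :: complex_inner)"
  by (metis cinner_add_left cinner_commute complex_cnj_add)

lemma cinner_zero_left [simp]: "cinner 0 (x :: 'a :: complex_inner) = 0"
  using cinner_add_left[of 0 0 x] by simp

lemma cinner_zero_right [simp]: "cinner (x :: 'a :: complex_inner) 0 = 0"
  using cinner_add_right[of x 0 0] by simp

lemma cinner_diff_left: "cinner (x - y) z = cinner x z - cinner y (z :: 'a :: complex_inner)"
  using cinner_add_left[of "x - y" y z] by simp

lemma cinner_diff_right: "cinner x (y - z) = cinner x y - cinner x (z :: 'a :: complex_inner)"
  using cinner_add_right[of x "y - z" z] by simp

lemma cinner_sum_left: "cinner (\<Sum>i\<in>I. f i) x = (\<Sum>i\<in>I. cinner (f i) (x :: 'a :: complex_inner))"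
  by (induction I rule: infinite_finite_induct) (auto simp: cinner_add_left)

lemma cinner_sum_right: "cinner x (\<Sum>i\<in>I. f i) = (\<Sum>i\<in>I. cinner x (f i :: 'a :: complex_inner))"
  by (induction I rule: infinite_finite_induct) (auto simp: cinner_add_right)

lemma cinner_eq_zero_commute: "cinner x y = 0 \<longleftrightarrow> cinner y (x :: 'a :: complex_inner) = 0"
  by (metis cinner_commute complex_cnj_zero)

lemma cinner_self_eq_0: "cinner x x = 0 \<longleftrightarrow> x = (0 :: 'a :: complex_inner)"
  by (simp add: cinner_self)

lemma cinner_ext_left:
  assumes "\<And>z. cinner x z = cinner y (z :: 'a :: complex_inner)" shows "x = y"
proof -
  have "cinner (x - y) (x - y) = 0" using assms[of "x - y"] by (simp add: cinner_diff_left)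
  then show ?thesis by (simp add: cinner_self_eq_0)
qed

lemma bounded_linear_cinner_left: "bounded_linear (\<lambda>x. cinner x (y :: 'a :: complex_inner))"
  by (rule bounded_linear_intro[where K = "norm y"])
    (auto simp: cinner_add_left scaleR_eq_scaleC[where 'a = 'a] cinner_scaleC_left cmod_cinner_le
      scaleR_conv_of_real)

lemma bounded_linear_cinner_right: "bounded_linear (\<lambda>x. cinner (y :: 'a :: complex_inner) x)"
proof (rule bounded_linear_intro[where K = "norm y"])
  fix x show "cmod (cinner y x) \<le> norm x * norm y"
    using cmod_cinner_le[of y x] by (simp add: mult.commute)
qed (auto simp: cinner_add_right scaleR_eq_scaleC[where 'a = 'a] cinner_scaleC_right scaleR_conv_of_real)

lemma bounded_linear_scaleC: "bounded_linear (\<lambda>x. c *\<^sub>C (x :: 'a :: complex_inner))"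
  by (rule bounded_linear_intro[where K = "cmod c"])
    (auto simp: scaleC_add_right scaleR_eq_scaleC scaleC_scaleC norm_scaleC mult.commute)

lemma norm_add_sq_orth:
  assumes "cinner x (y :: 'a :: complex_inner) = 0"
  shows "(norm (x + y))\<^sup>2 = (norm x)\<^sup>2 + (norm y)\<^sup>2"
proof -
  have "cinner (x + y) (x + y) = cinner x x + cinner y y"
    using assms cinner_eq_zero_commute[of x y] by (simp add: cinner_add_left cinner_add_right)
  then have "complex_of_real ((norm (x + y))\<^sup>2) = complex_of_real ((norm x)\<^sup>2 + (norm y)\<^sup>2)"
    by (simp only: cinner_self of_real_add)
  then show ?thesis by (simp only: of_real_eq_iff)
qed

lemma norm_sum_sq_orth:
  assumes "finite I" "\<And>i j. i \<in> I \<Longrightarrow> j \<in> I \<Longrightarrow> i \<noteq> j \<Longrightarrow> cinner (f i) (f j :: 'a :: complex_inner) = 0"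
  shows "(norm (\<Sum>i\<in>I. f i))\<^sup>2 = (\<Sum>i\<in>I. (norm (f i))\<^sup>2)"
  using assms
proof (induction I rule: finite_induct)
  case (insert i I)
  have "cinner (f i) (\<Sum>i\<in>I. f i) = 0"
    unfolding cinner_sum_right by (rule sum.neutral) (use insert in auto)
  then show ?case using insert by (simp add: norm_add_sq_orth)
qed simp

subsection \<open>Closed subspaces and orthogonal projections\<close>

lemma csubspaceI:
  assumes "0 \<in> M" "\<And>x y. x \<in> M \<Longrightarrow> y \<in> M \<Longrightarrow> x + y \<in> M" "\<And>c x. x \<in> M \<Longrightarrow> c *\<^sub>C x \<in> M"
  shows "csubspace (M :: 'a :: complex_inner set)"
  using assms by (simp add: complex_vector.subspace_def)

lemma csubspace_UNIV: "csubspace UNIV"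
  by (rule csubspaceI) auto

lemma csubspace_closure:
  assumes "csubspace (M :: 'a :: complex_inner set)" shows "csubspace (closure M)"
proof (rule csubspaceI)
  show "0 \<in> closure M"
    using assms complex_vector.subspace_0 closure_subset by blast
next
  fix x y assume "x \<in> closure M" "y \<in> closure M"
  then obtain f g where "\<forall>n. f n \<in> M" "f \<longlonglongrightarrow> x" "\<forall>n. g n \<in> M" "g \<longlonglongrightarrow> y"
    unfolding closure_sequential by blast
  then have "\<forall>n. f n + g n \<in> M" "(\<lambda>n. f n + g n) \<longlonglongrightarrow> x + y"
    using assms by (auto intro: complex_vector.subspace_add tendsto_add)
  then show "x + y \<in> closure M"
    unfolding closure_sequential by (intro exI[of _ "\<lambda>n. f n + g n"] conjI)
next
  fix c x assume "x \<in> closure M"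
  then obtain f where "\<forall>n. f n \<in> M" "f \<longlonglongrightarrow> x"
    unfolding closure_sequential by blast
  then have "\<forall>n. c *\<^sub>C f n \<in> M" "(\<lambda>n. c *\<^sub>C f n) \<longlonglongrightarrow> c *\<^sub>C x"
    using assms by (auto intro: complex_vector.subspace_scale bounded_linear.tendsto[OF bounded_linear_scaleC])
  then show "c *\<^sub>C x \<in> closure M"
    unfolding closure_sequential by (intro exI[of _ "\<lambda>n. c *\<^sub>C f n"] conjI)
qed

lemma csubspace_closure_cspan: "csubspace (closure (cspan (G :: 'a :: complex_inner set)))"
  by (intro csubspace_closure complex_vector.subspace_span)

lemma closure_cspan_base: "x \<in> G \<Longrightarrow> x \<in> closure (cspan (G :: 'a :: complex_inner set))"
  using complex_vector.span_base closure_subset by blast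

lemma closure_cspan_minimal:
  assumes "G \<subseteq> M" "csubspace M" "closed (M :: 'a :: complex_inner set)"
  shows "closure (cspan G) \<subseteq> M"
  using assms by (simp add: closure_minimal complex_vector.span_minimal)

lemma closed_orthogonal: "closed {x. cinner z x = 0}" for z :: "'a :: complex_inner"
  by (intro closed_Collect_eq continuous_on_const linear_continuous_on bounded_linear_cinner_right)

lemma orthogonal_closure_cspan:
  assumes "\<And>g. g \<in> G \<Longrightarrow> cinner x g = 0" "z \<in> closure (cspan G)"
  shows "cinner x (z :: 'a :: complex_inner) = 0"
proof -
  have "csubspace {z. cinner x z = 0}"
    by (rule csubspaceI) (auto simp: cinner_add_right cinner_scaleC_right)
  then have "closure (cspan G) \<subseteq> {z. cinner x z = 0}"
    using assms(1) by (intro closure_cspan_minimal closed_orthogonal) auto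
  then show ?thesis using assms(2) by blast
qed

text \<open>Two candidates differ by a vector of \<open>M\<close> that is orthogonal to
  \<open>M\<close>, hence to itself. Explicit values of \<open>proj\<close> are computed through
  this criterion.\<close>

lemma proj_unique:
  assumes "csubspace M" "y \<in> M" "\<And>z. z \<in> M \<Longrightarrow> cinner (x - y) z = 0"
  shows "proj M x = (y :: 'a :: complex_inner)"
  unfolding proj_def
proof (rule the_equality)
  show "y \<in> M \<and> (\<forall>z\<in>M. cinner (x - y) z = 0)" using assms by blast
  fix y' assume y': "y' \<in> M \<and> (\<forall>z\<in>M. cinner (x - y') z = 0)"
  have "y' - y \<in> M" using assms y' by (simp add: complex_vector.subspace_diff)
  then have "cinner (x - y) (y' - y) - cinner (x - y') (y' - y) = 0"
    using assms y' by simp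
  then have "cinner (y' - y) (y' - y) = 0" by (simp add: cinner_diff_left)
  then show "y' = y" by (simp add: cinner_self_eq_0)
qed

lemma parallelogram:
  "(norm (x + y))\<^sup>2 + (norm (x - y))\<^sup>2 = 2 * (norm x)\<^sup>2 + 2 * (norm (y :: 'a :: real_inner))\<^sup>2"
  by (simp add: power2_norm_eq_inner inner_add_left inner_add_right inner_diff_left inner_diff_right)

text \<open>The nearest point: a minimising sequence for the distance to \<open>x\<close> is Cauchy
  by the parallelogram law, and completeness supplies its limit.\<close>

lemma proj_exists:
  fixes M :: "'a :: chilbert_space set"
  assumes M: "csubspace M" "closed M"
  shows "\<exists>y\<in>M. \<forall>z\<in>M. cinner (x - y) z = 0"
proof -
  define d where "d = Inf ((\<lambda>y. (norm (x - y))\<^sup>2) ` M)"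
  have ne: "M \<noteq> {}" using M complex_vector.subspace_0 by blast
  have d_le: "d \<le> (norm (x - y))\<^sup>2" if "y \<in> M" for y
    unfolding d_def by (rule cINF_lower) (use that in \<open>auto simp: bdd_below_def intro: exI[of _ 0]\<close>)
  have "\<exists>y\<in>M. (norm (x - y))\<^sup>2 < d + 1 / real (Suc m)" for m
  proof -
    have "d < d + 1 / real (Suc m)" by simp
    then show ?thesis unfolding d_def
      using ne by (subst (asm) (1) cInf_less_iff) (auto simp: bdd_below_def intro!: exI[of _ 0])
  qed
  then obtain f where f: "\<And>m. f m \<in> M" "\<And>m. (norm (x - f m))\<^sup>2 < d + 1 / real (Suc m)"
    by metis
  have half: "(1/2) *\<^sub>R (y + z) \<in> M" if "y \<in> M" "z \<in> M" for y z
    using that M(1) unfolding scaleR_eq_scaleC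
    by (intro complex_vector.subspace_scale complex_vector.subspace_add)
  \<comment> \<open>The midpoint of \<open>f a\<close> and \<open>f b\<close> lies in
    \<open>M\<close>, so its squared distance from \<open>x\<close> is at least \<open>d\<close>.
    The parallelogram law then leaves only twice the two excesses over \<open>d\<close>.\<close>
  have near: "(norm (f a - f b))\<^sup>2 \<le> 2 / real (Suc a) + 2 / real (Suc b)" for a b
  proof -
    have "(norm (x - f b + (x - f a)))\<^sup>2 + (norm (x - f b - (x - f a)))\<^sup>2
        = 2 * (norm (x - f b))\<^sup>2 + 2 * (norm (x - f a))\<^sup>2" by (rule parallelogram)
    moreover have "x - f b + (x - f a) = 2 *\<^sub>R (x - (1/2) *\<^sub>R (f a + f b))"
      by (simp add: algebra_simps scaleR_2)
    then have "(norm (x - f b + (x - f a)))\<^sup>2 = 4 * (norm (x - (1/2) *\<^sub>R (f a + f b)))\<^sup>2"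
      by (simp add: power_mult_distrib)
    moreover have "d \<le> (norm (x - (1/2) *\<^sub>R (f a + f b)))\<^sup>2" by (intro d_le half f)
    ultimately show ?thesis using f(2)[of a] f(2)[of b] by simp
  qed
  have "Cauchy f"
  proof (rule metric_CauchyI)
    fix e :: real assume "e > 0"
    obtain N where N: "inverse (real (Suc N)) < e\<^sup>2 / 4"
      using reals_Archimedean[of "e\<^sup>2 / 4"] \<open>e > 0\<close> by auto
    have "dist (f a) (f b) < e" if "a \<ge> N" "b \<ge> N" for a b
    proof -
      have "1 / real (Suc a) \<le> inverse (real (Suc N))" "1 / real (Suc b) \<le> inverse (real (Suc N))"
        using that by (auto simp: inverse_eq_divide intro!: divide_left_mono)
      then have "(norm (f a - f b))\<^sup>2 < e\<^sup>2" using near[of a b] N by linarith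
      then show ?thesis using \<open>e > 0\<close> by (simp add: dist_norm power_less_imp_less_base)
    qed
    then show "\<exists>M. \<forall>m\<ge>M. \<forall>n\<ge>M. dist (f m) (f n) < e" by blast
  qed
  then obtain y where y: "f \<longlonglongrightarrow> y" using Cauchy_convergent_iff convergent_def by blast
  have yM: "y \<in> M" using M(2) f(1) y closed_sequentially by blast
  have "(norm (x - y))\<^sup>2 \<le> d"
  proof (rule LIMSEQ_le)
    show "(\<lambda>m. (norm (x - f m))\<^sup>2) \<longlonglongrightarrow> (norm (x - y))\<^sup>2" by (intro tendsto_intros y)
    have "(\<lambda>m. d + 1 / real (Suc m)) \<longlonglongrightarrow> d + 0"
      by (intro tendsto_add tendsto_const LIMSEQ_Suc[OF lim_1_over_n])
    then show "(\<lambda>m. d + 1 / real (Suc m)) \<longlonglongrightarrow> d" by simp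
    show "\<exists>N. \<forall>n\<ge>N. (norm (x - f n))\<^sup>2 \<le> d + 1 / real (Suc n)" using f(2) less_imp_le by blast
  qed
  moreover have "cinner (x - y) z = 0" if z: "z \<in> M" and min: "(norm (x - y))\<^sup>2 \<le> d" for z
  proof (cases "z = 0")
    case False
    \<comment> \<open>The component of \<open>x - y\<close> along \<open>z\<close> is
      \<open>c\<close> times \<open>z\<close>; adding it to \<open>y\<close> would bring
      \<open>y\<close> closer to \<open>x\<close> unless it is zero.\<close>
    define c where "c = cinner (x - y) z / (norm z)\<^sup>2"
    have orth: "cinner (x - y - c *\<^sub>C z) (c *\<^sub>C z) = 0"
      using False by (simp add: cinner_diff_left cinner_scaleC_left cinner_scaleC_right cinner_self c_def)
    have "y + c *\<^sub>C z \<in> M" using M(1) yM z complex_vector.subspace_add complex_vector.subspace_scale by blast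
    then have "d \<le> (norm (x - y - c *\<^sub>C z))\<^sup>2" using d_le[of "y + c *\<^sub>C z"] by (simp add: diff_diff_eq)
    moreover have "(norm (x - y))\<^sup>2 = (norm (x - y - c *\<^sub>C z))\<^sup>2 + (norm (c *\<^sub>C z))\<^sup>2"
      using norm_add_sq_orth[OF orth] by simp
    ultimately have "(norm (c *\<^sub>C z))\<^sup>2 \<le> 0" using min by linarith
    then have "norm (c *\<^sub>C z) = 0" by simp
    then show ?thesis using False by (simp add: norm_scaleC c_def)
  qed simp
  ultimately show ?thesis using yM by blast
qed

context
  fixes M :: "'a :: chilbert_space set"
  assumes M: "csubspace M" "closed M"
begin

lemma proj_in: "proj M x \<in> M"
  and proj_orth: "z \<in> M \<Longrightarrow> cinner (x - proj M x) z = 0"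
proof -
  obtain y where y: "y \<in> M" "\<And>z. z \<in> M \<Longrightarrow> cinner (x - y) z = 0"
    using proj_exists[OF M] by blast
  then have "proj M x = y" using proj_unique M by blast
  then show "proj M x \<in> M" "z \<in> M \<Longrightarrow> cinner (x - proj M x) z = 0" using y by auto
qed

lemma cinner_proj: "z \<in> M \<Longrightarrow> cinner (proj M x) z = cinner x z"
  using proj_orth[of z x] by (simp add: cinner_diff_left)

lemma proj_add: "proj M (x + y) = proj M x + proj M y"
  by (rule proj_unique)
    (use M proj_in cinner_proj in
      \<open>auto simp: cinner_add_left cinner_diff_left intro!: complex_vector.subspace_add\<close>)

lemma proj_scaleC: "proj M (c *\<^sub>C x) = c *\<^sub>C proj M x"
  by (rule proj_unique)
    (use M proj_in cinner_proj in
      \<open>auto simp: cinner_scaleC_left cinner_diff_left intro!: complex_vector.subspace_scale\<close>)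

lemma norm_proj_le: "norm (proj M x) \<le> norm x"
proof -
  have "(norm (x - proj M x + proj M x))\<^sup>2 = (norm (x - proj M x))\<^sup>2 + (norm (proj M x))\<^sup>2"
    by (rule norm_add_sq_orth) (rule proj_orth[OF proj_in])
  then have "(norm (proj M x))\<^sup>2 \<le> (norm x)\<^sup>2" by simp
  then show ?thesis by (rule power2_le_imp_le) simp
qed

lemma bounded_op_on_proj: "bounded_op_on N M (proj M)"
  unfolding bounded_op_on_def using proj_in proj_add proj_scaleC norm_proj_le
  by (auto intro: exI[of _ 1])

end

subsection \<open>Bounded operators and adjoints\<close>

lemma bounded_op_onD:
  assumes "bounded_op_on M N A"
  shows "x \<in> M \<Longrightarrow> A x \<in> N" "x \<in> M \<Longrightarrow> y \<in> M \<Longrightarrow> A (x + y) = A x + A y"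
    "x \<in> M \<Longrightarrow> A (c *\<^sub>C x) = c *\<^sub>C A x"
  using assms unfolding bounded_op_on_def by auto

lemma bounded_op_on_bound:
  assumes "bounded_op_on M N A"
  obtains C where "C > 0" "\<And>x. x \<in> M \<Longrightarrow> norm (A x) \<le> C * norm x"
proof -
  obtain C where C: "\<And>x. x \<in> M \<Longrightarrow> norm (A x) \<le> C * norm x"
    using assms unfolding bounded_op_on_def by blast
  have "norm (A x) \<le> (\<bar>C\<bar> + 1) * norm x" if "x \<in> M" for x
    by (rule order_trans[OF C[OF that] mult_right_mono]) auto
  then show ?thesis using that[of "\<bar>C\<bar> + 1"] by simp
qed

lemma bounded_op_on_tendsto:
  assumes A: "bounded_op_on M N A" and M: "csubspace M"
    and f: "\<And>n. f n \<in> M" "f \<longlonglongrightarrow> x" "x \<in> M"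
  shows "(\<lambda>n. A (f n)) \<longlonglongrightarrow> A x"
proof -
  obtain C where C: "C > 0" "\<And>x. x \<in> M \<Longrightarrow> norm (A x) \<le> C * norm x"
    using bounded_op_on_bound[OF A] by blast
  have d: "A (f n) - A x = A (f n - x)" for n
    using bounded_op_onD(2)[OF A, of "f n - x" x] M f complex_vector.subspace_diff[of M "f n" x] by simp
  have "(\<lambda>n. C * norm (f n - x)) \<longlonglongrightarrow> C * 0"
    using f(2) by (intro tendsto_mult tendsto_const tendsto_norm_zero LIM_zero)
  then have lim: "(\<lambda>n. C * norm (f n - x)) \<longlonglongrightarrow> 0" by simp
  have "norm (A (f n) - A x) \<le> C * norm (f n - x)" for n
    unfolding d by (intro C(2) complex_vector.subspace_diff M f)
  then have "(\<lambda>n. A (f n) - A x) \<longlonglongrightarrow> 0"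
    by (intro Lim_null_comparison[OF _ lim] always_eventually allI)
  then show ?thesis by (rule LIM_zero_cancel)
qed

text \<open>The vectors on which two bounded operators agree form a closed subspace. This makes the
  operators introduced by choice, \<open>ampliation\<close> and \<open>ptensor_op\<close>,
  computable: their values on generators of the domain determine them.\<close>

lemma bounded_op_on_eqI:
  assumes A: "bounded_op_on (closure (cspan G)) N A" and B: "bounded_op_on (closure (cspan G)) N' B"
    and eq: "\<And>g. g \<in> G \<Longrightarrow> A g = B g" and x: "x \<in> closure (cspan G)"
  shows "A x = B x"
proof -
  let ?M = "closure (cspan G)"
  have M: "csubspace ?M" by (rule csubspace_closure_cspan)
  have zero: "A 0 = 0" "B 0 = 0"
    using bounded_op_onD(3)[OF A, of 0 0] bounded_op_onD(3)[OF B, of 0 0]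
      complex_vector.subspace_0[OF M] by auto
  have "csubspace {x \<in> ?M. A x = B x}"
    using M A B zero by (intro csubspaceI)
      (auto simp: bounded_op_onD complex_vector.subspace_0 complex_vector.subspace_add complex_vector.subspace_scale)
  moreover have "closed {x \<in> ?M. A x = B x}"
    unfolding closed_sequential_limits
  proof (intro allI impI)
    fix f l assume f: "(\<forall>n. f n \<in> {x \<in> ?M. A x = B x}) \<and> f \<longlonglongrightarrow> l"
    then have l: "l \<in> ?M" by (intro closed_sequentially[of ?M f l]) auto
    have "(\<lambda>n. A (f n)) \<longlonglongrightarrow> A l" "(\<lambda>n. B (f n)) \<longlonglongrightarrow> B l"
      by (rule bounded_op_on_tendsto[OF A M], use f l in auto)
        (rule bounded_op_on_tendsto[OF B M], use f l in auto)
    moreover have "(\<lambda>n. A (f n)) = (\<lambda>n. B (f n))" using f by auto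
    ultimately have "A l = B l" by (auto intro: LIMSEQ_unique)
    then show "l \<in> {x \<in> ?M. A x = B x}" using l by blast
  qed
  moreover have "G \<subseteq> {x \<in> ?M. A x = B x}" using eq closure_cspan_base by blast
  ultimately have "?M \<subseteq> {x \<in> ?M. A x = B x}" by (intro closure_cspan_minimal)
  then show ?thesis using x by blast
qed

text \<open>Riesz representation of the functional taking \<open>z\<close> to
  \<open>cinner (A z) y\<close> on \<open>M\<close>: if it is not zero, its kernel \<open>K\<close>
  is a proper closed subspace, and a vector \<open>w\<close> orthogonal to \<open>K\<close>
  represents it up to a scalar.\<close>

lemma adj_on_exists:
  fixes A :: "'a :: chilbert_space \<Rightarrow> 'b :: complex_inner"
  assumes M: "csubspace M" "closed M" and A: "bounded_op_on M N A"
  shows "\<exists>x. x \<in> M \<and> (\<forall>z\<in>M. cinner (A z) y = cinner z x)"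
proof (cases "\<forall>z\<in>M. cinner (A z) y = 0")
  case True
  then show ?thesis using complex_vector.subspace_0[OF M(1)] by (intro exI[of _ 0]) simp
next
  case False
  then obtain z0 where z0: "z0 \<in> M" "cinner (A z0) y \<noteq> 0" by blast
  define K where "K = {z \<in> M. cinner (A z) y = 0}"
  note AD = bounded_op_onD[OF A]
  note MD = complex_vector.subspace_0[OF M(1)] complex_vector.subspace_add[OF M(1)]
    complex_vector.subspace_scale[OF M(1)] complex_vector.subspace_diff[OF M(1)]
  have A0: "A 0 = 0" using AD(3)[of 0 0] MD(1) by simp
  have K: "csubspace K" unfolding K_def
    by (rule csubspaceI) (auto simp: A0 AD cinner_add_left cinner_scaleC_left intro!: MD)
  have "closed K" unfolding closed_sequential_limits
  proof (intro allI impI)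
    fix f l assume f: "(\<forall>n. f n \<in> K) \<and> f \<longlonglongrightarrow> l"
    then have l: "l \<in> M" using M(2) unfolding K_def by (intro closed_sequentially[of M f l]) auto
    have "(\<lambda>n. cinner (A (f n)) y) \<longlonglongrightarrow> cinner (A l) y"
      by (intro bounded_linear.tendsto[OF bounded_linear_cinner_left] bounded_op_on_tendsto[OF A M(1)])
        (use f l in \<open>auto simp: K_def\<close>)
    moreover have "(\<lambda>n. cinner (A (f n)) y) = (\<lambda>n. 0)" using f by (auto simp: K_def)
    ultimately have "(\<lambda>n. 0) \<longlonglongrightarrow> cinner (A l) y" by simp
    then have "cinner (A l) y = 0" by (simp add: LIMSEQ_const_iff)
    then show "l \<in> K" using l by (simp add: K_def)
  qed
  note P = proj_in[OF K this] proj_orth[OF K this]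
  define w where "w = z0 - proj K z0"
  have KM: "K \<subseteq> M" and KA: "\<And>z. z \<in> K \<Longrightarrow> cinner (A z) y = 0" by (auto simp: K_def)
  have PM: "proj K z0 \<in> M" using KM P(1) by blast
  have wM: "w \<in> M" unfolding w_def by (intro MD z0 PM)
  have "A z0 = A w + A (proj K z0)" using AD(2)[OF wM PM] by (simp add: w_def)
  moreover have "cinner (A (proj K z0)) y = 0" by (rule KA[OF P(1)])
  ultimately have Aw: "cinner (A w) y \<noteq> 0" using z0 by (simp add: cinner_add_left)
  then have w0: "w \<noteq> 0" using A0 by auto
  \<comment> \<open>Normalised so that \<open>cinner w (c *\<^sub>C w)\<close> equals
    \<open>cinner (A w) y\<close>; the conjugate is due to conjugate linearity in the second
    argument.\<close>
  define c where "c = cnj (cinner (A w) y) / (norm w)\<^sup>2"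
  have "cinner (A z) y = cinner z (c *\<^sub>C w)" if z: "z \<in> M" for z
  proof -
    \<comment> \<open>Subtracting this multiple of \<open>w\<close> moves \<open>z\<close> into the
      kernel \<open>K\<close>, hence makes it orthogonal to \<open>w\<close>.\<close>
    define t where "t = cinner (A z) y / cinner (A w) y"
    have tw: "t *\<^sub>C w \<in> M" by (intro MD wM)
    have zt: "z - t *\<^sub>C w \<in> M" by (intro MD z tw)
    have "A z = A (z - t *\<^sub>C w) + t *\<^sub>C A w" using AD(2)[OF zt tw] AD(3)[OF wM] by simp
    then have "cinner (A (z - t *\<^sub>C w)) y = cinner (A z) y - t * cinner (A w) y"
      by (simp add: cinner_add_left cinner_scaleC_left)
    then have "z - t *\<^sub>C w \<in> K" using zt Aw by (simp add: K_def t_def)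
    then have "cinner w (z - t *\<^sub>C w) = 0" using P(2) by (simp add: w_def)
    then have "cinner (z - t *\<^sub>C w) w = 0" using cinner_eq_zero_commute by blast
    then have "cinner z w = t * (norm w)\<^sup>2" by (simp add: cinner_diff_left cinner_scaleC_left cinner_self)
    then show ?thesis using Aw w0 by (simp add: cinner_scaleC_right c_def t_def)
  qed
  then show ?thesis by (intro exI[of _ "c *\<^sub>C w"] conjI ballI MD wM)
qed

lemma adj_on_unique:
  assumes M: "csubspace M" and x: "x \<in> M" "\<And>z. z \<in> M \<Longrightarrow> cinner (A z) y = cinner z (x :: 'a :: complex_inner)"
  shows "adj_on M A y = x"
  unfolding adj_on_def
proof (rule the_equality)
  show "x \<in> M \<and> (\<forall>z\<in>M. cinner (A z) y = cinner z x)" using x by blast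
  fix x' assume x': "x' \<in> M \<and> (\<forall>z\<in>M. cinner (A z) y = cinner z x')"
  then have "x' - x \<in> M" by (intro complex_vector.subspace_diff M x) simp
  then have "cinner (x' - x) x = cinner (x' - x) x'" using x(2)[of "x' - x"] x' by metis
  then have "cinner (x' - x) (x' - x) = 0" by (simp add: cinner_diff_right)
  then show "x' = x" by (simp add: cinner_self_eq_0)
qed

lemma adj_on_props:
  fixes A :: "'a :: chilbert_space \<Rightarrow> 'b :: complex_inner"
  assumes M: "csubspace M" "closed M" and A: "bounded_op_on M N A"
  shows adj_on_in: "adj_on M A y \<in> M"
    and cinner_adj_on: "z \<in> M \<Longrightarrow> cinner (A z) y = cinner z (adj_on M A y)"
proof -
  obtain x where x: "x \<in> M" "\<And>z. z \<in> M \<Longrightarrow> cinner (A z) y = cinner z x"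
    using adj_on_exists[OF assms] by blast
  then have "adj_on M A y = x" by (intro adj_on_unique[OF M(1)]) auto
  then show "adj_on M A y \<in> M" "z \<in> M \<Longrightarrow> cinner (A z) y = cinner z (adj_on M A y)" using x by auto
qed

lemma cinner_adj:
  fixes A :: "'a :: chilbert_space \<Rightarrow> 'b :: complex_inner"
  assumes "bounded_op A" shows "cinner (A z) y = cinner z (adj A y)"
  by (rule cinner_adj_on[OF csubspace_UNIV closed_UNIV assms]) simp

lemma cinner_adj':
  fixes A :: "'a :: chilbert_space \<Rightarrow> 'b :: complex_inner"
  assumes "bounded_op A" shows "cinner (adj A y) z = cinner y (A z)"
  using cinner_adj[OF assms, of z y] cinner_commute[of "adj A y" z] cinner_commute[of y "A z"] by simp

subsection \<open>Orthonormal bases and traces\<close>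

text \<open>Guarantees that the set selected by \<open>SOME\<close> in \<open>trace_on\<close>
  really is a basis. A maximal orthonormal set, from Zorn's lemma, has dense span, since otherwise a
  normalised residual of a projection would enlarge it.\<close>

lemma orthonormal_basis_exists:
  fixes M :: "'a :: chilbert_space set"
  assumes M: "csubspace M" "closed M"
  shows "\<exists>B. orthonormal_basis_of M B"
proof -
  define ON where "ON = {B. B \<subseteq> M \<and> (\<forall>x\<in>B. \<forall>y\<in>B. cinner x y = (if x = y then 1 else 0))}"
  have "\<exists>B\<in>ON. \<forall>X\<in>ON. B \<subseteq> X \<longrightarrow> X = B"
  proof (rule subset_Zorn')
    fix C assume C: "subset.chain ON C"
    then have CD: "\<And>X. X \<in> C \<Longrightarrow> X \<in> ON" "\<And>X Y. X \<in> C \<Longrightarrow> Y \<in> C \<Longrightarrow> X \<subseteq> Y \<or> Y \<subseteq> X"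
      by (auto simp: subset.chain_def subset_chain_def)
    have "cinner x y = (if x = y then 1 else 0)" if xy: "x \<in> \<Union>C" "y \<in> \<Union>C" for x y
    proof -
      obtain X Y where XY: "x \<in> X" "X \<in> C" "y \<in> Y" "Y \<in> C" using xy by blast
      then obtain Z where "Z \<in> C" "x \<in> Z" "y \<in> Z" using CD(2)[of X Y] by blast
      then show ?thesis using CD(1)[of Z] by (simp add: ON_def)
    qed
    moreover have "\<Union>C \<subseteq> M" using CD(1) by (auto simp: ON_def)
    ultimately show "\<Union>C \<in> ON" by (auto simp: ON_def)
  qed
  then obtain B where B: "B \<in> ON" and max: "\<And>X. X \<in> ON \<Longrightarrow> B \<subseteq> X \<Longrightarrow> X = B" by blast
  let ?S = "closure (cspan B)"
  note S = csubspace_closure_cspan[of B] closed_closure[of "cspan B"]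
  have sub: "?S \<subseteq> M" using B M by (intro closure_cspan_minimal) (auto simp: ON_def)
  have "x \<in> ?S" if x: "x \<in> M" for x
  proof (rule ccontr)
    assume "x \<notin> ?S"
    define w where "w = x - proj ?S x"
    have w0: "w \<noteq> 0" using \<open>x \<notin> ?S\<close> proj_in[OF S, of x] by (auto simp: w_def)
    have wM: "w \<in> M" using x sub proj_in[OF S, of x] M complex_vector.subspace_diff by (auto simp: w_def)
    have w_orth: "cinner w b = 0" if "b \<in> B" for b
      using proj_orth[OF S] closure_cspan_base[OF that] by (simp add: w_def)
    define u where "u = (1 / norm w) *\<^sub>C w"
    have "norm u = 1" using w0 by (simp add: u_def norm_scaleC norm_divide)
    then have u1: "cinner u u = 1" by (simp add: cinner_self)
    have u_orth: "cinner u b = 0" "cinner b u = 0" if "b \<in> B" for b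
      using w_orth[OF that] cinner_eq_zero_commute[of w b] by (auto simp: u_def cinner_scaleC_left cinner_scaleC_right)
    have "u \<in> M" using wM M complex_vector.subspace_scale by (auto simp: u_def)
    then have "insert u B \<in> ON" using B u1 u_orth by (auto simp: ON_def)
    then have "u \<in> B" using max[of "insert u B"] by blast
    then show False using u_orth(1) u1 by fastforce
  qed
  then have "?S = M" using sub by blast
  moreover have "\<forall>x\<in>B. \<forall>y\<in>B. cinner x y = (if x = y then 1 else 0)"
    using B by (simp add: ON_def)
  ultimately have "orthonormal_basis_of M B" unfolding orthonormal_basis_of_def by blast
  then show ?thesis ..
qed

text \<open>A finite subsum over \<open>X\<close> is the best approximation of \<open>v\<close> from
  the span of \<open>X\<close>, so it is at least as close to \<open>v\<close> as any
  \<open>w\<close> in the span of a finite \<open>F\<close> contained in \<open>X\<close>.\<close>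

lemma orthonormal_expansion:
  assumes B: "orthonormal_basis_of M B" and v: "v \<in> (M :: 'a :: complex_inner set)"
  shows "((\<lambda>e. cinner v e *\<^sub>C e) has_sum v) B"
  unfolding has_sum_def tendsto_iff eventually_finite_subsets_at_top
proof (intro allI impI)
  fix \<epsilon> :: real assume "\<epsilon> > 0"
  have on: "\<And>x y. x \<in> B \<Longrightarrow> y \<in> B \<Longrightarrow> cinner x y = (if x = y then 1 else 0)"
    using B by (auto simp: orthonormal_basis_of_def)
  have "v \<in> closure (cspan B)" using B v by (auto simp: orthonormal_basis_of_def)
  then obtain w where w: "w \<in> cspan B" "dist w v < \<epsilon>" using \<open>\<epsilon> > 0\<close> closure_approachable by blast
  then obtain F c where F: "finite F" "F \<subseteq> B" "w = (\<Sum>a\<in>F. c a *\<^sub>C a)"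
    by (auto simp: complex_vector.span_explicit)
  have "dist (\<Sum>e\<in>X. cinner v e *\<^sub>C e) v < \<epsilon>" if X: "finite X" "F \<subseteq> X" "X \<subseteq> B" for X
  proof -
    define s where "s = (\<Sum>e\<in>X. cinner v e *\<^sub>C e)"
    define c' where "c' e = (if e \<in> F then c e else 0)" for e
    have w': "w = (\<Sum>e\<in>X. c' e *\<^sub>C e)"
      unfolding F(3) c'_def by (rule sum.mono_neutral_cong_left) (use X F in auto)
    have sw: "s - w = (\<Sum>e\<in>X. (cinner v e - c' e) *\<^sub>C e)"
      by (simp add: s_def w' sum_subtractf[symmetric] complex_vector.scale_left_diff_distrib)
    have vs: "cinner (v - s) e = 0" if "e \<in> X" for e
    proof -
      have "cinner s e = (\<Sum>e'\<in>X. if e' = e then cinner v e' else 0)"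
        unfolding s_def cinner_sum_left cinner_scaleC_left
      proof (rule sum.cong[OF refl])
        fix e' assume "e' \<in> X"
        then have "cinner e' e = (if e' = e then 1 else 0)" using on X(3) \<open>e \<in> X\<close> by blast
        then show "cinner v e' * cinner e' e = (if e' = e then cinner v e' else 0)" by simp
      qed
      then show ?thesis using that X by (simp add: cinner_diff_left)
    qed
    have "cinner (v - s) (s - w) = 0"
      unfolding sw cinner_sum_right by (simp add: cinner_scaleC_right vs)
    then have "(norm (v - s + (s - w)))\<^sup>2 = (norm (v - s))\<^sup>2 + (norm (s - w))\<^sup>2"
      by (rule norm_add_sq_orth)
    then have "(norm (v - s))\<^sup>2 \<le> (norm (v - w))\<^sup>2" by simp
    then have "norm (v - s) \<le> norm (v - w)" by (rule power2_le_imp_le) simp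
    then show ?thesis using w(2) by (simp add: s_def dist_norm norm_minus_commute[of v])
  qed
  then show "\<exists>X. finite X \<and> X \<subseteq> B \<and> (\<forall>Y. finite Y \<and> X \<subseteq> Y \<and> Y \<subseteq> B \<longrightarrow> dist (\<Sum>e\<in>Y. cinner v e *\<^sub>C e) v < \<epsilon>)"
    using F by blast
qed

lemma parseval:
  assumes B: "orthonormal_basis_of M B" and v: "v \<in> (M :: 'a :: complex_inner set)"
  shows "((\<lambda>e. cinner v e * cinner e u) has_sum cinner v u) B"
  using has_sum_bounded_linear[OF bounded_linear_cinner_left orthonormal_expansion[OF assms], of u]
  by (simp add: cinner_scaleC_left o_def)

lemma has_sum_finite_sum:
  fixes f :: "'i \<Rightarrow> 'a \<Rightarrow> 'b :: topological_comm_monoid_add"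
  assumes "finite I" "\<And>i. i \<in> I \<Longrightarrow> (f i has_sum s i) A"
  shows "((\<lambda>x. \<Sum>i\<in>I. f i x) has_sum (\<Sum>i\<in>I. s i)) A"
  using assms by (induction I rule: finite_induct) (auto intro!: has_sum_add)

text \<open>Parseval in each of the finitely many rank one terms gives a value in which the basis no
  longer occurs. All traces below are evaluated by writing the operator in this form.\<close>

lemma trace_on_finite_sum:
  fixes M :: "'a :: chilbert_space set"
  assumes M: "csubspace M" "closed M" and "finite I" and v: "\<And>i. i \<in> I \<Longrightarrow> v i \<in> M"
    and A: "\<And>h. h \<in> M \<Longrightarrow> A h = (\<Sum>i\<in>I. cinner h (u i) *\<^sub>C v i)"
  shows "trace_on M A = (\<Sum>i\<in>I. cinner (v i) (u i))"
proof -
  define B where "B = (SOME B. orthonormal_basis_of M B)"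
  have B: "orthonormal_basis_of M B"
    unfolding B_def by (rule someI_ex[OF orthonormal_basis_exists[OF M]])
  then have BM: "B \<subseteq> M" using closure_cspan_base[of _ B] by (auto simp: orthonormal_basis_of_def)
  have "((\<lambda>e. \<Sum>i\<in>I. cinner (v i) e * cinner e (u i)) has_sum (\<Sum>i\<in>I. cinner (v i) (u i))) B"
    by (rule has_sum_finite_sum) (use parseval[OF B] v \<open>finite I\<close> in auto)
  also have "?this \<longleftrightarrow> ((\<lambda>e. cinner (A e) e) has_sum (\<Sum>i\<in>I. cinner (v i) (u i))) B"
  proof (rule has_sum_cong)
    fix e assume "e \<in> B"
    then have "A e = (\<Sum>i\<in>I. cinner e (u i) *\<^sub>C v i)" using BM A by blast
    then show "(\<Sum>i\<in>I. cinner (v i) e * cinner e (u i)) = cinner (A e) e"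
      by (simp add: cinner_sum_left cinner_scaleC_left mult.commute)
  qed
  finally show ?thesis unfolding trace_on_def B_def[symmetric] by (rule infsumI)
qed

section \<open>Positive operators of finite rank\<close>

lemma bounded_opD:
  assumes "bounded_op A"
  shows "A (x + y) = A x + A y" "A (c *\<^sub>C x) = c *\<^sub>C A x" "A 0 = 0" "A (x - y) = A x - A y"
    "A (sum f I) = (\<Sum>i\<in>I. A (f i))"
proof -
  show add: "A (x + y) = A x + A y" for x y using bounded_op_onD(2)[OF assms] by simp
  show "A (c *\<^sub>C x) = c *\<^sub>C A x" using bounded_op_onD(3)[OF assms] by simp
  show zero: "A 0 = 0" using bounded_op_onD(3)[OF assms, of 0 0] by simp
  show "A (x - y) = A x - A y" using add[of "x - y" y] by simp
  show "A (sum f I) = (\<Sum>i\<in>I. A (f i))"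
    by (induction I rule: infinite_finite_induct) (auto simp: zero add)
qed

lemma bounded_op_imp_bounded_linear:
  assumes "bounded_op A" shows "bounded_linear A"
proof -
  obtain C where "C > 0" "\<And>x. x \<in> UNIV \<Longrightarrow> norm (A x) \<le> C * norm x"
    using bounded_op_on_bound[OF assms] by blast
  then show ?thesis
    by (intro bounded_linear_intro[where K = C])
      (auto simp: bounded_opD[OF assms] scaleR_eq_scaleC mult.commute)
qed

lemma positive_op_hermitian:
  assumes "positive_op A" shows "cinner (A x) y = cinner x (A y)"
proof -
  have A: "bounded_op A" and pos: "\<And>h. cinner (A h) h \<in> \<real>\<^sub>\<ge>\<^sub>0"
    using assms by (auto simp: positive_op_def)
  have im: "Im (cinner (A h) h) = 0" for h
    using pos[of h] by (simp add: complex_nonneg_Reals_iff)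
  define p q where "p = cinner (A x) y" and "q = cinner (A y) x"
  have "cinner (A (x + y)) (x + y) = cinner (A x) x + cinner (A y) y + (p + q)"
    by (simp add: bounded_opD[OF A] cinner_add_left cinner_add_right p_def q_def)
  then have 1: "Im p + Im q = 0" using im[of "x + y"] im[of x] im[of y] by simp
  have "cinner (A (x + \<i> *\<^sub>C y)) (x + \<i> *\<^sub>C y) = cinner (A x) x + cinner (A y) y + \<i> * (q - p)"
    by (simp add: bounded_opD[OF A] cinner_add_left cinner_add_right cinner_scaleC_left
        cinner_scaleC_right p_def q_def algebra_simps)
  then have 2: "Re q - Re p = 0" using im[of "x + \<i> *\<^sub>C y"] im[of x] im[of y] by simp
  have "p = cnj q" using 1 2 by (simp add: complex_eq_iff)
  then show ?thesis by (simp add: p_def q_def cinner_commute[of x "A y"])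
qed

lemma quadratic_nonneg_imp_zero:
  fixes a b :: real
  assumes "a \<ge> 0" "\<And>t. 0 \<le> 2 * t * a + t\<^sup>2 * b" shows "a = 0"
proof (rule ccontr)
  assume "a \<noteq> 0"
  then have a: "a > 0" using assms by simp
  \<comment> \<open>Negative, and so small that the quadratic term cannot make up for the linear
    one.\<close>
  define t where "t = - a / (\<bar>b\<bar> + 1)"
  have t: "t < 0" using a by (simp add: t_def divide_neg_pos)
  have "\<bar>t * b\<bar> \<le> a" using a by (simp add: t_def abs_mult field_simps)
  then have "2 * a + t * b > 0" using a by linarith
  then have "t * (2 * a + t * b) < 0" using t by (simp add: mult_neg_pos)
  then show False using assms(2)[of t] by (simp add: algebra_simps power2_eq_square)
qed

text \<open>Vary \<open>u\<close> in the direction \<open>C u\<close>: the quadratic form is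
  nonnegative along this line, vanishes at \<open>u\<close> and has derivative twice the squared
  norm of \<open>C u\<close> there. Positivity is asked on a subspace because the operator
  \<open>l - A\<close> of the spectral argument below is known to be nonnegative only there.\<close>

lemma psd_kernel:
  fixes C :: "'a :: complex_inner \<Rightarrow> 'a"
  assumes C: "bounded_op C" and herm: "\<And>x y. cinner (C x) y = cinner x (C y)"
    and W: "csubspace W" and pos: "\<And>x. x \<in> W \<Longrightarrow> Re (cinner (C x) x) \<ge> 0"
    and u: "u \<in> W" "C u \<in> W" "Re (cinner (C u) u) = 0"
  shows "C u = 0"
proof -
  have "0 \<le> 2 * t * (norm (C u))\<^sup>2 + t\<^sup>2 * Re (cinner (C (C u)) (C u))" for t :: real
  proof -
    have "u + complex_of_real t *\<^sub>C C u \<in> W"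
      using u W by (intro complex_vector.subspace_add complex_vector.subspace_scale)
    from pos[OF this] show ?thesis
      using u(3) herm[of "C u" u]
      by (simp add: bounded_opD[OF C] cinner_add_left cinner_add_right cinner_scaleC_left
          cinner_scaleC_right cinner_self power2_eq_square algebra_simps)
  qed
  then have "(norm (C u))\<^sup>2 = 0" by (intro quadratic_nonneg_imp_zero) auto
  then show ?thesis by simp
qed

definition orthonormal :: "'a :: complex_inner set \<Rightarrow> bool" where
  "orthonormal E \<longleftrightarrow> (\<forall>x\<in>E. \<forall>y\<in>E. cinner x y = (if x = y then 1 else 0))"

lemma orthonormalD: "orthonormal E \<Longrightarrow> x \<in> E \<Longrightarrow> y \<in> E \<Longrightarrow> cinner x y = (if x = y then 1 else 0)"
  by (simp add: orthonormal_def)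

lemma cinner_orthonormal_sum:
  assumes "orthonormal E" "finite E" "e \<in> E"
  shows "cinner (\<Sum>u\<in>E. c u *\<^sub>C u) e = c e"
proof -
  have "cinner (\<Sum>u\<in>E. c u *\<^sub>C u) e = (\<Sum>u\<in>E. if u = e then c u else 0)"
    unfolding cinner_sum_left cinner_scaleC_left
    by (rule sum.cong) (auto simp: orthonormalD[OF assms(1) _ assms(3)])
  then show ?thesis using assms by simp
qed

lemma orthonormal_independent:
  assumes "orthonormal E" shows "complex_vector.independent E"
  unfolding complex_vector.independent_explicit_finite_subsets
proof (intro allI impI ballI)
  fix S u v assume S: "S \<subseteq> E" "finite S" "(\<Sum>v\<in>S. u v *\<^sub>C v) = 0" "v \<in> S"
  have "orthonormal S" using assms S(1) unfolding orthonormal_def by blast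
  from cinner_orthonormal_sum[OF this S(2,4), of u] show "u v = 0" using S(3) by simp
qed

text \<open>Orthonormal subsets of \<open>cspan B\<close> are independent, so \<open>card B\<close>
  bounds their size and a largest one exists. With \<open>Q\<close> always true it is an orthonormal
  basis; with \<open>Q\<close> selecting eigenvectors it is as large an orthonormal family of them
  as possible.\<close>

lemma maximal_orthonormal:
  assumes B: "finite B"
  obtains E where "finite E" "orthonormal E" "E \<subseteq> {x \<in> cspan B. Q x}"
    "\<And>u. u \<in> cspan B \<Longrightarrow> Q u \<Longrightarrow> norm u = 1 \<Longrightarrow> \<exists>e\<in>E. cinner u e \<noteq> 0"
proof -
  let ?P = "\<lambda>E. orthonormal E \<and> E \<subseteq> {x \<in> cspan B. Q x}"
  have fin: "finite E \<and> card E \<le> card B" if "?P E" for E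
    using complex_vector.independent_span_bound[OF B, of E] orthonormal_independent that by blast
  have "\<exists>E. ?P E \<and> (\<forall>E'. ?P E' \<longrightarrow> card E' \<le> card E)"
  proof (rule ex_has_greatest_nat[where P = ?P and f = card and k = "{}" and b = "Suc (card B)"])
    show "?P {}" by (simp add: orthonormal_def)
    show "\<forall>E. ?P E \<longrightarrow> card E < Suc (card B)" using fin less_Suc_eq_le by blast
  qed
  then obtain E where E: "?P E" and max: "\<And>E'. ?P E' \<Longrightarrow> card E' \<le> card E" by blast
  have "\<exists>e\<in>E. cinner u e \<noteq> 0" if u: "u \<in> cspan B" "Q u" "norm u = 1" for u
  proof (rule ccontr)
    assume "\<not> ?thesis"
    then have o: "\<And>e. e \<in> E \<Longrightarrow> cinner u e = 0" "\<And>e. e \<in> E \<Longrightarrow> cinner e u = 0"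
      using cinner_eq_zero_commute[of u] by auto
    have u1: "cinner u u = 1" using u by (simp add: cinner_self)
    then have "u \<notin> E" using o by fastforce
    moreover have "orthonormal (insert u E)" using E u1 o by (auto simp: orthonormal_def)
    then have "?P (insert u E)" using E u by blast
    from max[OF this] have "card (insert u E) \<le> card E" .
    ultimately show False using fin[OF E] by simp
  qed
  then show ?thesis using that E fin by blast
qed

text \<open>A compact polydisc of coefficients is mapped linearly, one coefficient at a time. This
  supplies the compactness needed to attain the maximum of a quadratic form on a finite-dimensional
  subspace.\<close>

lemma compact_coefficient_ball:
  assumes "finite (E :: 'a :: complex_inner set)"
  shows "compact {\<Sum>e\<in>E. c e *\<^sub>C e | c. \<forall>e\<in>E. cmod (c e) \<le> 1}"
  using assms
proof (induction E rule: finite_induct)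
  case (insert a E)
  let ?K = "{\<Sum>e\<in>E. c e *\<^sub>C e | c. \<forall>e\<in>E. cmod (c e) \<le> 1}"
  have "bounded_linear (\<lambda>z. z *\<^sub>C a)"
    by (rule bounded_linear_intro[where K = "norm a"])
      (auto simp: scaleC_add_left norm_scaleC scaleR_eq_scaleC[where 'a = 'a] scaleC_scaleC scaleR_conv_of_real)
  then have "compact ((\<lambda>z. z *\<^sub>C a) ` cball 0 1)"
    by (intro compact_continuous_image linear_continuous_on compact_cball)
  then have "compact {x + y | x y. x \<in> (\<lambda>z. z *\<^sub>C a) ` cball 0 1 \<and> y \<in> ?K}"
    using insert.IH by (rule compact_sums)
  also have "{x + y | x y. x \<in> (\<lambda>z. z *\<^sub>C a) ` cball 0 1 \<and> y \<in> ?K}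
      = {\<Sum>e\<in>insert a E. c e *\<^sub>C e | c. \<forall>e\<in>insert a E. cmod (c e) \<le> 1}" (is "?L = ?R")
  proof (intro equalityI subsetI)
    fix x assume "x \<in> ?L"
    then obtain z c where z: "cmod z \<le> 1" "\<forall>e\<in>E. cmod (c e) \<le> 1" "x = z *\<^sub>C a + (\<Sum>e\<in>E. c e *\<^sub>C e)"
      by auto
    have "(\<Sum>e\<in>E. (c(a := z)) e *\<^sub>C e) = (\<Sum>e\<in>E. c e *\<^sub>C e)"
      by (rule sum.cong) (use insert.hyps in auto)
    then have "x = (\<Sum>e\<in>insert a E. (c(a := z)) e *\<^sub>C e)" using insert.hyps z by simp
    then show "x \<in> ?R" using z by (intro CollectI exI[of _ "c(a := z)"]) auto
  next
    fix x assume "x \<in> ?R"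
    then obtain c where c: "\<forall>e\<in>insert a E. cmod (c e) \<le> 1" "x = (\<Sum>e\<in>insert a E. c e *\<^sub>C e)" by blast
    then have "x = c a *\<^sub>C a + (\<Sum>e\<in>E. c e *\<^sub>C e)" using insert.hyps by simp
    moreover have "c a *\<^sub>C a \<in> (\<lambda>z. z *\<^sub>C a) ` cball 0 1" using c by auto
    moreover have "(\<Sum>e\<in>E. c e *\<^sub>C e) \<in> ?K" using c by blast
    ultimately show "x \<in> ?L" by blast
  qed
  finally show ?case .
qed simp

text \<open>\<open>E\<close> is a maximal orthonormal set of eigenvectors with positive eigenvalue
  inside the finite-dimensional \<open>cspan B\<close>. If \<open>A\<close> did not vanish on the
  orthogonal complement of \<open>E\<close>, maximising its quadratic form there would produce one
  more such eigenvector.\<close>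

lemma finite_rank_spectral:
  fixes A :: "'a :: chilbert_space \<Rightarrow> 'a"
  assumes pos: "positive_op A" and fin: "finite_rank_op A"
  obtains E lam where "finite E" "orthonormal E" "\<And>u. u \<in> E \<Longrightarrow> lam u > (0 :: real)"
    "\<And>u. u \<in> E \<Longrightarrow> A u = complex_of_real (lam u) *\<^sub>C u"
    "\<And>h. A h = (\<Sum>u\<in>E. (complex_of_real (lam u) * cinner h u) *\<^sub>C u)"
proof -
  have A: "bounded_op A" and posA: "\<And>h. cinner (A h) h \<in> \<real>\<^sub>\<ge>\<^sub>0"
    using pos by (auto simp: positive_op_def)
  note herm = positive_op_hermitian[OF pos]
  have reA: "Re (cinner (A h) h) \<ge> 0" for h
    using posA[of h] by (simp add: complex_nonneg_Reals_iff)
  obtain B where B: "finite B" "range A \<subseteq> cspan B" using fin by (auto simp: finite_rank_op_def)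
  obtain F where F: "finite F" "orthonormal F" "F \<subseteq> {x \<in> cspan B. True}"
    "\<And>u. u \<in> cspan B \<Longrightarrow> True \<Longrightarrow> norm u = 1 \<Longrightarrow> \<exists>e\<in>F. cinner u e \<noteq> 0"
    by (rule maximal_orthonormal[OF B(1), of "\<lambda>_. True"]) blast
  have spanB: "csubspace (cspan B)" by (rule complex_vector.subspace_span)
  have F_exp: "x = (\<Sum>e\<in>F. cinner x e *\<^sub>C e)" if x: "x \<in> cspan B" for x
  proof (rule ccontr)
    define w where "w = x - (\<Sum>e\<in>F. cinner x e *\<^sub>C e)"
    assume "x \<noteq> (\<Sum>e\<in>F. cinner x e *\<^sub>C e)"
    then have w0: "w \<noteq> 0" by (simp add: w_def)
    have "(\<Sum>e\<in>F. cinner x e *\<^sub>C e) \<in> cspan B"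
      using F(3) by (intro complex_vector.subspace_sum[OF spanB] complex_vector.subspace_scale[OF spanB]) auto
    then have "w \<in> cspan B" unfolding w_def by (intro complex_vector.subspace_diff[OF spanB] x)
    then have "(1 / norm w) *\<^sub>C w \<in> cspan B" by (rule complex_vector.subspace_scale[OF spanB])
    moreover have "norm (complex_of_real (1 / norm w) *\<^sub>C w) = 1" using w0 by (simp add: norm_scaleC norm_divide)
    ultimately obtain e where e: "e \<in> F" "cinner ((1 / norm w) *\<^sub>C w) e \<noteq> 0" using F(4) by fastforce
    have "cinner w e = 0"
      using cinner_orthonormal_sum[OF F(2,1) e(1), of "cinner x"] by (simp add: w_def cinner_diff_left)
    then show False using e(2) by (simp add: cinner_scaleC_left)
  qed
  let ?Q = "\<lambda>u. \<exists>l>0. A u = complex_of_real l *\<^sub>C u"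
  obtain E where E: "finite E" "orthonormal E" "E \<subseteq> {x \<in> cspan B. ?Q x}"
    "\<And>u. u \<in> cspan B \<Longrightarrow> ?Q u \<Longrightarrow> norm u = 1 \<Longrightarrow> \<exists>e\<in>E. cinner u e \<noteq> 0"
    by (rule maximal_orthonormal[OF B(1), of ?Q]) blast
  have "\<forall>u\<in>E. ?Q u" using E(3) by blast
  then obtain lam where lam: "\<And>u. u \<in> E \<Longrightarrow> lam u > 0" "\<And>u. u \<in> E \<Longrightarrow> A u = complex_of_real (lam u) *\<^sub>C u"
    by metis
  have ker: "A h = 0" if h: "\<And>e. e \<in> E \<Longrightarrow> cinner h e = 0" for h
  proof (rule ccontr)
    assume Ah: "A h \<noteq> 0"
    define W where "W = {x \<in> cspan B. \<forall>e\<in>E. cinner x e = 0}"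
    have W: "csubspace W" unfolding W_def
      by (rule csubspaceI)
        (auto simp: cinner_add_left cinner_scaleC_left complex_vector.span_zero
          intro: complex_vector.span_add complex_vector.span_scale)
    have AW: "A x \<in> W" if "\<And>e. e \<in> E \<Longrightarrow> cinner x e = 0" for x
      using B(2) that lam(2) by (auto simp: W_def herm cinner_scaleC_right)
    \<comment> \<open>The unit sphere of \<open>W\<close>, written as a closed part of a coefficient
      polydisc so that its compactness is evident.\<close>
    define S where "S = {\<Sum>e\<in>F. c e *\<^sub>C e | c. \<forall>e\<in>F. cmod (c e) \<le> 1} \<inter> (\<Inter>e\<in>E. {x. cinner e x = 0}) \<inter> {x. norm x = 1}"
    have S: "x \<in> S \<longleftrightarrow> x \<in> W \<and> norm x = 1" for x
    proof
      assume "x \<in> S"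
      then obtain c where c: "x = (\<Sum>e\<in>F. c e *\<^sub>C e)" "\<forall>e\<in>E. cinner e x = 0" "norm x = 1" by (auto simp: S_def)
      have "x \<in> cspan B" unfolding c(1)
        using F(3) by (intro complex_vector.subspace_sum[OF spanB] complex_vector.subspace_scale[OF spanB]) auto
      then show "x \<in> W \<and> norm x = 1" using c cinner_eq_zero_commute[of x] by (auto simp: W_def)
    next
      assume x: "x \<in> W \<and> norm x = 1"
      have "cmod (cinner x e) \<le> 1" if "e \<in> F" for e
      proof -
        have "(norm e)\<^sup>2 = 1" using orthonormalD[OF F(2) that that] cinner_self[of e]
          by (metis of_real_eq_1_iff)
        then have "norm e = 1" using norm_ge_zero[of e] by (auto simp: power2_eq_1_iff)
        then show ?thesis using cmod_cinner_le[of x e] x by simp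
      qed
      moreover have "x = (\<Sum>e\<in>F. cinner x e *\<^sub>C e)" by (rule F_exp) (use x in \<open>simp add: W_def\<close>)
      ultimately have "x \<in> {\<Sum>e\<in>F. c e *\<^sub>C e | c. \<forall>e\<in>F. cmod (c e) \<le> 1}"
        by (intro CollectI exI[of _ "cinner x"]) simp
      then show "x \<in> S" using x cinner_eq_zero_commute[of x] by (auto simp: S_def W_def)
    qed
    have contA: "continuous_on UNIV A"
      by (intro linear_continuous_on bounded_op_imp_bounded_linear A)
    have "compact S" unfolding S_def
      by (intro compact_Int_closed compact_coefficient_ball F closed_INT ballI closed_orthogonal
          closed_Collect_eq continuous_intros)
    moreover have Ah_W: "A h \<in> W" by (rule AW[OF h])
    then have "(1 / norm (A h)) *\<^sub>C A h \<in> S"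
      using Ah complex_vector.subspace_scale[OF W] by (simp add: S norm_scaleC norm_divide)
    then have "S \<noteq> {}" by blast
    moreover have "continuous_on S (\<lambda>x. inner (A x) x)"
      by (intro continuous_intros continuous_on_subset[OF contA]) auto
    ultimately obtain u where u: "u \<in> S" and max: "\<And>y. y \<in> S \<Longrightarrow> inner (A y) y \<le> inner (A u) u"
      using continuous_attains_sup[of S "\<lambda>x. inner (A x) x"] by blast
    define l where "l = inner (A u) u"
    have u': "u \<in> W" "norm u = 1" using u S by auto
    have bound: "inner (A y) y \<le> l * (norm y)\<^sup>2" if "y \<in> W" for y
    proof (cases "y = 0")
      case False
      let ?y = "(1 / norm y) *\<^sub>R y"
      have "?y \<in> S" using complex_vector.subspace_scale[OF W that] False
        by (simp add: S scaleR_eq_scaleC norm_scaleC norm_divide del: of_real_divide)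
      from max[OF this] have "inner (A ?y) ?y \<le> l" by (simp add: l_def)
      moreover have "A ?y = (1 / norm y) *\<^sub>R A y" unfolding scaleR_eq_scaleC by (rule bounded_opD[OF A])
      ultimately show ?thesis using False by (simp add: field_simps power2_eq_square)
    qed (simp add: bounded_opD[OF A])
    \<comment> \<open>The form of \<open>l - A\<close> is nonnegative on \<open>W\<close> and
      vanishes at the maximiser \<open>u\<close>, so \<open>psd_kernel\<close> makes
      \<open>u\<close> an eigenvector for \<open>l\<close>.\<close>
    define C where "C x = complex_of_real l *\<^sub>C x - A x" for x
    have C: "bounded_op C"
    proof -
      have "bounded_linear (\<lambda>x. complex_of_real l *\<^sub>C x - A x)"
        by (intro bounded_linear_sub bounded_linear_scaleC bounded_op_imp_bounded_linear A)
      then obtain K where "\<And>x. norm (C x) \<le> norm x * K" using bounded_linear.bounded unfolding C_def by blast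
      then have "\<And>x. norm (C x) \<le> K * norm x" by (simp add: mult.commute)
      then show ?thesis unfolding bounded_op_on_def
        by (auto simp: C_def bounded_opD[OF A] scaleC_add_right scaleC_scaleC
            complex_vector.scale_right_diff_distrib mult.commute)
    qed
    have "C u = 0"
    proof (rule psd_kernel[OF C _ W])
      show "cinner (C x) y = cinner x (C y)" for x y
        by (simp add: C_def cinner_diff_left cinner_diff_right cinner_scaleC_left cinner_scaleC_right herm)
      show "0 \<le> Re (cinner (C x) x)" if "x \<in> W" for x
        using bound[OF that] by (simp add: C_def cinner_diff_left cinner_scaleC_left cinner_self inner_eq_Re_cinner)
      show "u \<in> W" by fact
      have "A u \<in> W" by (rule AW) (use u' in \<open>simp add: W_def\<close>)
      then show "C u \<in> W" unfolding C_def
        by (intro complex_vector.subspace_diff[OF W] complex_vector.subspace_scale[OF W] u')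
      show "Re (cinner (C u) u) = 0"
        using u' by (simp add: C_def cinner_diff_left cinner_scaleC_left cinner_self l_def inner_eq_Re_cinner)
    qed
    then have Au: "A u = complex_of_real l *\<^sub>C u" by (simp add: C_def)
    \<comment> \<open>A nonpositive maximum would force the form of \<open>A\<close> to vanish at
      \<open>A h\<close>, hence \<open>A (A h) = 0\<close> and then \<open>A h = 0\<close> by
      symmetry.\<close>
    have "l > 0"
    proof (rule ccontr)
      assume "\<not> l > 0"
      then have "l * (norm (A h))\<^sup>2 \<le> 0" by (simp add: mult_nonpos_nonneg)
      then have "Re (cinner (A (A h)) (A h)) = 0"
        using bound[OF Ah_W] reA[of "A h"] by (simp add: inner_eq_Re_cinner)
      then have "A (A h) = 0" by (intro psd_kernel[OF A herm csubspace_UNIV reA]) auto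
      then have "cinner (A h) (A h) = 0" by (simp add: herm)
      then show False using Ah by (simp add: cinner_self_eq_0)
    qed
    then obtain e where "e \<in> E" "cinner u e \<noteq> 0" using E(4)[of u] Au u' by (auto simp: W_def)
    then show False using u' by (simp add: W_def)
  qed
  have "A h = (\<Sum>u\<in>E. (complex_of_real (lam u) * cinner h u) *\<^sub>C u)" for h
  proof -
    have "A (h - (\<Sum>u\<in>E. cinner h u *\<^sub>C u)) = 0"
      by (rule ker) (simp add: cinner_diff_left cinner_orthonormal_sum[OF E(2,1)])
    then have "A h = (\<Sum>u\<in>E. cinner h u *\<^sub>C A u)" by (simp add: bounded_opD[OF A])
    also have "\<dots> = (\<Sum>u\<in>E. (complex_of_real (lam u) * cinner h u) *\<^sub>C u)"
      by (rule sum.cong) (auto simp: lam scaleC_scaleC mult.commute)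
    finally show ?thesis .
  qed
  then show ?thesis using that[OF E(1,2) lam] by blast
qed

text \<open>\<open>sqrt_op\<close> is a definite description, so uniqueness has to be shown as well.
  For a positive root \<open>S\<close> and an eigenvector \<open>u\<close>, the deviation of
  \<open>S u\<close> from the expected multiple of \<open>u\<close> is annihilated by
  \<open>S\<close> plus a positive scalar, which is injective. On a vector \<open>w\<close>
  orthogonal to \<open>E\<close>, the squared norm of \<open>S w\<close> is
  \<open>cinner (A w) w = 0\<close>.\<close>

lemma sqrt_op_spectral:
  fixes A :: "'a :: complex_inner \<Rightarrow> 'a"
  assumes E: "finite E" "orthonormal E" and lam: "\<And>u. u \<in> E \<Longrightarrow> lam u > (0 :: real)"
    and Au: "\<And>u. u \<in> E \<Longrightarrow> A u = complex_of_real (lam u) *\<^sub>C u"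
    and A: "\<And>h. A h = (\<Sum>u\<in>E. (complex_of_real (lam u) * cinner h u) *\<^sub>C u)"
  shows "sqrt_op A = (\<lambda>h. \<Sum>u\<in>E. (complex_of_real (sqrt (lam u)) * cinner h u) *\<^sub>C u)" (is "_ = ?R")
  unfolding sqrt_op_def
proof (rule the_equality)
  have "norm (?R h) \<le> (\<Sum>u\<in>E. sqrt (lam u) * norm u * norm u) * norm h" for h
    unfolding sum_distrib_right
  proof (rule sum_norm_le)
    fix u assume "u \<in> E"
    have "norm ((complex_of_real (sqrt (lam u)) * cinner h u) *\<^sub>C u) = sqrt (lam u) * cmod (cinner h u) * norm u"
      using lam[OF \<open>u \<in> E\<close>] by (simp add: norm_scaleC norm_mult)
    also have "\<dots> \<le> sqrt (lam u) * (norm h * norm u) * norm u"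
      using lam[OF \<open>u \<in> E\<close>] by (intro mult_right_mono mult_left_mono cmod_cinner_le) auto
    finally show "norm ((complex_of_real (sqrt (lam u)) * cinner h u) *\<^sub>C u) \<le> sqrt (lam u) * norm u * norm u * norm h"
      by (simp add: mult_ac)
  qed
  then have "\<exists>C. \<forall>h\<in>UNIV. norm (?R h) \<le> C * norm h" by blast
  moreover have "?R (x + y) = ?R x + ?R y" for x y
    by (simp add: cinner_add_left scaleC_add_left distrib_left sum.distrib)
  moreover have "?R (c *\<^sub>C x) = c *\<^sub>C ?R x" for c x
    by (simp add: cinner_scaleC_left scaleC_scaleC complex_vector.scale_sum_right mult_ac)
  ultimately have "bounded_op ?R" unfolding bounded_op_on_def by blast
  moreover have "cinner (?R h) h \<in> \<real>\<^sub>\<ge>\<^sub>0" for h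
  proof -
    have "cinner (?R h) h = (\<Sum>u\<in>E. complex_of_real (sqrt (lam u) * (cmod (cinner h u))\<^sup>2))"
      unfolding cinner_sum_left cinner_scaleC_left
      by (rule sum.cong)
        (simp_all add: cinner_commute[of _ h] mult.assoc complex_norm_square[symmetric] of_real_power[symmetric]
          del: of_real_power)
    moreover have "(\<Sum>u\<in>E. sqrt (lam u) * (cmod (cinner h u))\<^sup>2) \<ge> 0"
      using lam by (intro sum_nonneg mult_nonneg_nonneg) (auto intro: less_imp_le)
    ultimately show ?thesis by (simp flip: of_real_sum of_real_mult of_real_power)
  qed
  ultimately have "positive_op ?R" by (simp add: positive_op_def)
  moreover have "?R (?R h) = A h" for h
    unfolding A
    by (rule sum.cong)
      (simp_all add: cinner_orthonormal_sum[OF E(2,1)] mult.assoc[symmetric] less_imp_le[OF lam]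
        flip: of_real_mult)
  ultimately show "positive_op ?R \<and> ?R \<circ> ?R = A" by (auto simp: fun_eq_iff)
next
  fix S assume "positive_op S \<and> S \<circ> S = A"
  then have pos: "positive_op S" and SS: "\<And>h. S (S h) = A h" by (auto simp: fun_eq_iff)
  have S: "bounded_op S" and posS: "\<And>h. cinner (S h) h \<in> \<real>\<^sub>\<ge>\<^sub>0"
    using pos by (auto simp: positive_op_def)
  have Su: "S u = complex_of_real (sqrt (lam u)) *\<^sub>C u" if u: "u \<in> E" for u
  proof -
    define v where "v = S u - complex_of_real (sqrt (lam u)) *\<^sub>C u"
    have sq: "complex_of_real (sqrt (lam u)) * complex_of_real (sqrt (lam u)) = complex_of_real (lam u)"
      using lam[OF u] by (simp flip: of_real_mult)
    have "S v + complex_of_real (sqrt (lam u)) *\<^sub>C v = 0"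
      by (simp add: v_def bounded_opD[OF S] SS Au[OF u] complex_vector.scale_right_diff_distrib scaleC_scaleC sq)
    then have "cinner (S v) v + complex_of_real (sqrt (lam u)) * cinner v v = 0"
      by (metis cinner_add_left cinner_scaleC_left cinner_zero_left)
    then have "Re (cinner (S v) v) + sqrt (lam u) * (norm v)\<^sup>2 = 0"
      by (simp add: cinner_self complex_eq_iff)
    moreover have "Re (cinner (S v) v) \<ge> 0" using posS[of v] by (simp add: complex_nonneg_Reals_iff)
    moreover have "sqrt (lam u) * (norm v)\<^sup>2 \<ge> 0" using lam[OF u] by simp
    ultimately have "sqrt (lam u) * (norm v)\<^sup>2 = 0" by linarith
    then have "v = 0" using lam[OF u] by simp
    then show ?thesis by (simp add: v_def)
  qed
  show "S = ?R"
  proof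
    fix h
    define w where "w = h - (\<Sum>u\<in>E. cinner h u *\<^sub>C u)"
    have "cinner w u = 0" if "u \<in> E" for u
      by (simp add: w_def cinner_diff_left cinner_orthonormal_sum[OF E(2,1) that])
    then have "A w = 0" by (simp add: A)
    then have "cinner (S w) (S w) = 0"
      using positive_op_hermitian[OF pos, of "S w" w] by (simp add: SS positive_op_hermitian[OF pos])
    then have "S w = 0" by (simp add: cinner_self_eq_0)
    then have "S h = (\<Sum>u\<in>E. cinner h u *\<^sub>C S u)" by (simp add: w_def bounded_opD[OF S])
    also have "\<dots> = ?R h" by (rule sum.cong) (auto simp: Su scaleC_scaleC mult.commute)
    finally show "S h = ?R h" .
  qed
qed

section \<open>Compositions, words and completely positive maps\<close>

lemma bounded_op_id: "bounded_op (id :: 'a :: complex_inner \<Rightarrow> 'a)"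
  by (auto simp: bounded_op_on_def intro: exI[of _ 1])

lemma bounded_op_comp:
  assumes A: "bounded_op (A :: 'b :: complex_inner \<Rightarrow> 'c :: complex_inner)"
    and B: "bounded_op (B :: 'a :: complex_inner \<Rightarrow> 'b)"
  shows "bounded_op (A \<circ> B)"
proof -
  obtain C D where C: "C > 0" "\<And>x. x \<in> UNIV \<Longrightarrow> norm (A x) \<le> C * norm x"
    and D: "D > 0" "\<And>x. x \<in> UNIV \<Longrightarrow> norm (B x) \<le> D * norm x"
    using bounded_op_on_bound[OF A] bounded_op_on_bound[OF B] by metis
  have "norm (A (B x)) \<le> (C * D) * norm x" for x
    using order_trans[OF C(2)[of "B x"] mult_left_mono[OF D(2)[of x], of C]] C(1)
    by (simp add: mult.assoc)
  then show ?thesis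
    by (auto simp: bounded_op_on_def bounded_opD[OF A] bounded_opD[OF B])
qed

lemma bounded_op_adj:
  fixes A :: "'a :: chilbert_space \<Rightarrow> 'b :: complex_inner"
  assumes A: "bounded_op A" shows "bounded_op (adj A)"
proof -
  obtain C where C: "C > 0" "\<And>x. x \<in> UNIV \<Longrightarrow> norm (A x) \<le> C * norm x"
    using bounded_op_on_bound[OF A] by blast
  have "norm (adj A y) \<le> C * norm y" for y
  proof -
    have "complex_of_real ((norm (adj A y))\<^sup>2) = cinner (A (adj A y)) y"
      by (simp only: cinner_adj[OF A] cinner_self)
    then have "(norm (adj A y))\<^sup>2 = cmod (cinner (A (adj A y)) y)"
      by (metis norm_of_real abs_power2)
    also have "\<dots> \<le> norm (A (adj A y)) * norm y" by (rule cmod_cinner_le)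
    also have "\<dots> \<le> C * norm (adj A y) * norm y" by (intro mult_right_mono C) auto
    finally have "norm (adj A y) * norm (adj A y) \<le> norm (adj A y) * (C * norm y)"
      by (simp add: power2_eq_square mult_ac)
    then show ?thesis
      using C(1) by (cases "norm (adj A y) = 0") (auto dest: mult_left_le_imp_le)
  qed
  moreover have "adj A (x + y) = adj A x + adj A y" for x y
    by (rule cinner_ext_left) (simp add: cinner_adj'[OF A] cinner_add_left)
  moreover have "adj A (c *\<^sub>C x) = c *\<^sub>C adj A x" for c x
    by (rule cinner_ext_left) (simp add: cinner_adj'[OF A] cinner_scaleC_left)
  ultimately show ?thesis by (auto simp: bounded_op_on_def)
qed

lemma adj_comp:
  fixes A :: "'b :: chilbert_space \<Rightarrow> 'c :: complex_inner" and B :: "'a :: chilbert_space \<Rightarrow> 'b"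
  assumes "bounded_op A" "bounded_op B"
  shows "adj (A \<circ> B) = adj B \<circ> adj A"
proof
  fix x show "adj (A \<circ> B) x = (adj B \<circ> adj A) x"
    by (rule cinner_ext_left)
      (simp add: cinner_adj'[OF bounded_op_comp] cinner_adj'[OF assms(1)] cinner_adj'[OF assms(2)] assms)
qed

lemma adj_id: "adj (id :: 'a :: chilbert_space \<Rightarrow> 'a) = id"
  by (rule ext, rule cinner_ext_left) (simp add: cinner_adj'[OF bounded_op_id])

lemma adj_ident: "adj (\<lambda>x. x :: 'a :: chilbert_space) = (\<lambda>x. x)"
  using adj_id unfolding id_def .

lemma comp_upto_0 [simp]: "comp_upto 0 A = id"
  by (simp add: comp_upto_def)

lemma comp_upto_Suc [simp]: "comp_upto (Suc k) A = comp_upto k A \<circ> A (Suc k)"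
proof -
  have "foldr (\<lambda>i R. A i \<circ> R) xs g = foldr (\<lambda>i R. A i \<circ> R) xs id \<circ> g" for xs g
    by (induction xs) (auto simp: o_assoc)
  from this[of "[1..<Suc k]" "A (Suc k)"] show ?thesis by (simp add: comp_upto_def)
qed

lemma comp_upto_cong:
  assumes "\<And>i. i \<in> {1..k} \<Longrightarrow> A i = B i" shows "comp_upto k A = comp_upto k B"
  using assms by (induction k) auto

lemma comp_upto_commute:
  assumes "\<And>i x. i \<in> {1..k} \<Longrightarrow> A i (G x) = G (A i x)"
  shows "comp_upto k A (G x) = G (comp_upto k A x)"
  using assms by (induction k arbitrary: x) auto

lemma comp_upto_truncate:
  assumes "j \<le> k" "\<And>i. j < i \<Longrightarrow> i \<le> k \<Longrightarrow> A i = id"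
  shows "comp_upto k A = comp_upto j A"
  using assms by (induction k) (auto simp: le_Suc_eq)

text \<open>Tuples are split at the last coordinate because \<open>comp_upto (Suc k)\<close> splits
  off its last factor, see \<open>comp_upto_Suc\<close>.\<close>

lemma PiE_atLeastAtMost_Suc:
  "PiE {1..Suc k} S = (\<lambda>(\<beta>, a). \<beta>(Suc k := a)) ` (PiE {1..k} S \<times> S (Suc k))"
proof -
  have "{1..Suc k} = insert (Suc k) {1..k}" by auto
  then show ?thesis by (auto simp: PiE_insert_eq)
qed

lemma inj_on_fun_upd_PiE:
  "inj_on (\<lambda>(\<beta>, a). \<beta>(Suc k := a)) (PiE {1..k} S \<times> R)"
proof (rule inj_onI, clarify)
  fix \<beta> \<gamma> a b assume *: "\<beta> \<in> PiE {1..k} S" "\<gamma> \<in> PiE {1..k} S" "\<beta>(Suc k := a) = \<gamma>(Suc k := b)"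
  have "\<beta> i = \<gamma> i" for i
  proof (cases "i = Suc k")
    case True
    then show ?thesis using * by (auto simp: PiE_def extensional_def)
  next
    case False
    then show ?thesis using fun_cong[OF *(3), of i] by simp
  qed
  then show "\<beta> = \<gamma> \<and> a = b" using fun_cong[OF *(3), of "Suc k"] by auto
qed

lemma sum_PiE_Suc:
  "(\<Sum>\<beta>\<in>PiE {1..Suc k} S. g \<beta>) = (\<Sum>\<beta>\<in>PiE {1..k} S. \<Sum>a\<in>S (Suc k). g (\<beta>(Suc k := a)))"
  unfolding PiE_atLeastAtMost_Suc
  by (subst sum.reindex[OF inj_on_fun_upd_PiE]) (simp add: sum.cartesian_product case_prod_beta)

lemma word_op_Nil [simp]: "word_op X [] = id"
  by (simp add: word_op_def)

lemma word_op_Cons [simp]: "word_op X (j # \<alpha>) = X j \<circ> word_op X \<alpha>"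
  by (simp add: word_op_def)

lemma bounded_op_word_op:
  assumes "\<And>j. j \<in> set \<alpha> \<Longrightarrow> bounded_op (X j)" shows "bounded_op (word_op X \<alpha>)"
  using assms by (induction \<alpha>) (auto intro: bounded_op_id bounded_op_comp)

lemma word_op_commute:
  assumes "\<And>j x. j \<in> set \<alpha> \<Longrightarrow> X j (G x) = G (X j x)"
  shows "word_op X \<alpha> (G x) = G (word_op X \<alpha> x)"
  using assms by (induction \<alpha> arbitrary: x) auto

text \<open>The first letter of \<open>\<alpha>\<close> occurs somewhere in \<open>\<beta>\<close>,
  and its operator can be moved to the front there past operators that commute with it; the rest is
  induction.\<close>

lemma word_op_mset:
  assumes "mset \<alpha> = mset \<beta>"
    and "\<And>i j x. i \<in> set \<alpha> \<Longrightarrow> j \<in> set \<alpha> \<Longrightarrow> X i (X j x) = X j (X i x)"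
  shows "word_op X \<alpha> = word_op X \<beta>"
  using assms
proof (induction \<alpha> arbitrary: \<beta>)
  case (Cons a \<alpha>)
  have "a \<in> set \<beta>" using Cons.prems(1) by (metis list.set_intros(1) mset_eq_setD)
  then obtain b c where \<beta>: "\<beta> = b @ a # c" by (auto simp: in_set_conv_decomp)
  have "mset \<alpha> = mset (b @ c)" using Cons.prems(1) by (simp add: \<beta>)
  then have IH: "word_op X \<alpha> = word_op X (b @ c)" using Cons by simp
  have app: "word_op X (u @ v) = word_op X u \<circ> word_op X v" for u v
    by (induction u) (auto simp: o_assoc)
  have "set b \<subseteq> set (a # \<alpha>)" using Cons.prems(1) mset_eq_setD[of "a # \<alpha>" \<beta>] by (auto simp: \<beta>)
  then have "word_op X b (X a x) = X a (word_op X b x)" for x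
    by (intro word_op_commute Cons.prems(2)) auto
  then show ?case by (auto simp: IH app \<beta> fun_eq_iff)
qed simp

section \<open>Iterated completely positive maps as sums over words, and telescoping\<close>

definition words :: "nat \<Rightarrow> nat \<Rightarrow> nat list set" where
  "words m q = {\<alpha>. set \<alpha> \<subseteq> {1..m} \<and> length \<alpha> = q}"

lemma finite_words: "finite (words m q)"
  unfolding words_def by (rule finite_lists_length_eq) simp

lemma words_0: "words m 0 = {[]}"
  by (auto simp: words_def)

lemma sum_words_Suc: "(\<Sum>\<alpha>\<in>words m (Suc q). g \<alpha>) = (\<Sum>j=1..m. \<Sum>\<alpha>\<in>words m q. g (j # \<alpha>))"
proof -
  have "words m (Suc q) = (\<lambda>(j, \<alpha>). j # \<alpha>) ` ({1..m} \<times> words m q)"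
    by (auto simp: words_def length_Suc_conv image_iff)
  moreover have "inj_on (\<lambda>(j, \<alpha>). j # \<alpha>) ({1..m} \<times> words m q)" by (auto simp: inj_on_def)
  ultimately show ?thesis
    by (simp only: sum.reindex sum.cartesian_product o_def) (simp add: case_prod_beta)
qed

lemma cp_map_pow:
  fixes X :: "nat \<Rightarrow> 'h \<Rightarrow> 'h :: chilbert_space"
  assumes X: "\<And>j. j \<in> {1..m} \<Longrightarrow> bounded_op (X j)"
  shows "(cp_map m X ^^ q) Y h = (\<Sum>\<alpha>\<in>words m q. word_op X \<alpha> (Y (adj (word_op X \<alpha>) h)))"
proof (induction q arbitrary: h)
  case 0
  show ?case by (simp add: words_0 adj_ident)
next
  case (Suc q)
  have "(cp_map m X ^^ Suc q) Y h
      = (\<Sum>j=1..m. X j (\<Sum>\<alpha>\<in>words m q. word_op X \<alpha> (Y (adj (word_op X \<alpha>) (adj (X j) h)))))"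
    by (simp add: cp_map_def[of m X "(cp_map m X ^^ q) Y"] Suc)
  also have "\<dots> = (\<Sum>j=1..m. \<Sum>\<alpha>\<in>words m q. word_op X (j # \<alpha>) (Y (adj (word_op X (j # \<alpha>)) h)))"
  proof (intro sum.cong refl)
    fix j assume j: "j \<in> {1..m}"
    have "X j (\<Sum>\<alpha>\<in>words m q. word_op X \<alpha> (Y (adj (word_op X \<alpha>) (adj (X j) h))))
        = (\<Sum>\<alpha>\<in>words m q. X j (word_op X \<alpha> (Y (adj (word_op X \<alpha>) (adj (X j) h)))))"
      by (rule bounded_opD(5)[OF X[OF j]])
    also have "\<dots> = (\<Sum>\<alpha>\<in>words m q. word_op X (j # \<alpha>) (Y (adj (word_op X (j # \<alpha>)) h)))"
    proof (rule sum.cong[OF refl])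
      fix \<alpha> assume "\<alpha> \<in> words m q"
      then have "bounded_op (word_op X \<alpha>)" by (intro bounded_op_word_op X) (auto simp: words_def)
      then show "X j (word_op X \<alpha> (Y (adj (word_op X \<alpha>) (adj (X j) h))))
          = word_op X (j # \<alpha>) (Y (adj (word_op X (j # \<alpha>)) h))"
        by (simp add: adj_comp[OF X[OF j]])
    qed
    finally show "X j (\<Sum>\<alpha>\<in>words m q. word_op X \<alpha> (Y (adj (word_op X \<alpha>) (adj (X j) h))))
        = (\<Sum>\<alpha>\<in>words m q. word_op X (j # \<alpha>) (Y (adj (word_op X (j # \<alpha>)) h)))" .
  qed
  finally show ?case by (simp only: sum_words_Suc)
qed

definition tuple_word :: "nat \<Rightarrow> 'h operator_tuple \<Rightarrow> (nat \<Rightarrow> nat list) \<Rightarrow> 'h \<Rightarrow> 'h" where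
  "tuple_word k T \<beta> = comp_upto k (\<lambda>i. word_op (T i) (\<beta> i))"

lemma bounded_op_comp_upto:
  assumes "\<And>i. i \<in> {1..k} \<Longrightarrow> bounded_op (A i)" shows "bounded_op (comp_upto k A)"
  using assms by (induction k) (auto intro!: bounded_op_id bounded_op_comp)

lemma bounded_op_tuple_word:
  assumes "\<And>i j. i \<in> {1..k} \<Longrightarrow> j \<in> {1..n i} \<Longrightarrow> bounded_op (T i j)"
    and "\<And>i. i \<in> {1..k} \<Longrightarrow> set (\<beta> i) \<subseteq> {1..n i}"
  shows "bounded_op (tuple_word k T \<beta>)"
  unfolding tuple_word_def
  by (intro bounded_op_comp_upto bounded_op_word_op) (use assms in blast)

lemma iterated_cp_map:
  fixes T :: "'h :: chilbert_space operator_tuple"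
  assumes T: "\<And>i j. i \<in> {1..k} \<Longrightarrow> j \<in> {1..n i} \<Longrightarrow> bounded_op (T i j)"
  shows "comp_upto k (\<lambda>i. cp_map (n i) (T i) ^^ q i) Y h
    = (\<Sum>\<beta>\<in>PiE {1..k} (\<lambda>i. words (n i) (q i)). tuple_word k T \<beta> (Y (adj (tuple_word k T \<beta>) h)))"
  using T
proof (induction k arbitrary: Y h)
  case 0
  show ?case by (simp add: tuple_word_def adj_ident)
next
  case (Suc k)
  let ?W = "\<lambda>i. words (n i) (q i)"
  have IH: "comp_upto k (\<lambda>i. cp_map (n i) (T i) ^^ q i) Z h
      = (\<Sum>\<beta>\<in>PiE {1..k} ?W. tuple_word k T \<beta> (Z (adj (tuple_word k T \<beta>) h)))" for Z
    by (rule Suc.IH) (use Suc.prems in auto)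
  have pow: "(cp_map (n (Suc k)) (T (Suc k)) ^^ q (Suc k)) Y h
      = (\<Sum>\<alpha>\<in>?W (Suc k). word_op (T (Suc k)) \<alpha> (Y (adj (word_op (T (Suc k)) \<alpha>) h)))" for h
    by (rule cp_map_pow) (use Suc.prems in auto)
  have "comp_upto (Suc k) (\<lambda>i. cp_map (n i) (T i) ^^ q i) Y h
      = (\<Sum>\<beta>\<in>PiE {1..k} ?W. tuple_word k T \<beta>
          (\<Sum>\<alpha>\<in>?W (Suc k). word_op (T (Suc k)) \<alpha> (Y (adj (word_op (T (Suc k)) \<alpha>) (adj (tuple_word k T \<beta>) h)))))"
    by (simp only: comp_upto_Suc o_apply IH pow)
  also have "\<dots> = (\<Sum>\<beta>\<in>PiE {1..k} ?W. \<Sum>\<alpha>\<in>?W (Suc k).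
      tuple_word (Suc k) T (\<beta>(Suc k := \<alpha>)) (Y (adj (tuple_word (Suc k) T (\<beta>(Suc k := \<alpha>))) h)))"
  proof (intro sum.cong refl)
    fix \<beta> assume \<beta>: "\<beta> \<in> PiE {1..k} ?W"
    have b: "bounded_op (tuple_word k T \<beta>)"
      by (rule bounded_op_tuple_word[where n = n]) (use Suc.prems \<beta> in \<open>auto simp: words_def PiE_iff\<close>)
    have "tuple_word (Suc k) T (\<beta>(Suc k := \<alpha>)) = tuple_word k T \<beta> \<circ> word_op (T (Suc k)) \<alpha>" for \<alpha>
      unfolding tuple_word_def comp_upto_Suc
      by (intro arg_cong2[of _ _ _ _ "(\<circ>)"] comp_upto_cong) auto
    moreover have "bounded_op (word_op (T (Suc k)) \<alpha>)" if "\<alpha> \<in> ?W (Suc k)" for \<alpha>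
      by (rule bounded_op_word_op) (use Suc.prems that in \<open>auto simp: words_def\<close>)
    ultimately show "tuple_word k T \<beta> (\<Sum>\<alpha>\<in>?W (Suc k). word_op (T (Suc k)) \<alpha> (Y (adj (word_op (T (Suc k)) \<alpha>) (adj (tuple_word k T \<beta>) h))))
      = (\<Sum>\<alpha>\<in>?W (Suc k). tuple_word (Suc k) T (\<beta>(Suc k := \<alpha>)) (Y (adj (tuple_word (Suc k) T (\<beta>(Suc k := \<alpha>))) h)))"
      by (simp add: bounded_opD(5)[OF b] adj_comp[OF b])
  qed
  also have "\<dots> = (\<Sum>\<beta>\<in>PiE {1..Suc k} ?W. tuple_word (Suc k) T \<beta> (Y (adj (tuple_word (Suc k) T \<beta>) h)))"
    by (simp only: sum_PiE_Suc)
  finally show ?case .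
qed

text \<open>In each coordinate \<open>x - F^(q+1) x\<close> is the sum of the
  \<open>F^s (x - F x)\<close> for \<open>s\<close> up to \<open>q\<close>, and commutativity
  collects the factors. The setting is an arbitrary abelian group because the result is applied to
  the maps \<open>\<Phi> i\<close>, which act on functions with pointwise operations.\<close>

lemma comp_upto_telescope:
  fixes F :: "nat \<Rightarrow> 'x \<Rightarrow> 'x :: ab_group_add"
  assumes diff: "\<And>i x y. i \<in> {1..k} \<Longrightarrow> F i (x - y) = F i x - F i y"
    and comm: "\<And>i j x. i \<in> {1..k} \<Longrightarrow> j \<in> {1..k} \<Longrightarrow> F i (F j x) = F j (F i x)"
  shows "comp_upto k (\<lambda>i x. x - (F i ^^ Suc (q i)) x) x
    = (\<Sum>s\<in>PiE {1..k} (\<lambda>i. {..q i}). comp_upto k (\<lambda>i. F i ^^ s i) (comp_upto k (\<lambda>i x. x - F i x) x))"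
  using assms
proof (induction k arbitrary: x)
  case (Suc k)
  let ?G = "F (Suc k)" and ?A = "comp_upto k (\<lambda>i x. x - (F i ^^ Suc (q i)) x)"
  have diff_pow: "(F i ^^ m) (x - y) = (F i ^^ m) x - (F i ^^ m) y" if "i \<in> {1..Suc k}" for i m x y
    using that by (induction m) (auto simp: Suc.prems(1))
  have zero_pow: "(F i ^^ m) 0 = 0" if "i \<in> {1..Suc k}" for i m
    using diff_pow[OF that, of m 0 0] by simp
  have uminus_pow: "(F i ^^ m) (- x) = - (F i ^^ m) x" if "i \<in> {1..Suc k}" for i m x
    using diff_pow[OF that, of m 0 x] zero_pow[OF that, of m] by simp
  have add_pow: "(F i ^^ m) (x + y) = (F i ^^ m) x + (F i ^^ m) y" if "i \<in> {1..Suc k}" for i m x y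
    using diff_pow[OF that, of m x "- y"] uminus_pow[OF that, of m y] by simp
  have comm_pow: "F i ((?G ^^ m) x) = (?G ^^ m) (F i x)" if "i \<in> {1..Suc k}" for i m x
    using that by (induction m) (auto simp: Suc.prems(2)[of i "Suc k"])
  have comm_pow2: "(F i ^^ l) ((?G ^^ m) x) = (?G ^^ m) ((F i ^^ l) x)" if "i \<in> {1..Suc k}" for i l m x
    using that by (induction l) (auto simp: comm_pow)
  have A_comm: "?A ((?G ^^ m) x) = (?G ^^ m) (?A x)" for m x
    by (rule comp_upto_commute) (auto simp: diff_pow comm_pow2 simp del: funpow.simps)
  have A_add: "?A (x + y) = ?A x + ?A y" for x y
  proof -
    have "comp_upto k' (\<lambda>i x. x - (F i ^^ Suc (q i)) x) (x + y)
        = comp_upto k' (\<lambda>i x. x - (F i ^^ Suc (q i)) x) x + comp_upto k' (\<lambda>i x. x - (F i ^^ Suc (q i)) x) y"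
      if "k' \<le> k" for k'
      using that
    proof (induction k' arbitrary: x y)
      case (Suc k')
      have e: "x + y - (F (Suc k') ^^ Suc (q (Suc k'))) (x + y)
          = (x - (F (Suc k') ^^ Suc (q (Suc k'))) x) + (y - (F (Suc k') ^^ Suc (q (Suc k'))) y)"
        using Suc.prems by (simp add: add_pow del: funpow.simps)
      show ?case unfolding comp_upto_Suc o_apply e by (rule Suc.IH) (use Suc.prems in simp)
    qed simp
    then show ?thesis by simp
  qed
  have A_zero: "?A 0 = 0" using A_add[of 0 0] by simp
  have A_sum: "?A (sum f I) = (\<Sum>i\<in>I. ?A (f i))" for f and I :: "nat set"
    by (induction I rule: infinite_finite_induct) (auto simp: A_add A_zero simp del: funpow.simps)
  have tele: "x - (?G ^^ Suc m) x = (\<Sum>s\<le>m. (?G ^^ s) (x - ?G x))" for m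
  proof (induction m)
    case (Suc m)
    have "(\<Sum>s\<le>Suc m. (?G ^^ s) (x - ?G x)) = (x - (?G ^^ Suc m) x) + (?G ^^ Suc m) (x - ?G x)"
      using Suc by simp
    also have "(?G ^^ Suc m) (x - ?G x) = (?G ^^ Suc m) x - (?G ^^ Suc (Suc m)) x"
      by (simp add: diff_pow funpow_swap1 del: funpow.simps) (simp add: funpow_swap1)
    finally show ?case by simp
  qed simp
  have P_comm: "comp_upto k (\<lambda>i. F i ^^ s i) ((?G ^^ m) x) = (?G ^^ m) (comp_upto k (\<lambda>i. F i ^^ s i) x)" for s m x
    by (rule comp_upto_commute) (auto simp: comm_pow2)
  have G_sum: "(?G ^^ m) (sum f I) = (\<Sum>i\<in>I. (?G ^^ m) (f i))" for m f and I :: "(nat \<Rightarrow> nat) set"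
    by (induction I rule: infinite_finite_induct) (auto simp: add_pow zero_pow)
  let ?D = "comp_upto k (\<lambda>i x. x - F i x) (x - ?G x)"
  have "comp_upto (Suc k) (\<lambda>i x. x - (F i ^^ Suc (q i)) x) x = (\<Sum>m\<le>q (Suc k). (?G ^^ m) (?A (x - ?G x)))"
    by (simp add: tele A_sum A_comm del: funpow.simps)
  also have "\<dots> = (\<Sum>m\<le>q (Suc k). \<Sum>s\<in>PiE {1..k} (\<lambda>i. {..q i}). (?G ^^ m) (comp_upto k (\<lambda>i. F i ^^ s i) ?D))"
    using Suc.IH[of "x - ?G x"] Suc.prems by (simp add: G_sum del: funpow.simps)
  also have "\<dots> = (\<Sum>s\<in>PiE {1..k} (\<lambda>i. {..q i}). \<Sum>m\<le>q (Suc k). comp_upto k (\<lambda>i. F i ^^ s i) ((?G ^^ m) ?D))"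
    unfolding P_comm by (rule sum.swap)
  also have "\<dots> = (\<Sum>s\<in>PiE {1..k} (\<lambda>i. {..q i}). \<Sum>m\<le>q (Suc k).
      comp_upto (Suc k) (\<lambda>i. F i ^^ (s(Suc k := m)) i) (comp_upto (Suc k) (\<lambda>i x. x - F i x) x))"
  proof (intro sum.cong refl)
    fix s m
    have "comp_upto k (\<lambda>i. F i ^^ (s(Suc k := m)) i) = comp_upto k (\<lambda>i. F i ^^ s i)"
      by (rule comp_upto_cong) auto
    then show "comp_upto k (\<lambda>i. F i ^^ s i) ((?G ^^ m) ?D)
        = comp_upto (Suc k) (\<lambda>i. F i ^^ (s(Suc k := m)) i) (comp_upto (Suc k) (\<lambda>i x. x - F i x) x)"
      by simp
  qed
  also have "\<dots> = (\<Sum>s\<in>PiE {1..Suc k} (\<lambda>i. {..q i}).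
      comp_upto (Suc k) (\<lambda>i. F i ^^ s i) (comp_upto (Suc k) (\<lambda>i x. x - F i x) x))"
    by (simp only: sum_PiE_Suc)
  finally show ?case .
qed simp

section \<open>The commutative polyball\<close>

lemma sum_fun_apply: "(\<Sum>i\<in>I. f i) x = (\<Sum>i\<in>I. f i (x :: 'a) :: 'b :: comm_monoid_add)"
  by (induction I rule: infinite_finite_induct) auto

lemma id_minus_eq: "id_minus F = (\<lambda>Y. Y - F Y)"
  by (auto simp: id_minus_def fun_eq_iff)

locale comm_tuple =
  fixes k :: nat and n :: "nat \<Rightarrow> nat" and T :: "'h :: chilbert_space operator_tuple"
  assumes T: "T \<in> comm_polyball k n"
begin

abbreviation tw where "tw \<equiv> tuple_word k T"
abbreviation \<Phi> where "\<Phi> i \<equiv> cp_map (n i) (T i)"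
abbreviation \<Delta> where "\<Delta> \<equiv> defect_op k n T"
abbreviation all_words where "all_words \<equiv> PiE {1..k} (\<lambda>i. lists {1..n i})"
abbreviation graded_words where "graded_words q \<equiv> PiE {1..k} (\<lambda>i. words (n i) (q i))"

lemma T_bounded: "i \<in> {1..k} \<Longrightarrow> j \<in> {1..n i} \<Longrightarrow> bounded_op (T i j)"
  using T by (auto simp: comm_polyball_def polyball_def)

lemma T_commute:
  assumes "s \<in> {1..k}" "t \<in> {1..k}" "i \<in> {1..n s}" "j \<in> {1..n t}"
  shows "T s i (T t j x) = T t j (T s i x)"
proof -
  have "T s i \<circ> T t j = T t j \<circ> T s i" using T assms by (auto simp: comm_polyball_def)
  then show ?thesis by (metis o_apply)
qed

lemma word_op_T_commute:
  assumes "s \<in> {1..k}" "t \<in> {1..k}" "set \<alpha> \<subseteq> {1..n s}" "set \<gamma> \<subseteq> {1..n t}"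
  shows "word_op (T s) \<alpha> (word_op (T t) \<gamma> x) = word_op (T t) \<gamma> (word_op (T s) \<alpha> x)"
proof (rule word_op_commute)
  fix j x assume "j \<in> set \<alpha>"
  then have "word_op (T t) \<gamma> (T s j x) = T s j (word_op (T t) \<gamma> x)"
    using assms by (intro word_op_commute T_commute) auto
  then show "T s j (word_op (T t) \<gamma> x) = word_op (T t) \<gamma> (T s j x)" by simp
qed

lemma all_wordsD: "\<beta> \<in> all_words \<Longrightarrow> i \<in> {1..k} \<Longrightarrow> set (\<beta> i) \<subseteq> {1..n i}"
  by (drule (1) PiE_mem) (simp only: lists_eq_set mem_Collect_eq)

lemma graded_words_subset: "graded_words q \<subseteq> all_words"
  by (rule PiE_mono) (simp add: words_def lists_eq_set Collect_mono)

lemma finite_graded_words: "finite (graded_words q)"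
  by (intro finite_PiE finite_words) simp

lemma tw_bounded: "\<beta> \<in> all_words \<Longrightarrow> bounded_op (tw \<beta>)"
  by (rule bounded_op_tuple_word[where n = n, OF T_bounded all_wordsD])

lemma tw_mset:
  assumes "\<beta> \<in> all_words" "\<And>i. i \<in> {1..k} \<Longrightarrow> mset (\<beta> i) = mset (\<gamma> i)"
  shows "tw \<beta> = tw \<gamma>"
  unfolding tuple_word_def
proof (rule comp_upto_cong)
  fix i assume i: "i \<in> {1..k}"
  show "word_op (T i) (\<beta> i) = word_op (T i) (\<gamma> i)"
  proof (rule word_op_mset[OF assms(2)[OF i]])
    fix j l x assume "j \<in> set (\<beta> i)" "l \<in> set (\<beta> i)"
    then have "j \<in> {1..n i}" "l \<in> {1..n i}" using all_wordsD[OF assms(1) i] by auto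
    then show "T i j (T i l x) = T i l (T i j x)" by (rule T_commute[OF i i])
  qed
qed

text \<open>The adjoint of a product reverses the factors, whereas the Berezin kernel composes the
  adjoints in the original order. The two agree because entries of different rows commute.\<close>

lemma comp_adj_words:
  assumes \<beta>: "\<beta> \<in> all_words"
  shows "comp_upto k (\<lambda>i. adj (word_op (T i) (\<beta> i))) = adj (tw \<beta>)"
proof -
  note S = all_wordsD[OF \<beta>]
  have "comp_upto j (\<lambda>i. adj (word_op (T i) (\<beta> i))) = adj (tuple_word j T \<beta>)" if "j \<le> k" for j
    using that
  proof (induction j)
    case 0
    show ?case by (simp add: tuple_word_def adj_ident)
  next
    case (Suc j)
    let ?w = "word_op (T (Suc j)) (\<beta> (Suc j))"
    have j: "Suc j \<in> {1..k}" using Suc.prems by simp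
    have w: "bounded_op ?w" by (rule bounded_op_word_op) (use S[OF j] T_bounded[OF j] in blast)
    have tj: "bounded_op (tuple_word j T \<beta>)"
      by (rule bounded_op_tuple_word[where n = n]) (use S T_bounded Suc.prems in auto)
    have "tuple_word j T \<beta> (?w x) = ?w (tuple_word j T \<beta> x)" for x
      unfolding tuple_word_def
      by (intro comp_upto_commute word_op_T_commute S j) (use Suc.prems S in auto)
    then have eq: "tuple_word (Suc j) T \<beta> = ?w \<circ> tuple_word j T \<beta>"
      by (auto simp: tuple_word_def fun_eq_iff)
    have IH: "comp_upto j (\<lambda>i. adj (word_op (T i) (\<beta> i))) = adj (tuple_word j T \<beta>)"
      using Suc by simp
    show ?case unfolding comp_upto_Suc IH eq by (rule adj_comp[OF w tj, symmetric])
  qed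
  then show ?thesis by simp
qed

lemma \<Phi>_diff: "i \<in> {1..k} \<Longrightarrow> \<Phi> i (Y - Z) = \<Phi> i Y - \<Phi> i Z"
  by (rule ext) (simp add: cp_map_def bounded_opD(4)[OF T_bounded] sum_subtractf)

text \<open>The adjoints inherit commutativity, so the two double sums differ only in the order of
  summation.\<close>

lemma \<Phi>_commute:
  assumes s: "s \<in> {1..k}" and t: "t \<in> {1..k}"
  shows "\<Phi> s (\<Phi> t Y) = \<Phi> t (\<Phi> s Y)"
proof
  fix h
  have adj2: "adj (T t j) (adj (T s i) h) = adj (T s i) (adj (T t j) h)"
    if "i \<in> {1..n s}" "j \<in> {1..n t}" for i j
  proof -
    have b: "bounded_op (T s i)" "bounded_op (T t j)" using T_bounded s t that by auto
    have "T s i \<circ> T t j = T t j \<circ> T s i" using T_commute[OF s t that] by (auto simp: fun_eq_iff)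
    then have "adj (T t j) \<circ> adj (T s i) = adj (T s i) \<circ> adj (T t j)"
      using adj_comp[OF b] adj_comp[OF b(2,1)] by simp
    then show ?thesis by (metis o_apply)
  qed
  have "\<Phi> s (\<Phi> t Y) h = (\<Sum>i=1..n s. \<Sum>j=1..n t. T s i (T t j (Y (adj (T t j) (adj (T s i) h)))))"
    unfolding cp_map_def by (rule sum.cong[OF refl], rule bounded_opD(5)[OF T_bounded[OF s]])
  also have "\<dots> = (\<Sum>i=1..n s. \<Sum>j=1..n t. T t j (T s i (Y (adj (T s i) (adj (T t j) h)))))"
    by (intro sum.cong refl) (simp only: adj2 T_commute[OF s t])
  also have "\<dots> = (\<Sum>j=1..n t. \<Sum>i=1..n s. T t j (T s i (Y (adj (T s i) (adj (T t j) h)))))"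
    by (rule sum.swap)
  also have "\<dots> = \<Phi> t (\<Phi> s Y) h"
    unfolding cp_map_def by (rule sum.cong[OF refl], rule bounded_opD(5)[OF T_bounded[OF t], symmetric])
  finally show "\<Phi> s (\<Phi> t Y) h = \<Phi> t (\<Phi> s Y) h" .
qed

lemma iterated_defect_words:
  "iterated_defect k n T q h = (\<Sum>\<beta>\<in>graded_words q. tw \<beta> (\<Delta> (adj (tw \<beta>) h)))"
  unfolding iterated_defect_def by (rule iterated_cp_map[OF T_bounded])

lemma defect_op_eq: "\<Delta> = comp_upto k (\<lambda>i Y. Y - \<Phi> i Y) id"
  by (simp add: defect_op_def id_minus_eq)

text \<open>The source of the last asymptotic formula: its operator is a box sum of those whose
  traces occur in the other formulas.\<close>

lemma telescope_iterated_defect: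
  "comp_upto k (\<lambda>i. id_minus (\<Phi> i ^^ (q i + 1))) id h
    = (\<Sum>s\<in>PiE {1..k} (\<lambda>i. {..q i}). iterated_defect k n T s h)"
proof -
  have "comp_upto k (\<lambda>i. id_minus (\<Phi> i ^^ (q i + 1))) id
      = comp_upto k (\<lambda>i Y. Y - (\<Phi> i ^^ Suc (q i)) Y) id"
    by (simp add: id_minus_eq del: funpow.simps)
  also have "\<dots> = (\<Sum>s\<in>PiE {1..k} (\<lambda>i. {..q i}). iterated_defect k n T s)"
    unfolding iterated_defect_def defect_op_eq by (rule comp_upto_telescope[OF \<Phi>_diff \<Phi>_commute])
  finally show ?thesis by (simp only: sum_fun_apply)
qed

text \<open>Weaker than \<open>positive_op\<close>: without boundedness and reality, nonnegativity
  passes through the maps \<open>\<Phi> i\<close> and finite sums with no further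
  bookkeeping.\<close>

definition psd :: "('h \<Rightarrow> 'h) \<Rightarrow> bool" where "psd Y \<longleftrightarrow> (\<forall>h. 0 \<le> Re (cinner (Y h) h))"

text \<open>The form of the image at \<open>h\<close> is a sum of values of the form of
  \<open>Y\<close> at the vectors \<open>adj (tuple_word j T \<beta>) h\<close>.\<close>

lemma psd_iterated:
  assumes "j \<le> k" "psd Y" shows "psd (comp_upto j (\<lambda>i. \<Phi> i ^^ q i) Y)"
  unfolding psd_def
proof
  fix h
  have T: "bounded_op (T i l)" if "i \<in> {1..j}" "l \<in> {1..n i}" for i l
    using T_bounded assms(1) that by auto
  have eq: "comp_upto j (\<lambda>i. \<Phi> i ^^ q i) Y h
      = (\<Sum>\<beta>\<in>PiE {1..j} (\<lambda>i. words (n i) (q i)). tuple_word j T \<beta> (Y (adj (tuple_word j T \<beta>) h)))"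
    by (rule iterated_cp_map) (rule T)
  have "cinner (comp_upto j (\<lambda>i. \<Phi> i ^^ q i) Y h) h
      = (\<Sum>\<beta>\<in>PiE {1..j} (\<lambda>i. words (n i) (q i)).
          cinner (Y (adj (tuple_word j T \<beta>) h)) (adj (tuple_word j T \<beta>) h))"
    unfolding eq cinner_sum_left
  proof (rule sum.cong[OF refl])
    fix \<beta> assume \<beta>: "\<beta> \<in> PiE {1..j} (\<lambda>i. words (n i) (q i))"
    have "bounded_op (tuple_word j T \<beta>)"
      by (rule bounded_op_tuple_word[where n = n]) (use T \<beta> in \<open>auto simp: words_def PiE_iff\<close>)
    then show "cinner (tuple_word j T \<beta> (Y (adj (tuple_word j T \<beta>) h))) h
        = cinner (Y (adj (tuple_word j T \<beta>) h)) (adj (tuple_word j T \<beta>) h)"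
      by (rule cinner_adj)
  qed
  moreover have "0 \<le> Re (cinner (Y g) g)" for g using assms(2) by (simp add: psd_def)
  ultimately show "0 \<le> Re (cinner (comp_upto j (\<lambda>i. \<Phi> i ^^ q i) Y h) h)"
    by (auto intro: sum_nonneg)
qed

text \<open>The defining positivity of the polyball, taken with exponent 1 up to \<open>j\<close>
  and 0 beyond.\<close>

lemma positive_op_defect_prefix:
  assumes "j \<le> k" shows "positive_op (comp_upto j (\<lambda>i Y. Y - \<Phi> i Y) id)"
proof -
  define p :: "nat \<Rightarrow> nat" where "p i = (if i \<le> j then 1 else 0)" for i
  have "positive_op (comp_upto k (\<lambda>i. id_minus (\<Phi> i) ^^ p i) id)"
    using T by (auto simp: comm_polyball_def polyball_def p_def)
  also have "comp_upto k (\<lambda>i. id_minus (\<Phi> i) ^^ p i) = comp_upto j (\<lambda>i. id_minus (\<Phi> i) ^^ p i)"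
    by (rule comp_upto_truncate[OF assms]) (auto simp: p_def)
  also have "\<dots> = comp_upto j (\<lambda>i Y. Y - \<Phi> i Y)"
    by (rule comp_upto_cong) (auto simp: p_def id_minus_eq fun_eq_iff)
  finally show ?thesis .
qed

lemma positive_op_defect: "positive_op \<Delta>"
  unfolding defect_op_eq by (rule positive_op_defect_prefix) simp

text \<open>Passing from \<open>?R j\<close> to \<open>?R (Suc j)\<close> subtracts the image of
  \<open>?R j\<close> under a power of \<open>\<Phi> (Suc j)\<close>. By telescoping,
  \<open>?R j\<close> is a sum of images of the prefix defect, hence positive, so the forms decrease
  from that of the identity at \<open>j = 0\<close>.\<close>

lemma telescope_le:
  "Re (cinner (comp_upto k (\<lambda>i Y. Y - (\<Phi> i ^^ Suc N) Y) id h) h) \<le> (norm h)\<^sup>2"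
proof -
  let ?R = "\<lambda>j. comp_upto j (\<lambda>i Y. Y - (\<Phi> i ^^ Suc N) Y) id"
  have pow_diff: "(\<Phi> i ^^ m) (Y - Z) = (\<Phi> i ^^ m) Y - (\<Phi> i ^^ m) Z" if "i \<in> {1..k}" for i m Y Z
    using that by (induction m) (auto simp: \<Phi>_diff)
  have pow_comm1: "\<Phi> i ((\<Phi> j ^^ m) Y) = (\<Phi> j ^^ m) (\<Phi> i Y)" if "i \<in> {1..k}" "j \<in> {1..k}" for i j m Y
    using that by (induction m) (auto simp: \<Phi>_commute[of i j])
  have pow_comm: "(\<Phi> i ^^ l) ((\<Phi> j ^^ m) Y) = (\<Phi> j ^^ m) ((\<Phi> i ^^ l) Y)" if "i \<in> {1..k}" "j \<in> {1..k}" for i j l m Y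
    using that by (induction l) (auto simp: pow_comm1)
  have psd_R: "psd (?R j)" if j: "j \<le> k" for j
  proof -
    have "?R j = (\<Sum>s\<in>PiE {1..j} (\<lambda>i. {..N}). comp_upto j (\<lambda>i. \<Phi> i ^^ s i) (comp_upto j (\<lambda>i Y. Y - \<Phi> i Y) id))"
      by (rule comp_upto_telescope[of j \<Phi> "\<lambda>_. N"]) (use j in \<open>auto intro: \<Phi>_diff \<Phi>_commute\<close>)
    moreover have "psd (comp_upto j (\<lambda>i Y. Y - \<Phi> i Y) id)"
      using positive_op_defect_prefix[OF j]
      by (auto simp: psd_def positive_op_def complex_nonneg_Reals_iff)
    then have "psd (comp_upto j (\<lambda>i. \<Phi> i ^^ s i) (comp_upto j (\<lambda>i Y. Y - \<Phi> i Y) id))" for s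
      by (rule psd_iterated[OF j])
    ultimately show ?thesis
      by (auto simp: psd_def sum_fun_apply cinner_sum_left intro!: sum_nonneg)
  qed
  have "Re (cinner (?R j h) h) \<le> (norm h)\<^sup>2" if "j \<le> k" for j
    using that
  proof (induction j)
    case 0
    show ?case by (simp add: cinner_self)
  next
    case (Suc j)
    \<comment> \<open>These exponents isolate one coordinate, so that \<open>psd_iterated\<close>
      covers a power of the single map \<open>\<Phi> (Suc j)\<close>.\<close>
    let ?q = "\<lambda>i. if i = Suc j then Suc N else 0"
    have j: "Suc j \<in> {1..k}" "j \<le> k" using Suc.prems by auto
    have "?R (Suc j) = comp_upto j (\<lambda>i Y. Y - (\<Phi> i ^^ Suc N) Y) (id - (\<Phi> (Suc j) ^^ Suc N) id)" by simp
    also have "\<dots> = ?R j - (\<Phi> (Suc j) ^^ Suc N) (?R j)"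
      by (rule comp_upto_commute[of j "\<lambda>i Y. Y - (\<Phi> i ^^ Suc N) Y" "\<lambda>Y. Y - (\<Phi> (Suc j) ^^ Suc N) Y" id])
        (use j in \<open>simp add: pow_diff pow_comm del: funpow.simps\<close>)
    finally have step: "?R (Suc j) = ?R j - (\<Phi> (Suc j) ^^ Suc N) (?R j)" .
    have "psd (comp_upto (Suc j) (\<lambda>i. \<Phi> i ^^ ?q i) (?R j))"
      by (rule psd_iterated[OF Suc.prems psd_R[OF j(2)]])
    moreover have "comp_upto j (\<lambda>i. \<Phi> i ^^ ?q i) = comp_upto 0 (\<lambda>i. \<Phi> i ^^ ?q i)"
      by (rule comp_upto_truncate) auto
    ultimately have "psd ((\<Phi> (Suc j) ^^ Suc N) (?R j))" by (simp del: funpow.simps)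
    then have "0 \<le> Re (cinner ((\<Phi> (Suc j) ^^ Suc N) (?R j) h) h)" by (simp only: psd_def)
    moreover have "cinner (?R (Suc j) h) h = cinner (?R j h) h - cinner ((\<Phi> (Suc j) ^^ Suc N) (?R j) h) h"
      by (simp only: step minus_apply cinner_diff_left)
    ultimately show ?case using Suc.IH[OF j(2)] by (simp only: minus_complex.sel)
  qed
  then show ?thesis by simp
qed

text \<open>A finite set of word tuples is enlarged to all tuples of words of length at most
  \<open>N\<close>, whose total is the quantity bounded in \<open>telescope_le\<close>. This
  inequality makes the Berezin kernel a well-defined contraction.\<close>

lemma bessel_words:
  assumes B: "finite B" "B \<subseteq> all_words"
  shows "(\<Sum>\<beta>\<in>B. Re (cinner (\<Delta> (adj (tw \<beta>) h)) (adj (tw \<beta>) h))) \<le> (norm h)\<^sup>2"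
proof -
  let ?g = "\<lambda>\<beta>. Re (cinner (\<Delta> (adj (tw \<beta>) h)) (adj (tw \<beta>) h))"
  define N where "N = Max (insert 0 ((\<lambda>(\<beta>, i). length (\<beta> i)) ` (B \<times> {1..k})))"
  have N: "length (\<beta> i) \<le> N" if "\<beta> \<in> B" "i \<in> {1..k}" for \<beta> i
    unfolding N_def by (rule Max_ge) (use B that in \<open>auto intro!: rev_image_eqI[of "(\<beta>, i)"]\<close>)
  have nonneg: "?g \<beta> \<ge> 0" for \<beta>
    using positive_op_defect by (auto simp: positive_op_def complex_nonneg_Reals_iff)
  let ?P = "PiE {1..k} (\<lambda>i. {..N})"
  \<comment> \<open>Tagging each tuple with its vector of lengths turns the enlarged set into a
    disjoint union over multidegrees.\<close>
  let ?len = "\<lambda>\<beta>. restrict (\<lambda>i. length (\<beta> i)) {1..k}"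
  have "(\<Sum>\<beta>\<in>B. ?g \<beta>) = (\<Sum>x\<in>(\<lambda>\<beta>. (?len \<beta>, \<beta>)) ` B. ?g (snd x))"
    by (subst sum.reindex) (auto simp: inj_on_def)
  also have "\<dots> \<le> (\<Sum>x\<in>Sigma ?P graded_words. ?g (snd x))"
  proof (rule sum_mono2)
    show "finite (Sigma ?P graded_words)" by (intro finite_SigmaI finite_PiE finite_graded_words) auto
    show "(\<lambda>\<beta>. (?len \<beta>, \<beta>)) ` B \<subseteq> Sigma ?P graded_words"
    proof clarify
      fix \<beta> assume "\<beta> \<in> B"
      then have "\<beta> \<in> all_words" using B by blast
      then show "?len \<beta> \<in> ?P \<and> \<beta> \<in> graded_words (?len \<beta>)"
        using N[OF \<open>\<beta> \<in> B\<close>] by (simp add: PiE_iff words_def lists_eq_set)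
    qed
  qed (rule nonneg)
  also have "\<dots> = (\<Sum>s\<in>?P. \<Sum>\<beta>\<in>graded_words s. ?g \<beta>)"
    by (subst sum.Sigma) (auto intro!: finite_PiE finite_words simp: case_prod_beta)
  also have "\<dots> = Re (cinner (\<Sum>s\<in>?P. iterated_defect k n T s h) h)"
    unfolding cinner_sum_left Re_sum
  proof (rule sum.cong[OF refl])
    fix s
    show "(\<Sum>\<beta>\<in>graded_words s. ?g \<beta>) = Re (cinner (iterated_defect k n T s h) h)"
      unfolding iterated_defect_words cinner_sum_left Re_sum
      by (rule sum.cong[OF refl]) (use graded_words_subset in \<open>simp add: cinner_adj[OF tw_bounded] subset_iff\<close>)
  qed
  also have "\<dots> \<le> (norm h)\<^sup>2"
    using telescope_le[of N h] telescope_iterated_defect[of "\<lambda>_. N" h]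
    by (simp add: id_minus_eq del: funpow.simps)
  finally show ?thesis .
qed

end

section \<open>Tensor products and Fock spaces\<close>

lemma ell2_eqI: "(\<And>i. Rep_ell2 f i = Rep_ell2 g i) \<Longrightarrow> f = g"
  using Rep_ell2_inject by blast

lemma Rep_sum_ell2: "Rep_ell2 (\<Sum>j\<in>J. f j) i = (\<Sum>j\<in>J. Rep_ell2 (f j) i)"
  by (induction J rule: infinite_finite_induct) (auto simp: Rep_zero_ell2 Rep_plus_ell2)

lemma bounded_linear_Rep_ell2: "bounded_linear (\<lambda>f. Rep_ell2 f i)"
  by (rule bounded_linear_intro[where K = 1])
    (auto simp: Rep_plus_ell2 scaleR_eq_scaleC Rep_scaleC_ell2 norm_Rep_ell2_le)

lemma closed_Rep_ell2_eq: "closed {f :: ('i, 'e :: complex_inner) ell2. Rep_ell2 f i = Rep_ell2 f j}"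
  by (intro closed_Collect_eq linear_continuous_on bounded_linear_Rep_ell2)

lemma closed_Rep_ell2_0: "closed {f :: ('i, 'e :: complex_inner) ell2. Rep_ell2 f i = 0}"
  by (intro closed_Collect_eq linear_continuous_on bounded_linear_Rep_ell2 continuous_on_const)

lemma cinner_ebasis: "cinner f (ebasis \<alpha>) = Rep_ell2 f \<alpha>"
proof -
  have "cinner f (ebasis \<alpha>) = (\<Sum>\<^sub>\<infinity>\<beta>\<in>{\<alpha>}. Rep_ell2 f \<alpha>)"
    unfolding cinner_ell2_def
    by (rule infsum_cong_neutral) (auto simp: Rep_ebasis cinner_complex_def)
  then show ?thesis by simp
qed

lemma etensor_add_left: "etensor (f + g) x = etensor f x + etensor g x"
  by (rule ell2_eqI) (simp add: Rep_etensor Rep_plus_ell2 scaleC_add_left)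

lemma etensor_diff_left: "etensor (f - g) x = etensor f x - etensor g x"
  using etensor_add_left[of "f - g" g x] by simp

lemma etensor_scaleC_left: "etensor (c *\<^sub>C f) x = c *\<^sub>C etensor f x"
  by (rule ell2_eqI) (simp add: Rep_etensor Rep_scaleC_ell2 scaleC_scaleC scaleC_complex_def)

lemma etensor_sum_left: "etensor (\<Sum>j\<in>J. f j) x = (\<Sum>j\<in>J. etensor (f j) x)"
  by (rule ell2_eqI) (simp add: Rep_etensor Rep_sum_ell2 complex_vector.scale_sum_left)

lemma etensor_scaleC_right: "etensor f (c *\<^sub>C x) = c *\<^sub>C etensor f x"
  by (rule ell2_eqI) (simp add: Rep_etensor Rep_scaleC_ell2 scaleC_scaleC mult.commute)

lemma etensor_sum_right: "etensor f (\<Sum>j\<in>J. x j) = (\<Sum>j\<in>J. etensor f (x j))"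
  by (rule ell2_eqI) (simp add: Rep_etensor Rep_sum_ell2 complex_vector.scale_sum_right)

lemma cinner_ptensor:
  "cinner (ptensor k f) (ptensor k g) = (\<Prod>i=1..k. cinner (f i) (g i))"
proof -
  have "cinner (ptensor k f) (ptensor k g)
      = (\<Sum>\<^sub>\<infinity>\<beta>\<in>PiE {1..k} (\<lambda>_. UNIV). \<Prod>i=1..k. cinner (Rep_ell2 (f i) (\<beta> i)) (Rep_ell2 (g i) (\<beta> i)))"
    unfolding cinner_ell2_def
    by (rule infsum_cong_neutral) (auto simp: Rep_ptensor cinner_complex_def prod.distrib PiE_def)
  also have "\<dots> = (\<Prod>i=1..k. \<Sum>\<^sub>\<infinity>w. cinner (Rep_ell2 (f i) w) (Rep_ell2 (g i) w))"
    by (rule infsum_prod_PiE_abs)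
      (auto simp: summable_on_iff_abs_summable_on_complex[symmetric] ell2_cinner_summable)
  finally show ?thesis by (simp add: cinner_ell2_def)
qed

lemma ptensor_cong: "(\<And>i. i \<in> {1..k} \<Longrightarrow> f i = g i) \<Longrightarrow> ptensor k f = ptensor k g"
  by (rule ell2_eqI) (simp add: Rep_ptensor)

lemma ptensor_fun_upd_diff:
  assumes "i \<in> {1..k}"
  shows "ptensor k (f(i := u - v)) = ptensor k (f(i := u)) - ptensor k (f(i := v))"
proof (rule ell2_eqI)
  fix \<beta>
  have "(\<Prod>l=1..k. Rep_ell2 ((f(i := w)) l) (\<beta> l))
      = Rep_ell2 w (\<beta> i) * (\<Prod>l\<in>{1..k} - {i}. Rep_ell2 (f l) (\<beta> l))" for w
    using assms by (subst prod.remove[of _ i]) (auto intro!: prod.cong)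
  then show "Rep_ell2 (ptensor k (f(i := u - v))) \<beta>
      = Rep_ell2 (ptensor k (f(i := u)) - ptensor k (f(i := v))) \<beta>"
    by (simp add: Rep_ptensor Rep_minus_ell2 left_diff_distrib)
qed

lemma ptensor_sum:
  assumes "\<And>i. i \<in> {1..k} \<Longrightarrow> finite (S i)"
  shows "ptensor k (\<lambda>i. \<Sum>A\<in>S i. c i A *\<^sub>C v A)
    = (\<Sum>a\<in>PiE {1..k} S. (\<Prod>i=1..k. c i (a i)) *\<^sub>C ptensor k (\<lambda>i. v (a i)))"
proof (rule ell2_eqI)
  fix \<beta>
  have "(\<Prod>i=1..k. \<Sum>A\<in>S i. c i A * Rep_ell2 (v A) (\<beta> i))
      = (\<Sum>a\<in>PiE {1..k} S. \<Prod>i=1..k. c i (a i) * Rep_ell2 (v (a i)) (\<beta> i))"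
    by (rule prod_sum_PiE) (use assms in auto)
  then show "Rep_ell2 (ptensor k (\<lambda>i. \<Sum>A\<in>S i. c i A *\<^sub>C v A)) \<beta>
    = Rep_ell2 (\<Sum>a\<in>PiE {1..k} S. (\<Prod>i=1..k. c i (a i)) *\<^sub>C ptensor k (\<lambda>i. v (a i))) \<beta>"
    by (simp add: Rep_ptensor Rep_sum_ell2 Rep_scaleC_ell2 scaleC_complex_def prod.distrib)
qed

subsection \<open>Shifts along injections of the index set\<close>

text \<open>For injective \<open>\<sigma>\<close>, the isometry sending the basis vector at
  \<open>\<beta>\<close> to the one at \<open>\<sigma> \<beta>\<close>. The same formula works for
  every coefficient space, so tensoring with an identity does not change it, and unlike
  \<open>ptensor_op\<close> it involves no choice of an operator.\<close>

definition push :: "('i \<Rightarrow> 'i) \<Rightarrow> ('i, 'e :: complex_inner) ell2 \<Rightarrow> ('i, 'e) ell2" where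
  "push \<sigma> f = Abs_ell2 (\<lambda>\<gamma>. if \<gamma> \<in> range \<sigma> then Rep_ell2 f (inv \<sigma> \<gamma>) else 0)"

lemma Rep_push:
  assumes "inj \<sigma>"
  shows "Rep_ell2 (push \<sigma> f) \<gamma> = (if \<gamma> \<in> range \<sigma> then Rep_ell2 f (inv \<sigma> \<gamma>) else 0)"
proof -
  let ?g = "\<lambda>\<gamma>. if \<gamma> \<in> range \<sigma> then Rep_ell2 f (inv \<sigma> \<gamma>) else 0"
  have "(\<lambda>\<gamma>. (norm (?g \<gamma>))\<^sup>2) summable_on range \<sigma>"
    by (subst summable_on_reindex[OF assms]) (simp add: o_def ell2_summable assms)
  then have "(\<lambda>\<gamma>. (norm (?g \<gamma>))\<^sup>2) summable_on UNIV"
    by (rule summable_on_cong_neutral[THEN iffD1, rotated -1]) auto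
  then show ?thesis unfolding push_def by (subst Abs_ell2_inverse) auto
qed

lemma Rep_push_image: "inj \<sigma> \<Longrightarrow> Rep_ell2 (push \<sigma> f) (\<sigma> \<beta>) = Rep_ell2 f \<beta>"
  by (simp add: Rep_push)

lemma Rep_push_outside: "inj \<sigma> \<Longrightarrow> \<gamma> \<notin> range \<sigma> \<Longrightarrow> Rep_ell2 (push \<sigma> f) \<gamma> = 0"
  by (simp add: Rep_push)

lemma cinner_push:
  assumes "inj \<sigma>"
  shows "cinner (push \<sigma> f) g = (\<Sum>\<^sub>\<infinity>\<beta>. cinner (Rep_ell2 f \<beta>) (Rep_ell2 g (\<sigma> \<beta>)))"
proof -
  have "cinner (push \<sigma> f) g = (\<Sum>\<^sub>\<infinity>\<gamma>\<in>range \<sigma>. cinner (Rep_ell2 (push \<sigma> f) \<gamma>) (Rep_ell2 g \<gamma>))"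
    unfolding cinner_ell2_def
    by (rule infsum_cong_neutral) (auto simp: Rep_push_outside[OF assms])
  also have "\<dots> = (\<Sum>\<^sub>\<infinity>\<beta>. cinner (Rep_ell2 f \<beta>) (Rep_ell2 g (\<sigma> \<beta>)))"
    by (subst infsum_reindex[OF assms]) (simp add: o_def Rep_push_image[OF assms])
  finally show ?thesis .
qed

lemma norm_push: "inj \<sigma> \<Longrightarrow> norm (push \<sigma> f) = norm f"
proof -
  assume "inj \<sigma>"
  then have "cinner (push \<sigma> f) (push \<sigma> f) = cinner f f"
    by (simp only: cinner_push[of \<sigma> f "push \<sigma> f"] Rep_push_image) (simp add: cinner_ell2_def)
  then have "(norm (push \<sigma> f))\<^sup>2 = (norm f)\<^sup>2" unfolding cinner_self of_real_eq_iff .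
  then show ?thesis by (simp add: power2_eq_iff_nonneg)
qed

text \<open>Applied to \<open>cons_at i j\<close> for different letters \<open>j\<close>, this is
  the orthogonality of ranges behind the row contraction property of the shifts.\<close>

lemma cinner_push_disjoint:
  assumes "inj \<sigma>" "inj \<tau>" "range \<sigma> \<inter> range \<tau> = {}"
  shows "cinner (push \<sigma> f) (push \<tau> g) = 0"
proof -
  have "\<sigma> \<beta> \<notin> range \<tau>" for \<beta> using assms(3) by blast
  then show ?thesis by (simp add: cinner_push[OF assms(1)] Rep_push_outside[OF assms(2)])
qed

lemma bounded_op_push: "inj \<sigma> \<Longrightarrow> bounded_op (push \<sigma>)"
  unfolding bounded_op_on_def
  by (auto simp: norm_push Rep_push Rep_plus_ell2 Rep_scaleC_ell2 intro!: ell2_eqI exI[of _ 1])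

lemma push_etensor: "inj \<sigma> \<Longrightarrow> push \<sigma> (etensor f x) = etensor (push \<sigma> f) x"
  by (rule ell2_eqI) (simp add: Rep_push Rep_etensor)

definition cons_at :: "nat \<Rightarrow> nat \<Rightarrow> (nat \<Rightarrow> nat list) \<Rightarrow> nat \<Rightarrow> nat list" where
  "cons_at i j \<beta> = \<beta>(i := j # \<beta> i)"

lemma inj_cons_at: "inj (cons_at i j)"
proof (rule injI)
  fix \<beta> \<gamma> assume eq: "cons_at i j \<beta> = cons_at i j \<gamma>"
  have "\<beta> l = \<gamma> l" for l using fun_cong[OF eq, of l] by (cases "l = i") (auto simp: cons_at_def)
  then show "\<beta> = \<gamma>" by blast
qed

lemma range_cons_at_disjoint: "j \<noteq> l \<Longrightarrow> range (cons_at i j) \<inter> range (cons_at i l) = {}"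
  by (auto simp: cons_at_def fun_eq_iff dest!: spec[of _ i])

lemma in_range_cons_at: "\<gamma> \<in> range (cons_at i j) \<longleftrightarrow> (\<exists>\<alpha>. \<gamma> i = j # \<alpha>)"
proof
  assume "\<exists>\<alpha>. \<gamma> i = j # \<alpha>"
  then obtain \<alpha> where "\<gamma> i = j # \<alpha>" ..
  then have "\<gamma> = cons_at i j (\<gamma>(i := \<alpha>))" by (auto simp: cons_at_def fun_eq_iff)
  then show "\<gamma> \<in> range (cons_at i j)" by blast
qed (auto simp: cons_at_def)

lemma push_cons_at_ptensor:
  assumes i: "i \<in> {1..k}"
  shows "push (cons_at i j) (ptensor k f) = ptensor k (f(i := creation j (f i)))"
proof (rule ell2_eqI)
  fix \<gamma>
  have split: "(\<Prod>l=1..k. Rep_ell2 ((f(i := w)) l) (\<delta> l))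
      = Rep_ell2 w (\<delta> i) * (\<Prod>l\<in>{1..k} - {i}. Rep_ell2 (f l) (\<delta> l))" for w \<delta>
    using i by (subst prod.remove[of _ i]) (auto intro!: prod.cong)
  show "Rep_ell2 (push (cons_at i j) (ptensor k f)) \<gamma> = Rep_ell2 (ptensor k (f(i := creation j (f i)))) \<gamma>"
  proof (cases "\<gamma> \<in> range (cons_at i j)")
    case True
    then obtain \<beta> where \<beta>: "\<gamma> = cons_at i j \<beta>" by blast
    have ext: "\<gamma> \<in> extensional {1..k} \<longleftrightarrow> \<beta> \<in> extensional {1..k}"
      using i by (auto simp: \<beta> cons_at_def extensional_def)
    have "(\<Prod>l\<in>{1..k} - {i}. Rep_ell2 (f l) (\<gamma> l)) = (\<Prod>l\<in>{1..k} - {i}. Rep_ell2 (f l) (\<beta> l))"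
      by (rule prod.cong) (auto simp: \<beta> cons_at_def)
    moreover have "Rep_ell2 (creation j (f i)) (\<gamma> i) = Rep_ell2 (f i) (\<beta> i)"
      by (simp add: \<beta> cons_at_def Rep_creation)
    ultimately show ?thesis
      using split[of "creation j (f i)" \<gamma>] split[of "f i" \<beta>] ext
      by (simp add: \<beta> Rep_push_image inj_cons_at Rep_ptensor)
  next
    case False
    then have "Rep_ell2 (creation j (f i)) (\<gamma> i) = 0"
      unfolding in_range_cons_at by (auto simp: Rep_creation split: list.split)
    then show ?thesis
      using split[of "creation j (f i)" \<gamma>]
      by (simp add: Rep_push_outside[OF inj_cons_at False] Rep_ptensor)
  qed
qed

subsection \<open>Ampliations and product operators\<close>

lemma csubspace_tensor_space: "csubspace (tensor_space M D)" "closed (tensor_space M D)"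
  unfolding tensor_space_def by (rule csubspace_closure_cspan closed_closure)+

lemma csubspace_ptensor_space: "csubspace (ptensor_space k M)" "closed (ptensor_space k M)"
  unfolding ptensor_space_def by (rule csubspace_closure_cspan closed_closure)+

lemma etensor_in_tensor_space: "f \<in> M \<Longrightarrow> x \<in> D \<Longrightarrow> etensor f x \<in> tensor_space M D"
  unfolding tensor_space_def by (rule closure_cspan_base) blast

lemma ptensor_in_ptensor_space:
  "(\<And>i. i \<in> {1..k} \<Longrightarrow> f i \<in> M i) \<Longrightarrow> ptensor k f \<in> ptensor_space k M"
  unfolding ptensor_space_def by (rule closure_cspan_base) blast

text \<open>A concrete bounded \<open>R\<close> with the right values on elementary tensors shows
  that the choice behind \<open>ampliation\<close> has a witness; density of their span then forces
  equality. Nothing is claimed off \<open>tensor_space M D\<close>.\<close>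

lemma ampliation_eq:
  assumes R: "bounded_op_on (tensor_space M D) (tensor_space M D) R"
    and RA: "\<And>f x. f \<in> M \<Longrightarrow> x \<in> D \<Longrightarrow> R (etensor f x) = etensor (A f) x"
    and y: "y \<in> tensor_space M D"
  shows "ampliation M D A y = R y"
proof -
  let ?P = "\<lambda>R. bounded_op_on (tensor_space M D) (tensor_space M D) R \<and>
     (\<forall>f\<in>M. \<forall>x\<in>D. R (etensor f x) = etensor (A f) x)"
  have P: "?P (ampliation M D A)"
    unfolding ampliation_def by (rule someI[of ?P R]) (use R RA in blast)
  show ?thesis
  proof (rule bounded_op_on_eqI[where A = "ampliation M D A" and B = R and x = y
        and N = "tensor_space M D" and N' = "tensor_space M D"
        and G = "{etensor f x | f x. f \<in> M \<and> x \<in> D}"])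
    fix g assume "g \<in> {etensor f x | f x. f \<in> M \<and> x \<in> D}"
    then show "ampliation M D A g = R g" using P RA by auto
  qed (use P R y in \<open>simp_all add: tensor_space_def\<close>)
qed

lemma ptensor_op_eq:
  assumes R: "bounded_op_on (ptensor_space k M) (ptensor_space k M) R"
    and RA: "\<And>f. (\<And>i. i \<in> {1..k} \<Longrightarrow> f i \<in> M i) \<Longrightarrow> R (ptensor k f) = ptensor k (\<lambda>i. A i (f i))"
    and y: "y \<in> ptensor_space k M"
  shows "ptensor_op k M A y = R y"
proof -
  let ?P = "\<lambda>R. bounded_op_on (ptensor_space k M) (ptensor_space k M) R \<and>
     (\<forall>f. (\<forall>i\<in>{1..k}. f i \<in> M i) \<longrightarrow> R (ptensor k f) = ptensor k (\<lambda>i. A i (f i)))"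
  have P: "?P (ptensor_op k M A)"
    unfolding ptensor_op_def by (rule someI[of ?P R]) (use R RA in blast)
  show ?thesis
  proof (rule bounded_op_on_eqI[where A = "ptensor_op k M A" and B = R and x = y
        and N = "ptensor_space k M" and N' = "ptensor_space k M"
        and G = "{ptensor k f | f. \<forall>i\<in>{1..k}. f i \<in> M i}"])
    fix g assume "g \<in> {ptensor k f | f. \<forall>i\<in>{1..k}. f i \<in> M i}"
    then show "ptensor_op k M A g = R g" using P RA by auto
  qed (use P R y in \<open>simp_all add: ptensor_space_def\<close>)
qed

text \<open>Orthogonality to the tensor space has to be checked on elementary tensors only, where
  the inner product factors.\<close>

lemma proj_etensor:
  assumes F: "csubspace F" "closed F" and x: "x \<in> D"
  shows "proj (tensor_space F D) (etensor g x) = etensor (proj F g) x"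
proof (rule proj_unique[OF csubspace_tensor_space(1)])
  show "etensor (proj F g) x \<in> tensor_space F D"
    by (intro etensor_in_tensor_space proj_in F x)
  fix z assume z: "z \<in> tensor_space F D"
  show "cinner (etensor g x - etensor (proj F g) x) z = 0"
  proof (rule orthogonal_closure_cspan[OF _ z[unfolded tensor_space_def]])
    fix t assume "t \<in> {etensor f x |f x. f \<in> F \<and> x \<in> D}"
    then obtain f y where t: "t = etensor f y" "f \<in> F" by blast
    show "cinner (etensor g x - etensor (proj F g) x) t = 0"
      using proj_orth[OF F t(2), of g]
      by (simp add: t(1) etensor_diff_left[symmetric] cinner_etensor)
  qed
qed

lemma proj_ptensor_upd:
  assumes M: "\<And>l. l \<in> {1..k} \<Longrightarrow> csubspace (M l)" "\<And>l. l \<in> {1..k} \<Longrightarrow> closed (M l)"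
    and i: "i \<in> {1..k}" and f: "\<And>l. l \<in> {1..k} \<Longrightarrow> f l \<in> M l"
  shows "proj (ptensor_space k M) (ptensor k (f(i := u))) = ptensor k (f(i := proj (M i) u))"
proof (rule proj_unique[OF csubspace_ptensor_space(1)])
  show "ptensor k (f(i := proj (M i) u)) \<in> ptensor_space k M"
    by (rule ptensor_in_ptensor_space) (use proj_in[OF M] i f in auto)
  fix z assume z: "z \<in> ptensor_space k M"
  show "cinner (ptensor k (f(i := u)) - ptensor k (f(i := proj (M i) u))) z = 0"
  proof (rule orthogonal_closure_cspan[OF _ z[unfolded ptensor_space_def]])
    fix t assume "t \<in> {ptensor k f |f. \<forall>i\<in>{1..k}. f i \<in> M i}"
    then obtain g where t: "t = ptensor k g" "g i \<in> M i" using i by blast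
    have "cinner ((f(i := u - proj (M i) u)) i) (g i) = 0"
      using proj_orth[OF M(1)[OF i] M(2)[OF i] t(2)] by simp
    then show "cinner (ptensor k (f(i := u)) - ptensor k (f(i := proj (M i) u))) t = 0"
      unfolding t(1) ptensor_fun_upd_diff[OF i, symmetric] cinner_ptensor using i by (auto intro: prod_zero)
  qed
qed

lemma bounded_op_on_proj_comp:
  fixes M :: "'b :: chilbert_space set" and A :: "'a :: complex_inner \<Rightarrow> 'b"
  assumes M: "csubspace M" "closed M" and A: "bounded_op A"
  shows "bounded_op_on N M (\<lambda>x. proj M (A x))"
proof -
  obtain C where C: "C > 0" "\<And>x. x \<in> UNIV \<Longrightarrow> norm (A x) \<le> C * norm x"
    using bounded_op_on_bound[OF A] by blast
  have "norm (proj M (A x)) \<le> C * norm x" for x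
    using norm_proj_le[OF M, of "A x"] C(2)[of x] by simp
  then show ?thesis
    by (auto simp: bounded_op_on_def proj_in[OF M] proj_add[OF M] proj_scaleC[OF M] bounded_opD[OF A])
qed

text \<open>Compressing a shift is compatible with tensoring by an identity. The characteristic
  function needs this for two coefficient spaces, the defect space and the whole auxiliary
  space.\<close>

lemma ampliation_proj_push:
  fixes D :: "'e :: chilbert_space set"
  assumes F: "csubspace F" "closed F" and \<sigma>: "inj \<sigma>"
    and A: "\<And>f. f \<in> F \<Longrightarrow> A f = proj F (push \<sigma> f)" and y: "y \<in> tensor_space F D"
  shows "ampliation F D A y = proj (tensor_space F D) (push \<sigma> y)"
  by (rule ampliation_eq[OF _ _ y])
    (simp_all add: bounded_op_on_proj_comp csubspace_tensor_space bounded_op_push \<sigma> push_etensor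
      proj_etensor[OF F] A)

text \<open>The scalar \<open>c j\<close> is kept apart so that one statement serves the square root
  of the defect operator and the degree projections with their weights.\<close>

lemma bounded_op_on_finite_sum:
  fixes u :: "'j \<Rightarrow> 'a :: complex_inner"
  assumes M: "csubspace M" and v: "\<And>j. j \<in> J \<Longrightarrow> v j \<in> M"
  shows "bounded_op_on N M (\<lambda>g. \<Sum>j\<in>J. (cinner g (u j) * c j) *\<^sub>C v j)"
proof -
  have "norm (\<Sum>j\<in>J. (cinner g (u j) * c j) *\<^sub>C v j) \<le> (\<Sum>j\<in>J. norm (u j) * cmod (c j) * norm (v j)) * norm g" for g
    unfolding sum_distrib_right
  proof (rule sum_norm_le)
    fix j
    have "norm ((cinner g (u j) * c j) *\<^sub>C v j) = cmod (cinner g (u j)) * (cmod (c j) * norm (v j))"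
      by (simp add: norm_scaleC norm_mult)
    also have "\<dots> \<le> (norm g * norm (u j)) * (cmod (c j) * norm (v j))"
      by (intro mult_right_mono cmod_cinner_le) simp
    finally show "norm ((cinner g (u j) * c j) *\<^sub>C v j) \<le> norm (u j) * cmod (c j) * norm (v j) * norm g"
      by (simp add: mult_ac)
  qed
  then have "\<exists>C. \<forall>g\<in>N. norm (\<Sum>j\<in>J. (cinner g (u j) * c j) *\<^sub>C v j) \<le> C * norm g" by blast
  moreover have "(\<Sum>j\<in>J. (cinner g (u j) * c j) *\<^sub>C v j) \<in> M" for g
    by (intro complex_vector.subspace_sum[OF M] complex_vector.subspace_scale[OF M] v)
  moreover have "(\<Sum>j\<in>J. (cinner (g + h) (u j) * c j) *\<^sub>C v j)
      = (\<Sum>j\<in>J. (cinner g (u j) * c j) *\<^sub>C v j) + (\<Sum>j\<in>J. (cinner h (u j) * c j) *\<^sub>C v j)" for g h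
    by (simp add: cinner_add_left distrib_right scaleC_add_left sum.distrib)
  moreover have "(\<Sum>j\<in>J. (cinner (a *\<^sub>C g) (u j) * c j) *\<^sub>C v j)
      = a *\<^sub>C (\<Sum>j\<in>J. (cinner g (u j) * c j) *\<^sub>C v j)" for a g
    by (simp add: cinner_scaleC_left scaleC_scaleC complex_vector.scale_sum_right mult.assoc)
  ultimately show ?thesis unfolding bounded_op_on_def by blast
qed

subsection \<open>The symmetric Fock space\<close>

text \<open>Left unnormalised: the squared norm is a multinomial coefficient, and backward shifts
  send such vectors to each other or to 0 without any factor.\<close>

definition sym_vec :: "nat multiset \<Rightarrow> (nat list, complex) ell2" where
  "sym_vec A = (\<Sum>\<alpha>\<in>permutations_of_multiset A. ebasis \<alpha>)"

text \<open>The multinomial coefficient of the multiplicities in \<open>A\<close>.\<close>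

definition multinom :: "nat multiset \<Rightarrow> nat" where
  "multinom A = card (permutations_of_multiset A)"

definition msets :: "nat \<Rightarrow> nat \<Rightarrow> nat multiset set" where
  "msets n q = {A. set_mset A \<subseteq> {1..n} \<and> size A = q}"

lemma Rep_sym_vec: "Rep_ell2 (sym_vec A) \<alpha> = (if mset \<alpha> = A then 1 else 0)"
  by (simp add: sym_vec_def Rep_sum_ell2 Rep_ebasis) (simp add: permutations_of_multiset_def)

lemma multinom_pos: "multinom A > 0"
  by (simp add: multinom_def card_gt_0_iff permutations_of_multiset_not_empty)

lemma msets_eq_image: "msets n q = mset ` words n q"
proof (intro equalityI subsetI)
  fix A assume A: "A \<in> msets n q"
  obtain \<alpha> where "mset \<alpha> = A" using ex_mset by blast
  then show "A \<in> mset ` words n q" using A by (auto simp: msets_def words_def intro!: image_eqI[of _ _ \<alpha>])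
qed (auto simp: msets_def words_def)

lemma finite_msets: "finite (msets n q)"
  by (simp add: msets_eq_image finite_words)

lemma cinner_sym_vec: "cinner f (sym_vec A) = (\<Sum>\<alpha>\<in>permutations_of_multiset A. Rep_ell2 f \<alpha>)"
  by (simp add: sym_vec_def cinner_sum_right cinner_ebasis)

lemma cinner_sym_vec_sym_vec:
  "cinner (sym_vec A) (sym_vec B) = (if A = B then of_nat (multinom A) else 0)"
  by (auto simp: cinner_sym_vec Rep_sym_vec permutations_of_multiset_def multinom_def)

lemma fock_support:
  assumes "f \<in> fock n" "\<alpha> \<notin> lists {1..n}" shows "Rep_ell2 f \<alpha> = 0"
proof -
  have "fock n \<subseteq> {f. Rep_ell2 f \<alpha> = 0}"
    unfolding fock_def
    by (rule closure_cspan_minimal)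
      (use assms(2) in \<open>auto simp: Rep_ebasis Rep_zero_ell2 Rep_plus_ell2 Rep_scaleC_ell2
        intro!: csubspaceI closed_Rep_ell2_0\<close>)
  then show ?thesis using assms(1) by blast
qed

lemma sym_vec_in_fock: "set_mset A \<subseteq> {1..n} \<Longrightarrow> sym_vec A \<in> fock n"
  unfolding fock_def sym_vec_def
  by (intro complex_vector.subspace_sum[OF csubspace_closure_cspan] closure_cspan_base imageI)
    (auto simp: permutations_of_multiset_def lists_eq_set)

lemma symmetric_tensor_sym_vec:
  assumes "set_mset A \<subseteq> {1..n}" shows "symmetric_tensor n (size A) (sym_vec A)"
  unfolding symmetric_tensor_def homogeneous_def
  using assms by (auto simp: sym_vec_in_fock Rep_sym_vec)

lemma sym_vec_in_sym_fock: "set_mset A \<subseteq> {1..n} \<Longrightarrow> sym_vec A \<in> sym_fock n"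
  unfolding sym_fock_def by (rule closure_cspan_base) (use symmetric_tensor_sym_vec in blast)

lemma csubspace_sym_fock: "csubspace (sym_fock n)" "closed (sym_fock n)"
  unfolding sym_fock_def by (rule csubspace_closure_cspan closed_closure)+

text \<open>Two words with equal letter content differ by a permutation of positions. Equality of
  two coordinates is a closed linear condition, so the invariance of symmetric tensors passes to
  their closed span.\<close>

lemma sym_fock_mset:
  assumes "f \<in> sym_fock n" "mset \<alpha> = mset \<beta>" shows "Rep_ell2 f \<alpha> = Rep_ell2 f \<beta>"
proof -
  have "sym_fock n \<subseteq> {f. Rep_ell2 f \<alpha> = Rep_ell2 f \<beta>}"
    unfolding sym_fock_def
  proof (rule closure_cspan_minimal)
    show "{f. \<exists>p. symmetric_tensor n p f} \<subseteq> {f. Rep_ell2 f \<alpha> = Rep_ell2 f \<beta>}"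
    proof clarify
      fix f p assume f: "symmetric_tensor n p f"
      obtain \<pi> where \<pi>: "\<pi> permutes {..<length \<beta>}" "permute_list \<pi> \<beta> = \<alpha>"
        using mset_eq_permutation[OF assms(2)] by blast
      have len: "length \<alpha> = length \<beta>" using assms(2) by (rule mset_eq_length)
      show "Rep_ell2 f \<alpha> = Rep_ell2 f \<beta>"
      proof (cases "length \<beta> = p")
        case True
        then show ?thesis using f \<pi> unfolding symmetric_tensor_def by blast
      next
        case False
        then show ?thesis using f len by (simp add: symmetric_tensor_def homogeneous_def)
      qed
    qed
  qed (auto simp: Rep_zero_ell2 Rep_plus_ell2 Rep_scaleC_ell2 intro!: csubspaceI closed_Rep_ell2_eq)
  then show ?thesis using assms(1) by blast
qed

lemma sym_fock_support:
  assumes "f \<in> sym_fock n" "\<alpha> \<notin> lists {1..n}" shows "Rep_ell2 f \<alpha> = 0"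
proof -
  have "sym_fock n \<subseteq> {f. Rep_ell2 f \<alpha> = 0}"
    unfolding sym_fock_def
  proof (rule closure_cspan_minimal)
    show "{f. \<exists>p. symmetric_tensor n p f} \<subseteq> {f. Rep_ell2 f \<alpha> = 0}"
      using fock_support[OF _ assms(2)] unfolding symmetric_tensor_def by blast
  qed (auto simp: Rep_zero_ell2 Rep_plus_ell2 Rep_scaleC_ell2 intro!: csubspaceI closed_Rep_ell2_0)
  then show ?thesis using assms(1) by blast
qed

lemma cinner_sym_fock_sym_vec:
  assumes "f \<in> sym_fock n" shows "cinner f (sym_vec (mset \<alpha>)) = of_nat (multinom (mset \<alpha>)) * Rep_ell2 f \<alpha>"
proof -
  have "cinner f (sym_vec (mset \<alpha>)) = (\<Sum>\<beta>\<in>permutations_of_multiset (mset \<alpha>). Rep_ell2 f \<alpha>)"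
    unfolding cinner_sym_vec
    by (rule sum.cong) (auto simp: permutations_of_multiset_def intro: sym_fock_mset[OF assms])
  then show ?thesis by (simp add: multinom_def)
qed

text \<open>Coordinates depend only on the letter content of the word, and a fixed degree admits
  finitely many contents. So the homogeneous component is finite-dimensional, with the vectors
  \<open>sym_vec A\<close> as an orthogonal basis.\<close>

lemma homogeneous_sym_fock_expansion:
  assumes f: "f \<in> sym_fock n" "homogeneous q f"
  shows "f = (\<Sum>A\<in>msets n q. (cinner f (sym_vec A) * inverse (of_nat (multinom A))) *\<^sub>C sym_vec A)"
proof (rule ell2_eqI)
  fix \<alpha>
  let ?c = "\<lambda>A. cinner f (sym_vec A) * inverse (of_nat (multinom A))"
  have "Rep_ell2 (\<Sum>A\<in>msets n q. ?c A *\<^sub>C sym_vec A) \<alpha> = (\<Sum>A\<in>msets n q. if A = mset \<alpha> then ?c A else 0)"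
    unfolding Rep_sum_ell2 Rep_scaleC_ell2 Rep_sym_vec scaleC_complex_def by (rule sum.cong) auto
  also have "\<dots> = (if mset \<alpha> \<in> msets n q then ?c (mset \<alpha>) else 0)"
    by (simp add: finite_msets)
  also have "\<dots> = Rep_ell2 f \<alpha>"
  proof (cases "mset \<alpha> \<in> msets n q")
    case True
    have "of_nat (multinom (mset \<alpha>)) \<noteq> (0 :: complex)" using multinom_pos[of "mset \<alpha>"] by simp
    then show ?thesis using True by (simp add: cinner_sym_fock_sym_vec[OF f(1)] field_simps)
  next
    case False
    then have "\<alpha> \<notin> lists {1..n} \<or> length \<alpha> \<noteq> q" by (auto simp: msets_def lists_eq_set)
    then have "Rep_ell2 f \<alpha> = 0" using f(2) sym_fock_support[OF f(1)] unfolding homogeneous_def by blast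
    then show ?thesis using False by simp
  qed
  finally show "Rep_ell2 f \<alpha> = Rep_ell2 (\<Sum>A\<in>msets n q. ?c A *\<^sub>C sym_vec A) \<alpha>" by simp
qed

lemma degree_proj_eq:
  "degree_proj n q g = (\<Sum>A\<in>msets n q. (cinner g (sym_vec A) * inverse (of_nat (multinom A))) *\<^sub>C sym_vec A)"
  (is "_ = ?y")
  unfolding degree_proj_def
proof (rule proj_unique)
  let ?M = "{f \<in> sym_fock n. homogeneous q f}"
  show M: "csubspace ?M"
    using csubspace_sym_fock(1)
    by (intro csubspaceI)
      (auto simp: homogeneous_def Rep_zero_ell2 Rep_plus_ell2 Rep_scaleC_ell2 scaleC_complex_def
        intro: complex_vector.subspace_0 complex_vector.subspace_add complex_vector.subspace_scale)
  have "sym_vec A \<in> ?M" if "A \<in> msets n q" for A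
    using that symmetric_tensor_sym_vec[of A n] by (auto simp: msets_def sym_vec_in_sym_fock symmetric_tensor_def)
  then show "?y \<in> ?M"
    by (intro complex_vector.subspace_sum[OF M] complex_vector.subspace_scale[OF M])
  have orth: "cinner (g - ?y) (sym_vec B) = 0" if B: "B \<in> msets n q" for B
  proof -
    have "cinner ?y (sym_vec B) = (\<Sum>A\<in>msets n q. if A = B then cinner g (sym_vec B) else 0)"
      unfolding cinner_sum_left cinner_scaleC_left cinner_sym_vec_sym_vec
      by (rule sum.cong) (use multinom_pos in \<open>auto simp: mult.assoc\<close>)
    then show ?thesis using B by (simp add: cinner_diff_left finite_msets)
  qed
  fix z assume "z \<in> ?M"
  then have "z = (\<Sum>A\<in>msets n q. (cinner z (sym_vec A) * inverse (of_nat (multinom A))) *\<^sub>C sym_vec A)"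
    using homogeneous_sym_fock_expansion by blast
  then have "cinner (g - ?y) z = cinner (g - ?y)
      (\<Sum>A\<in>msets n q. (cinner z (sym_vec A) * inverse (of_nat (multinom A))) *\<^sub>C sym_vec A)"
    by (rule arg_cong)
  also have "\<dots> = 0"
    unfolding cinner_sum_right by (rule sum.neutral) (simp add: cinner_scaleC_right orth)
  finally show "cinner (g - ?y) z = 0" .
qed

lemma trace_degree_proj: "trace_on (sym_fock n) (degree_proj n q) = of_nat (card (msets n q))"
proof -
  have "trace_on (sym_fock n) (degree_proj n q)
      = (\<Sum>A\<in>msets n q. cinner (inverse (of_nat (multinom A)) *\<^sub>C sym_vec A) (sym_vec A))"
    by (rule trace_on_finite_sum[OF csubspace_sym_fock finite_msets])
      (auto simp: degree_proj_eq scaleC_scaleC msets_def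
        intro!: complex_vector.subspace_scale[OF csubspace_sym_fock(1)] sym_vec_in_sym_fock)
  also have "\<dots> = (\<Sum>A\<in>msets n q. 1)"
    by (rule sum.cong) (use multinom_pos in \<open>auto simp: cinner_scaleC_left cinner_sym_vec_sym_vec\<close>)
  finally show ?thesis by simp
qed

subsection \<open>Products of symmetric Fock spaces\<close>

definition mdegs :: "nat \<Rightarrow> (nat \<Rightarrow> nat) \<Rightarrow> (nat \<Rightarrow> nat) \<Rightarrow> (nat \<Rightarrow> nat multiset) set" where
  "mdegs k n q = PiE {1..k} (\<lambda>i. msets (n i) (q i))"

definition multi_vec :: "nat \<Rightarrow> (nat \<Rightarrow> nat multiset) \<Rightarrow> (nat \<Rightarrow> nat list, complex) ell2" where
  "multi_vec k a = ptensor k (\<lambda>i. sym_vec (a i))"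

definition multi_num :: "nat \<Rightarrow> (nat \<Rightarrow> nat multiset) \<Rightarrow> nat" where
  "multi_num k a = (\<Prod>i=1..k. multinom (a i))"

lemma finite_mdegs: "finite (mdegs k n q)"
  unfolding mdegs_def by (intro finite_PiE finite_msets) simp

lemma multi_num_pos: "multi_num k a > 0"
  by (simp add: multi_num_def prod_pos multinom_pos)

lemma cinner_multi_vec:
  assumes "a \<in> extensional {1..k}" "b \<in> extensional {1..k}"
  shows "cinner (multi_vec k a) (multi_vec k b) = (if a = b then of_nat (multi_num k a) else 0)"
proof (cases "a = b")
  case False
  then obtain i where "i \<in> {1..k}" "a i \<noteq> b i" using assms extensionalityI by blast
  then have "\<exists>i\<in>{1..k}. cinner (sym_vec (a i)) (sym_vec (b i)) = 0" by (auto simp: cinner_sym_vec_sym_vec)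
  then show ?thesis using False by (simp add: multi_vec_def cinner_ptensor prod_zero_iff)
qed (simp add: multi_vec_def cinner_ptensor multi_num_def cinner_sym_vec_sym_vec)

lemma Rep_multi_vec:
  "Rep_ell2 (multi_vec k a) \<beta>
    = (if \<beta> \<in> extensional {1..k} \<and> (\<forall>i\<in>{1..k}. mset (\<beta> i) = a i) then 1 else 0)"
proof -
  have "(\<Prod>i=1..k. if mset (\<beta> i) = a i then 1 else 0 :: complex) = (if \<forall>i\<in>{1..k}. mset (\<beta> i) = a i then 1 else 0)"
    by (cases "\<forall>i\<in>{1..k}. mset (\<beta> i) = a i") (auto simp: prod_zero_iff)
  then show ?thesis by (simp add: multi_vec_def Rep_ptensor Rep_sym_vec)
qed

lemma multi_vec_in:
  assumes "a \<in> mdegs k n q" shows "multi_vec k a \<in> sym_fock_tensor k n"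
  unfolding multi_vec_def sym_fock_tensor_def
proof (intro ptensor_in_ptensor_space sym_vec_in_sym_fock)
  fix i assume "i \<in> {1..k}"
  then have "a i \<in> msets (n i) (q i)" using assms unfolding mdegs_def by (rule PiE_mem[rotated])
  then show "set_mset (a i) \<subseteq> {1..n i}" by (simp add: msets_def)
qed

lemma csubspace_sym_fock_tensor: "csubspace (sym_fock_tensor k n)" "closed (sym_fock_tensor k n)"
  unfolding sym_fock_tensor_def by (rule csubspace_ptensor_space)+

lemma multidegree_proj_eq:
  assumes "g \<in> sym_fock_tensor k n"
  shows "multidegree_proj k n q g
    = (\<Sum>a\<in>mdegs k n q. (cinner g (multi_vec k a) * inverse (of_nat (multi_num k a))) *\<^sub>C multi_vec k a)"
  unfolding multidegree_proj_def
proof (rule ptensor_op_eq)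
  show "bounded_op_on (ptensor_space k (\<lambda>i. sym_fock (n i))) (ptensor_space k (\<lambda>i. sym_fock (n i)))
    (\<lambda>g. \<Sum>a\<in>mdegs k n q. (cinner g (multi_vec k a) * inverse (of_nat (multi_num k a))) *\<^sub>C multi_vec k a)"
    by (rule bounded_op_on_finite_sum[OF csubspace_ptensor_space(1)])
      (use multi_vec_in in \<open>auto simp: sym_fock_tensor_def\<close>)
  show "g \<in> ptensor_space k (\<lambda>i. sym_fock (n i))" using assms by (simp add: sym_fock_tensor_def)
  fix f
  have "ptensor k (\<lambda>i. degree_proj (n i) (q i) (f i))
      = (\<Sum>a\<in>mdegs k n q. (\<Prod>i=1..k. cinner (f i) (sym_vec (a i)) * inverse (of_nat (multinom (a i))))
          *\<^sub>C multi_vec k a)"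
    unfolding degree_proj_eq mdegs_def multi_vec_def by (rule ptensor_sum) (rule finite_msets)
  also have "\<dots> = (\<Sum>a\<in>mdegs k n q. (cinner (ptensor k f) (multi_vec k a) * inverse (of_nat (multi_num k a))) *\<^sub>C multi_vec k a)"
    by (simp add: multi_vec_def multi_num_def cinner_ptensor prod.distrib prod_inversef[symmetric] o_def)
  finally show "(\<Sum>a\<in>mdegs k n q. (cinner (ptensor k f) (multi_vec k a) * inverse (of_nat (multi_num k a))) *\<^sub>C multi_vec k a)
    = ptensor k (\<lambda>i. degree_proj (n i) (q i) (f i))" by simp
qed

lemma trace_multidegree_proj:
  "trace_on (sym_fock_tensor k n) (multidegree_proj k n q) = of_nat (card (mdegs k n q))"
proof -
  have "trace_on (sym_fock_tensor k n) (multidegree_proj k n q)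
      = (\<Sum>a\<in>mdegs k n q. cinner (inverse (of_nat (multi_num k a)) *\<^sub>C multi_vec k a) (multi_vec k a))"
    by (rule trace_on_finite_sum[OF csubspace_sym_fock_tensor finite_mdegs])
      (auto simp: multidegree_proj_eq scaleC_scaleC
        intro!: complex_vector.subspace_scale[OF csubspace_sym_fock_tensor(1)] multi_vec_in)
  also have "\<dots> = (\<Sum>a\<in>mdegs k n q. 1)"
  proof (rule sum.cong[OF refl])
    fix a assume "a \<in> mdegs k n q"
    then have "a \<in> extensional {1..k}" by (auto simp: mdegs_def PiE_def)
    then show "cinner (inverse (of_nat (multi_num k a)) *\<^sub>C multi_vec k a) (multi_vec k a) = 1"
      using multi_num_pos[of k a] by (simp add: cinner_scaleC_left cinner_multi_vec)
  qed
  finally show ?thesis by simp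
qed

lemma card_mdegs: "card (mdegs k n q) = (\<Prod>i=1..k. card (msets (n i) (q i)))"
  by (simp add: mdegs_def card_PiE)

lemma ampliation_multidegree_proj:
  fixes D :: "'e :: chilbert_space set"
  assumes L: "finite L" "\<And>l. l \<in> L \<Longrightarrow> e l \<in> D" "\<And>x. x \<in> D \<Longrightarrow> x = (\<Sum>l\<in>L. cinner x (e l) *\<^sub>C e l)"
    and y: "y \<in> tensor_space (sym_fock_tensor k n) D"
  shows "ampliation (sym_fock_tensor k n) D (multidegree_proj k n q) y
    = (\<Sum>(a, l)\<in>mdegs k n q \<times> L. (cinner y (etensor (multi_vec k a) (e l)) * inverse (of_nat (multi_num k a)))
        *\<^sub>C etensor (multi_vec k a) (e l))"
  unfolding case_prod_beta
proof (rule ampliation_eq[OF _ _ y])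
  show "bounded_op_on (tensor_space (sym_fock_tensor k n) D) (tensor_space (sym_fock_tensor k n) D)
     (\<lambda>y. \<Sum>p\<in>mdegs k n q \<times> L. (cinner y (etensor (multi_vec k (fst p)) (e (snd p))) * inverse (of_nat (multi_num k (fst p))))
        *\<^sub>C etensor (multi_vec k (fst p)) (e (snd p)))"
    by (rule bounded_op_on_finite_sum[OF csubspace_tensor_space(1)])
      (use L multi_vec_in in \<open>auto intro!: etensor_in_tensor_space\<close>)
  fix f x assume f: "f \<in> sym_fock_tensor k n" and x: "x \<in> D"
  have "(\<Sum>p\<in>mdegs k n q \<times> L. (cinner (etensor f x) (etensor (multi_vec k (fst p)) (e (snd p))) * inverse (of_nat (multi_num k (fst p))))
        *\<^sub>C etensor (multi_vec k (fst p)) (e (snd p)))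
      = (\<Sum>a\<in>mdegs k n q. \<Sum>l\<in>L. ((cinner f (multi_vec k a) * inverse (of_nat (multi_num k a))) * cinner x (e l))
        *\<^sub>C etensor (multi_vec k a) (e l))"
    by (simp add: sum.cartesian_product case_prod_beta cinner_etensor mult_ac)
  also have "\<dots> = etensor (multidegree_proj k n q f) (\<Sum>l\<in>L. cinner x (e l) *\<^sub>C e l)"
    by (subst sum.swap) (simp add: multidegree_proj_eq[OF f] etensor_sum_left etensor_sum_right
        etensor_scaleC_left etensor_scaleC_right scaleC_scaleC complex_vector.scale_sum_right mult_ac)
  finally show "(\<Sum>p\<in>mdegs k n q \<times> L. (cinner (etensor f x) (etensor (multi_vec k (fst p)) (e (snd p))) * inverse (of_nat (multi_num k (fst p))))
        *\<^sub>C etensor (multi_vec k (fst p)) (e (snd p))) = etensor (multidegree_proj k n q f) x"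
    using L(3)[OF x] by simp
qed

text \<open>Compressing slot \<open>i\<close> alone agrees with compressing the whole tensor,
  because the other slots already hold symmetric vectors.\<close>

lemma sym_shift_eq:
  assumes i: "i \<in> {1..k}" and f: "f \<in> sym_fock_tensor k n"
  shows "sym_shift k n i j f = proj (sym_fock_tensor k n) (push (cons_at i j) f)"
  unfolding sym_shift_def
proof (rule ptensor_op_eq)
  show "bounded_op_on (ptensor_space k (\<lambda>l. sym_fock (n l))) (ptensor_space k (\<lambda>l. sym_fock (n l)))
     (\<lambda>f. proj (sym_fock_tensor k n) (push (cons_at i j) f))"
    unfolding sym_fock_tensor_def
    by (intro bounded_op_on_proj_comp csubspace_ptensor_space bounded_op_push inj_cons_at)
  show "f \<in> ptensor_space k (\<lambda>l. sym_fock (n l))" using f by (simp add: sym_fock_tensor_def)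
  fix f assume f: "\<And>i. i \<in> {1..k} \<Longrightarrow> f i \<in> sym_fock (n i)"
  have "proj (sym_fock_tensor k n) (push (cons_at i j) (ptensor k f))
      = ptensor k (f(i := proj (sym_fock (n i)) (creation j (f i))))"
    unfolding sym_fock_tensor_def push_cons_at_ptensor[OF i]
    by (rule proj_ptensor_upd) (use csubspace_sym_fock i f in auto)
  also have "\<dots> = ptensor k (\<lambda>l. (if l = i then sym_creation (n i) j else id) (f l))"
    by (rule ptensor_cong) (auto simp: sym_creation_def)
  finally show "proj (sym_fock_tensor k n) (push (cons_at i j) (ptensor k f))
    = ptensor k (\<lambda>l. (if l = i then sym_creation (n i) j else id) (f l))" .
qed

text \<open>Prefixing \<open>j\<close> in slot \<open>i\<close> produces content \<open>a\<close>
  exactly from the tuples whose content is \<open>a\<close> with one \<open>j\<close> removed. So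
  the adjoint of the shift removes a letter, with coefficient 1.\<close>

lemma cinner_push_multi_vec:
  assumes i: "i \<in> {1..k}"
  shows "cinner (push (cons_at i j) x) (etensor (multi_vec k a) d)
    = (if j \<in># a i then cinner x (etensor (multi_vec k (a(i := a i - {#j#}))) d) else 0)"
proof -
  have "Rep_ell2 (multi_vec k a) (cons_at i j \<beta>)
      = (if j \<in># a i then Rep_ell2 (multi_vec k (a(i := a i - {#j#}))) \<beta> else 0)" for \<beta>
  proof -
    have ext: "cons_at i j \<beta> \<in> extensional {1..k} \<longleftrightarrow> \<beta> \<in> extensional {1..k}"
      using i by (auto simp: cons_at_def extensional_def)
    have ms: "add_mset j (mset (\<beta> i)) = a i \<longleftrightarrow> j \<in># a i \<and> mset (\<beta> i) = a i - {#j#}"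
    proof
      assume "add_mset j (mset (\<beta> i)) = a i"
      then have "a i = add_mset j (mset (\<beta> i))" by simp
      then show "j \<in># a i \<and> mset (\<beta> i) = a i - {#j#}" by simp
    qed simp
    have eq: "(\<forall>l\<in>{1..k}. mset (cons_at i j \<beta> l) = a l)
        \<longleftrightarrow> j \<in># a i \<and> (\<forall>l\<in>{1..k}. mset (\<beta> l) = (a(i := a i - {#j#})) l)"
      using i ms by (auto simp: cons_at_def)
    show ?thesis
      by (cases "j \<in># a i") (simp_all only: Rep_multi_vec ext eq simp_thms if_True if_False)
  qed
  then show ?thesis
    by (simp only: cinner_push[OF inj_cons_at] Rep_etensor) (simp add: cinner_ell2_def Rep_etensor)
qed

section \<open>The constrained Berezin kernel\<close>

lemma cinner_etensor_ebasis: "cinner f (etensor (ebasis \<beta>) x) = cinner (Rep_ell2 f \<beta>) x"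
proof -
  have "cinner f (etensor (ebasis \<beta>) x) = (\<Sum>\<^sub>\<infinity>\<gamma>\<in>{\<beta>}. cinner (Rep_ell2 f \<beta>) x)"
    unfolding cinner_ell2_def
    by (rule infsum_cong_neutral) (auto simp: Rep_etensor Rep_ebasis)
  then show ?thesis by simp
qed

lemma Rep_etensor_ebasis: "Rep_ell2 (etensor (ebasis \<beta>) x) \<gamma> = (if \<gamma> = \<beta> then x else 0)"
  by (simp add: Rep_etensor Rep_ebasis)

text \<open>By Pythagoras the squared error of a finite subsum is a tail of the convergent series of
  squared norms.\<close>

lemma has_sum_ell2:
  fixes f :: "('i, 'e :: complex_inner) ell2"
  shows "((\<lambda>\<beta>. etensor (ebasis \<beta>) (Rep_ell2 f \<beta>)) has_sum f) UNIV"
  unfolding has_sum_def tendsto_iff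
proof (intro allI impI)
  fix \<epsilon> :: real assume "\<epsilon> > 0"
  let ?s = "\<lambda>Y. \<Sum>\<beta>\<in>Y. etensor (ebasis \<beta>) (Rep_ell2 f \<beta>)"
  have norm_s: "(norm f)\<^sup>2 = (norm (f - ?s Y))\<^sup>2 + (\<Sum>\<beta>\<in>Y. (norm (Rep_ell2 f \<beta>))\<^sup>2)" if "finite Y" for Y
  proof -
    have Rep_s: "Rep_ell2 (?s Y) \<gamma> = (if \<gamma> \<in> Y then Rep_ell2 f \<gamma> else 0)" for \<gamma>
      using that by (simp add: Rep_sum_ell2 Rep_etensor_ebasis)
    have "cinner (f - ?s Y) (?s Y) = 0"
      unfolding cinner_sum_right cinner_etensor_ebasis by (simp add: Rep_minus_ell2 Rep_s)
    then have "(norm (f - ?s Y + ?s Y))\<^sup>2 = (norm (f - ?s Y))\<^sup>2 + (norm (?s Y))\<^sup>2"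
      by (rule norm_add_sq_orth)
    moreover have "(norm (?s Y))\<^sup>2 = (\<Sum>\<beta>\<in>Y. (norm (etensor (ebasis \<beta>) (Rep_ell2 f \<beta>)))\<^sup>2)"
      by (rule norm_sum_sq_orth[OF that]) (simp add: cinner_etensor_ebasis Rep_etensor_ebasis)
    moreover have "(norm (etensor (ebasis \<beta>) x))\<^sup>2 = (norm x)\<^sup>2" for \<beta> :: 'i and x :: 'e
    proof -
      have "cinner (etensor (ebasis \<beta>) x) (etensor (ebasis \<beta>) x) = cinner x x"
        by (simp add: cinner_etensor_ebasis Rep_etensor_ebasis)
      then show ?thesis unfolding cinner_self of_real_eq_iff .
    qed
    ultimately show ?thesis by simp
  qed
  have "((\<lambda>\<beta>. (norm (Rep_ell2 f \<beta>))\<^sup>2) has_sum (norm f)\<^sup>2) UNIV"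
    unfolding norm_ell2_sq by (rule has_sum_infsum[OF ell2_summable])
  then have "\<forall>\<^sub>F Y in finite_subsets_at_top UNIV. dist (\<Sum>\<beta>\<in>Y. (norm (Rep_ell2 f \<beta>))\<^sup>2) ((norm f)\<^sup>2) < \<epsilon>\<^sup>2"
    unfolding has_sum_def tendsto_iff using \<open>\<epsilon> > 0\<close> by simp
  moreover have "\<forall>\<^sub>F Y in finite_subsets_at_top (UNIV :: 'i set). finite Y"
    by (rule eventually_finite_subsets_at_top_weakI) simp
  ultimately show "\<forall>\<^sub>F Y in finite_subsets_at_top UNIV. dist (?s Y) f < \<epsilon>"
  proof eventually_elim
    case (elim Y)
    then have "(norm (f - ?s Y))\<^sup>2 < \<epsilon>\<^sup>2" using norm_s[of Y] by (simp add: dist_real_def)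
    then have "norm (f - ?s Y) < \<epsilon>" using \<open>\<epsilon> > 0\<close> by (simp add: power_less_imp_less_base)
    then show ?case by (simp add: dist_norm norm_minus_commute[of f])
  qed
qed

lemma ptensor_ebasis:
  assumes "\<beta> \<in> extensional {1..k}" shows "ptensor k (\<lambda>i. ebasis (\<beta> i)) = ebasis \<beta>"
proof (rule ell2_eqI)
  fix \<gamma>
  have "(\<Prod>i=1..k. if \<gamma> i = \<beta> i then 1 else 0 :: complex) = (if \<forall>i\<in>{1..k}. \<gamma> i = \<beta> i then 1 else 0)"
    by (cases "\<forall>i\<in>{1..k}. \<gamma> i = \<beta> i") (auto simp: prod_zero_iff)
  moreover have "\<gamma> \<in> extensional {1..k} \<and> (\<forall>i\<in>{1..k}. \<gamma> i = \<beta> i) \<longleftrightarrow> \<gamma> = \<beta>"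
    using assms extensionalityI[of \<gamma> "{1..k}" \<beta>] by blast
  ultimately show "Rep_ell2 (ptensor k (\<lambda>i. ebasis (\<beta> i))) \<gamma> = Rep_ell2 (ebasis \<beta>) \<gamma>"
    by (auto simp: Rep_ptensor Rep_ebasis)
qed

section \<open>Word tuples with prescribed letter content\<close>

definition multi_words :: "nat \<Rightarrow> (nat \<Rightarrow> nat multiset) \<Rightarrow> (nat \<Rightarrow> nat list) set" where
  "multi_words k a = PiE {1..k} (\<lambda>i. permutations_of_multiset (a i))"

lemma finite_multi_words: "finite (multi_words k a)"
  unfolding multi_words_def by (rule finite_PiE) auto

lemma card_multi_words: "card (multi_words k a) = multi_num k a"
  by (simp add: multi_words_def multi_num_def multinom_def card_PiE)

lemma multi_vec_eq: "multi_vec k a = (\<Sum>\<beta>\<in>multi_words k a. ebasis \<beta>)"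
proof (rule ell2_eqI)
  fix \<gamma>
  have "Rep_ell2 (\<Sum>\<beta>\<in>multi_words k a. ebasis \<beta>) \<gamma> = (if \<gamma> \<in> multi_words k a then 1 else 0)"
    by (simp add: Rep_sum_ell2 Rep_ebasis finite_multi_words)
  then show "Rep_ell2 (multi_vec k a) \<gamma> = Rep_ell2 (\<Sum>\<beta>\<in>multi_words k a. ebasis \<beta>) \<gamma>"
    by (auto simp: Rep_multi_vec multi_words_def PiE_iff permutations_of_multiset_def)
qed

text \<open>Sorting merely picks one of the word tuples with content \<open>a\<close>; by
  commutativity all of them give the same operator.\<close>

definition rep_word :: "nat \<Rightarrow> (nat \<Rightarrow> nat multiset) \<Rightarrow> nat \<Rightarrow> nat list" where
  "rep_word k a = restrict (\<lambda>i. sorted_list_of_multiset (a i)) {1..k}"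

lemma mset_rep_word: "i \<in> {1..k} \<Longrightarrow> mset (rep_word k a i) = a i"
  by (simp add: rep_word_def)

context comm_tuple
begin

lemma mdegsD:
  assumes "a \<in> mdegs k n q" "i \<in> {1..k}"
  shows "set_mset (a i) \<subseteq> {1..n i}" "size (a i) = q i"
proof -
  have "a i \<in> msets (n i) (q i)" using assms unfolding mdegs_def by (rule PiE_mem)
  then show "set_mset (a i) \<subseteq> {1..n i}" "size (a i) = q i" by (auto simp: msets_def)
qed

lemma multi_words_subset:
  assumes "a \<in> mdegs k n q" shows "multi_words k a \<subseteq> graded_words q"
  unfolding multi_words_def
proof (rule PiE_mono)
  fix i assume i: "i \<in> {1..k}"
  show "permutations_of_multiset (a i) \<subseteq> words (n i) (q i)"
  proof
    fix \<alpha> assume "\<alpha> \<in> permutations_of_multiset (a i)"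
    then have "mset \<alpha> = a i" by (rule permutations_of_multisetD)
    then have "set \<alpha> = set_mset (a i)" "length \<alpha> = size (a i)"
      using set_mset_mset[of \<alpha>] size_mset[of \<alpha>] by simp_all
    then show "\<alpha> \<in> words (n i) (q i)" using mdegsD[OF assms i] by (simp add: words_def)
  qed
qed

lemma tw_multi_words:
  assumes "a \<in> mdegs k n q" "\<beta> \<in> multi_words k a" shows "tw \<beta> = tw (rep_word k a)"
proof (rule tw_mset)
  show "\<beta> \<in> all_words" using assms multi_words_subset graded_words_subset by blast
  fix i assume i: "i \<in> {1..k}"
  then have "\<beta> i \<in> permutations_of_multiset (a i)" using assms(2) by (auto simp: multi_words_def)
  then show "mset (\<beta> i) = mset (rep_word k a i)" using i by (simp add: mset_rep_word permutations_of_multisetD)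
qed

text \<open>The tuples are grouped by letter content, and the class of \<open>a\<close> has
  \<open>multi_num k a\<close> members.\<close>

lemma sum_graded_words:
  fixes F :: "(nat \<Rightarrow> nat multiset) \<Rightarrow> real"
  assumes G: "\<And>a \<beta>. a \<in> mdegs k n q \<Longrightarrow> \<beta> \<in> multi_words k a \<Longrightarrow> G \<beta> = F a"
  shows "(\<Sum>\<beta>\<in>graded_words q. G \<beta>) = (\<Sum>a\<in>mdegs k n q. real (multi_num k a) * F a)"
proof -
  let ?m = "\<lambda>\<beta>. restrict (\<lambda>i. mset (\<beta> i)) {1..k}"
  have "?m \<beta> \<in> mdegs k n q" if "\<beta> \<in> graded_words q" for \<beta>
    using that by (auto simp: mdegs_def msets_eq_image)
  then have "(\<Sum>\<beta>\<in>graded_words q. G \<beta>) = (\<Sum>a\<in>mdegs k n q. \<Sum>\<beta> | \<beta> \<in> graded_words q \<and> ?m \<beta> = a. G \<beta>)"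
    by (intro sum.group[symmetric] finite_graded_words finite_mdegs) blast
  also have "\<dots> = (\<Sum>a\<in>mdegs k n q. \<Sum>\<beta>\<in>multi_words k a. F a)"
  proof (rule sum.cong[OF refl])
    fix a assume a: "a \<in> mdegs k n q"
    have eq: "{\<beta>. \<beta> \<in> graded_words q \<and> ?m \<beta> = a} = multi_words k a"
    proof (intro equalityI subsetI)
      fix \<beta> assume "\<beta> \<in> {\<beta>. \<beta> \<in> graded_words q \<and> ?m \<beta> = a}"
      then show "\<beta> \<in> multi_words k a"
        by (auto simp: multi_words_def PiE_iff permutations_of_multiset_def)
    next
      fix \<beta> assume \<beta>: "\<beta> \<in> multi_words k a"
      have "a \<in> extensional {1..k}" using a by (auto simp: mdegs_def PiE_def)
      then have "?m \<beta> = a"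
        using \<beta> by (auto simp: multi_words_def PiE_iff permutations_of_multiset_def extensional_def fun_eq_iff)
      then show "\<beta> \<in> {\<beta>. \<beta> \<in> graded_words q \<and> ?m \<beta> = a}" using \<beta> multi_words_subset[OF a] by blast
    qed
    show "(\<Sum>\<beta> | \<beta> \<in> graded_words q \<and> ?m \<beta> = a. G \<beta>) = (\<Sum>\<beta>\<in>multi_words k a. F a)"
      unfolding eq by (rule sum.cong[OF refl G[OF a]])
  qed
  finally show ?thesis by (simp add: card_multi_words)
qed

end

section \<open>The constrained kernel and the two traces for a defect operator of finite
  rank\<close>

locale finite_rank_tuple = comm_tuple k n T for k n and T :: "'h :: chilbert_space operator_tuple" +
  fixes E :: "'h set" and lam :: "'h \<Rightarrow> real"
  assumes finE: "finite E" and orthE: "orthonormal E" and lam_pos: "u \<in> E \<Longrightarrow> lam u > 0"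
    and defect_eigen: "u \<in> E \<Longrightarrow> defect_op k n T u = complex_of_real (lam u) *\<^sub>C u"
    and defect_expansion: "defect_op k n T h = (\<Sum>u\<in>E. (complex_of_real (lam u) * cinner h u) *\<^sub>C u)"
begin

abbreviation D where "D \<equiv> defect_space k n T"
abbreviation K where "K \<equiv> constrained_berezin_kernel k n T"
abbreviation S where "S \<equiv> sym_fock_tensor k n"

definition R :: "'h \<Rightarrow> 'h" where
  "R h = (\<Sum>u\<in>E. (cinner h u * complex_of_real (sqrt (lam u))) *\<^sub>C u)"

lemma sqrt_defect: "sqrt_op \<Delta> = R"
proof -
  have "sqrt_op \<Delta> = (\<lambda>h. \<Sum>u\<in>E. (complex_of_real (sqrt (lam u)) * cinner h u) *\<^sub>C u)"
    by (rule sqrt_op_spectral[OF finE orthE]) (fact lam_pos defect_eigen defect_expansion)+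
  then show ?thesis by (simp add: R_def[abs_def] mult.commute)
qed

lemma bounded_op_R: "bounded_op R"
  unfolding R_def[abs_def] by (rule bounded_op_on_finite_sum[OF csubspace_UNIV]) simp

lemma cinner_R: "u \<in> E \<Longrightarrow> cinner (R h) u = complex_of_real (sqrt (lam u)) * cinner h u"
  unfolding R_def by (simp add: cinner_orthonormal_sum[OF orthE finE] mult.commute)

lemma norm_R_sq: "(norm (R h))\<^sup>2 = Re (cinner (\<Delta> h) h)"
proof -
  have "cinner (R h) x = (\<Sum>u\<in>E. cinner h u * complex_of_real (sqrt (lam u)) * cinner u x)" for x
    by (simp add: R_def cinner_sum_left cinner_scaleC_left)
  from this[of "R h"]
  have "cinner (R h) (R h) = (\<Sum>u\<in>E. cinner h u * complex_of_real (sqrt (lam u)) * cnj (cinner (R h) u))"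
    by (simp only: cinner_commute[of _ "R h", symmetric])
  also have "\<dots> = (\<Sum>u\<in>E. complex_of_real (lam u) * cinner h u * cinner u h)"
  proof (rule sum.cong[OF refl])
    fix u assume u: "u \<in> E"
    have "complex_of_real (sqrt (lam u)) * complex_of_real (sqrt (lam u)) = complex_of_real (lam u)"
      using lam_pos[OF u] by (simp flip: of_real_mult)
    then show "cinner h u * complex_of_real (sqrt (lam u)) * cnj (cinner (R h) u)
        = complex_of_real (lam u) * cinner h u * cinner u h"
      by (simp add: cinner_R[OF u] cinner_commute[of u h] mult_ac)
  qed
  also have "\<dots> = cinner (\<Delta> h) h"
    by (simp add: defect_expansion cinner_sum_left cinner_scaleC_left)
  finally show ?thesis by (metis Re_complex_of_real cinner_self)
qed

lemma E_in_D: "u \<in> E \<Longrightarrow> u \<in> D"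
proof -
  assume u: "u \<in> E"
  have "\<Delta> ((1 / complex_of_real (lam u)) *\<^sub>C u) = (1 / complex_of_real (lam u)) *\<^sub>C \<Delta> u"
    using positive_op_defect by (simp add: positive_op_def bounded_opD(2))
  then have "\<Delta> ((1 / complex_of_real (lam u)) *\<^sub>C u) = u"
    using lam_pos[OF u] by (simp add: defect_eigen[OF u] scaleC_scaleC)
  then have "u \<in> range \<Delta>" by (metis rangeI)
  then show ?thesis unfolding defect_space_def using closure_subset by (rule subsetD[rotated])
qed

text \<open>The expansion holds on the range of the defect operator and is a closed condition. Thus
  \<open>E\<close> is an orthonormal basis of the defect space, which is finite-dimensional.\<close>

lemma D_expansion: "x \<in> D \<Longrightarrow> x = (\<Sum>u\<in>E. cinner x u *\<^sub>C u)"
proof -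
  let ?X = "{x. x = (\<Sum>u\<in>E. cinner x u *\<^sub>C u)}"
  have "bounded_op (\<lambda>x. \<Sum>u\<in>E. (cinner x u * 1) *\<^sub>C u)"
    by (rule bounded_op_on_finite_sum[OF csubspace_UNIV]) simp
  then have "continuous_on UNIV (\<lambda>x. \<Sum>u\<in>E. cinner x u *\<^sub>C u)"
    by (intro linear_continuous_on bounded_op_imp_bounded_linear) simp
  then have "closed ?X" by (intro closed_Collect_eq continuous_on_id)
  moreover have "\<Delta> h \<in> ?X" for h
    by (simp add: defect_expansion[of h] cinner_orthonormal_sum[OF orthE finE] cong: sum.cong)
  ultimately have "D \<subseteq> ?X" unfolding defect_space_def by (intro closure_minimal) auto
  then show "x \<in> D \<Longrightarrow> x = (\<Sum>u\<in>E. cinner x u *\<^sub>C u)" by blast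
qed

lemma csubspace_D: "csubspace D"
proof -
  have b: "bounded_op \<Delta>" using positive_op_defect by (simp add: positive_op_def)
  have "csubspace (range \<Delta>)"
  proof (rule csubspaceI)
    show "0 \<in> range \<Delta>" by (rule range_eqI[of _ _ 0]) (simp add: bounded_opD(3)[OF b])
  qed (auto simp: bounded_opD(1)[OF b, symmetric] bounded_opD(2)[OF b, symmetric])
  then show ?thesis unfolding defect_space_def by (rule csubspace_closure)
qed

lemma R_in_D: "R h \<in> D"
  unfolding R_def
  by (intro complex_vector.subspace_sum[OF csubspace_D] complex_vector.subspace_scale[OF csubspace_D] E_in_D)

text \<open>The unconstrained Berezin kernel, given by coordinates rather than as an infinite sum;
  \<open>bessel_words\<close> makes them square-summable.\<close>

definition kernel_vec :: "'h \<Rightarrow> (nat \<Rightarrow> nat list, 'h) ell2" where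
  "kernel_vec h = Abs_ell2 (\<lambda>\<beta>. if \<beta> \<in> all_words then R (adj (tw \<beta>) h) else 0)"

lemma kernel_vec_bound:
  assumes "finite I"
  shows "(\<Sum>\<beta>\<in>I. (norm (if \<beta> \<in> all_words then R (adj (tw \<beta>) h) else 0))\<^sup>2) \<le> (norm h)\<^sup>2"
proof -
  have "(\<Sum>\<beta>\<in>I. (norm (if \<beta> \<in> all_words then R (adj (tw \<beta>) h) else 0))\<^sup>2)
      = (\<Sum>\<beta>\<in>I \<inter> all_words. (norm (R (adj (tw \<beta>) h)))\<^sup>2)"
    by (rule sum.mono_neutral_cong_right) (use assms in auto)
  also have "\<dots> \<le> (norm h)\<^sup>2"
    unfolding norm_R_sq by (rule bessel_words) (use assms in auto)
  finally show ?thesis .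
qed

lemma Rep_kernel_vec: "Rep_ell2 (kernel_vec h) \<beta> = (if \<beta> \<in> all_words then R (adj (tw \<beta>) h) else 0)"
proof -
  let ?g = "\<lambda>\<beta>. if \<beta> \<in> all_words then R (adj (tw \<beta>) h) else 0"
  have "(\<lambda>\<beta>. (norm (?g \<beta>))\<^sup>2) summable_on UNIV"
    by (rule nonneg_bdd_above_summable_on)
      (use kernel_vec_bound in \<open>auto simp only: bdd_above_def zero_le_power2\<close>)
  then show ?thesis unfolding kernel_vec_def by (subst Abs_ell2_inverse) auto
qed

lemma norm_kernel_vec: "norm (kernel_vec h) \<le> norm h"
proof -
  have "(norm (kernel_vec h))\<^sup>2 \<le> (norm h)\<^sup>2"
    unfolding norm_ell2_sq
    by (rule infsum_le_finite_sums[OF ell2_summable]) (use kernel_vec_bound in \<open>simp add: Rep_kernel_vec\<close>)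
  then show ?thesis by (rule power2_le_imp_le) simp
qed

lemma bounded_op_kernel_vec: "bounded_op kernel_vec"
proof -
  have adj_lin: "adj (tw \<beta>) (x + y) = adj (tw \<beta>) x + adj (tw \<beta>) y"
    "adj (tw \<beta>) (c *\<^sub>C x) = c *\<^sub>C adj (tw \<beta>) x" if "\<beta> \<in> all_words" for \<beta> x y c
    using bounded_opD[OF bounded_op_adj[OF tw_bounded[OF that]]] by auto
  have "kernel_vec (x + y) = kernel_vec x + kernel_vec y" for x y
    by (rule ell2_eqI) (simp add: Rep_kernel_vec Rep_plus_ell2 adj_lin bounded_opD[OF bounded_op_R])
  moreover have "kernel_vec (c *\<^sub>C x) = c *\<^sub>C kernel_vec x" for c x
    by (rule ell2_eqI) (simp add: Rep_kernel_vec Rep_scaleC_ell2 adj_lin bounded_opD[OF bounded_op_R])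
  ultimately show ?thesis
    unfolding bounded_op_on_def using norm_kernel_vec by (auto intro: exI[of _ 1])
qed

lemma ebasis_in_fock_tensor:
  assumes "\<beta> \<in> all_words" shows "ebasis \<beta> \<in> fock_tensor k n"
proof -
  have "ptensor k (\<lambda>i. ebasis (\<beta> i)) \<in> fock_tensor k n"
    unfolding fock_tensor_def fock_def
    by (intro ptensor_in_ptensor_space closure_cspan_base imageI) (use assms in \<open>auto simp: PiE_iff\<close>)
  moreover have "\<beta> \<in> extensional {1..k}" using assms by (auto simp: PiE_def)
  ultimately show ?thesis by (simp add: ptensor_ebasis)
qed

lemma has_sum_kernel_vec:
  "((\<lambda>\<beta>. etensor (ebasis \<beta>) (R (adj (tw \<beta>) h))) has_sum kernel_vec h) all_words"
proof -
  have "((\<lambda>\<beta>. etensor (ebasis \<beta>) (Rep_ell2 (kernel_vec h) \<beta>)) has_sum kernel_vec h) UNIV"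
    by (rule has_sum_ell2)
  also have "?this \<longleftrightarrow> ((\<lambda>\<beta>. etensor (ebasis \<beta>) (R (adj (tw \<beta>) h))) has_sum kernel_vec h) all_words"
    by (rule has_sum_cong_neutral)
      (auto simp: Rep_kernel_vec intro!: ell2_eqI simp: Rep_etensor Rep_zero_ell2)
  finally show ?thesis .
qed

lemma berezin_kernel_eq: "berezin_kernel k n T h = kernel_vec h"
proof -
  have "berezin_kernel k n T h = (\<Sum>\<^sub>\<infinity>\<beta>\<in>all_words. etensor (ebasis \<beta>) (R (adj (tw \<beta>) h)))"
    unfolding berezin_kernel_def sqrt_defect
  proof (rule infsum_cong)
    fix \<beta> assume \<beta>: "\<beta> \<in> all_words"
    then have "\<beta> \<in> extensional {1..k}" by (auto simp: PiE_def)
    then show "etensor (ptensor k (\<lambda>i. ebasis (\<beta> i))) (R (comp_upto k (\<lambda>i. adj (word_op (T i) (\<beta> i))) h))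
        = etensor (ebasis \<beta>) (R (adj (tw \<beta>) h))"
      by (simp add: ptensor_ebasis comp_adj_words[OF \<beta>])
  qed
  also have "\<dots> = kernel_vec h" by (rule infsumI[OF has_sum_kernel_vec])
  finally show ?thesis .
qed

lemma kernel_vec_in: "kernel_vec h \<in> tensor_space (fock_tensor k n) D"
proof (rule Lim_in_closed_set[OF csubspace_tensor_space(2)])
  show "(sum (\<lambda>\<beta>. etensor (ebasis \<beta>) (R (adj (tw \<beta>) h))) \<longlongrightarrow> kernel_vec h) (finite_subsets_at_top all_words)"
    using has_sum_kernel_vec unfolding has_sum_def .
  have "(\<Sum>\<beta>\<in>Y. etensor (ebasis \<beta>) (R (adj (tw \<beta>) h))) \<in> tensor_space (fock_tensor k n) D"
    if "Y \<subseteq> all_words" for Y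
    using that by (intro complex_vector.subspace_sum[OF csubspace_tensor_space(1)] etensor_in_tensor_space
        ebasis_in_fock_tensor R_in_D) auto
  then show "\<forall>\<^sub>F Y in finite_subsets_at_top all_words.
      (\<Sum>\<beta>\<in>Y. etensor (ebasis \<beta>) (R (adj (tw \<beta>) h))) \<in> tensor_space (fock_tensor k n) D"
    by (intro eventually_finite_subsets_at_top_weakI) blast
qed (rule finite_subsets_at_top_neq_bot)

lemma S_subset: "S \<subseteq> fock_tensor k n"
proof -
  have "sym_fock m \<subseteq> fock m" for m
    unfolding sym_fock_def
  proof (rule closure_cspan_minimal)
    show "{f. \<exists>p. symmetric_tensor m p f} \<subseteq> fock m" unfolding symmetric_tensor_def by blast
  qed (simp_all add: fock_def csubspace_closure_cspan)
  then show ?thesis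
    unfolding sym_fock_tensor_def fock_tensor_def ptensor_space_def
    by (intro closure_mono complex_vector.span_mono) blast
qed

text \<open>The ampliated projection is again an orthogonal projection, by
  \<open>proj_etensor\<close>. It maps the larger tensor space into itself because \<open>S\<close>
  is contained in the full Fock tensor product.\<close>

lemma K_eq: "K h = proj (tensor_space S D) (kernel_vec h)"
  unfolding constrained_berezin_kernel_def berezin_kernel_eq
proof (rule ampliation_eq[OF _ _ kernel_vec_in])
  have "tensor_space S D \<subseteq> tensor_space (fock_tensor k n) D"
    unfolding tensor_space_def using S_subset by (intro closure_mono complex_vector.span_mono) blast
  moreover have "bounded_op_on (tensor_space (fock_tensor k n) D) (tensor_space S D) (proj (tensor_space S D))"
    by (rule bounded_op_on_proj[OF csubspace_tensor_space])
  ultimately show "bounded_op_on (tensor_space (fock_tensor k n) D) (tensor_space (fock_tensor k n) D) (proj (tensor_space S D))"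
    unfolding bounded_op_on_def by blast
qed (rule proj_etensor[OF csubspace_sym_fock_tensor])

lemma bounded_op_K: "bounded_op K"
proof -
  have "bounded_op_on UNIV (tensor_space S D) K"
    unfolding K_eq[abs_def]
    by (rule bounded_op_on_proj_comp[OF csubspace_tensor_space bounded_op_kernel_vec])
  then show ?thesis unfolding bounded_op_on_def by blast
qed

lemma K_in: "K h \<in> tensor_space S D"
  unfolding K_eq by (rule proj_in[OF csubspace_tensor_space])

definition basis_vec :: "(nat \<Rightarrow> nat multiset) \<Rightarrow> 'h \<Rightarrow> (nat \<Rightarrow> nat list, 'h) ell2" where
  "basis_vec a u = etensor (multi_vec k a) u"

text \<open>The image of \<open>basis_vec a u\<close> under the adjoint of \<open>K\<close>. The
  factor \<open>multi_num k a\<close> counts the word tuples with content \<open>a\<close>, all of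
  which contribute the same vector.\<close>

definition kap :: "(nat \<Rightarrow> nat multiset) \<Rightarrow> 'h \<Rightarrow> 'h" where
  "kap a u = complex_of_real (real (multi_num k a) * sqrt (lam u)) *\<^sub>C tw (rep_word k a) u"

lemma basis_vec_in: "a \<in> mdegs k n q \<Longrightarrow> u \<in> E \<Longrightarrow> basis_vec a u \<in> tensor_space S D"
  unfolding basis_vec_def by (intro etensor_in_tensor_space multi_vec_in E_in_D)

lemma cinner_K_basis_vec:
  assumes a: "a \<in> mdegs k n q" and u: "u \<in> E"
  shows "cinner (K h) (basis_vec a u) = cinner h (kap a u)"
proof -
  have "cinner (K h) (basis_vec a u) = cinner (kernel_vec h) (basis_vec a u)"
    unfolding K_eq by (rule cinner_proj[OF csubspace_tensor_space basis_vec_in[OF a u]])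
  also have "\<dots> = (\<Sum>\<beta>\<in>multi_words k a. cinner (Rep_ell2 (kernel_vec h) \<beta>) u)"
    by (simp add: basis_vec_def multi_vec_eq etensor_sum_left cinner_sum_right cinner_etensor_ebasis)
  also have "\<dots> = (\<Sum>\<beta>\<in>multi_words k a. complex_of_real (sqrt (lam u)) * cinner h (tw (rep_word k a) u))"
  proof (rule sum.cong[OF refl])
    fix \<beta> assume \<beta>: "\<beta> \<in> multi_words k a"
    then have w: "\<beta> \<in> all_words" using multi_words_subset[OF a] graded_words_subset by blast
    then show "cinner (Rep_ell2 (kernel_vec h) \<beta>) u = complex_of_real (sqrt (lam u)) * cinner h (tw (rep_word k a) u)"
      using tw_bounded[OF w]
      by (simp add: Rep_kernel_vec cinner_R[OF u] cinner_adj' tw_multi_words[OF a \<beta>])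
  qed
  also have "\<dots> = cinner h (kap a u)"
    by (simp add: kap_def card_multi_words cinner_scaleC_right)
  finally show ?thesis .
qed

lemma adj_K_basis_vec: "a \<in> mdegs k n q \<Longrightarrow> u \<in> E \<Longrightarrow> adj K (basis_vec a u) = kap a u"
  by (rule adj_on_unique[OF csubspace_UNIV]) (auto intro: cinner_K_basis_vec)

text \<open>The common value of the two traces being compared: \<open>trace_kernel\<close> reaches
  it through the kernel, \<open>trace_iterated_defect\<close> through the iterated maps.\<close>

definition defect_trace :: "(nat \<Rightarrow> nat) \<Rightarrow> real" where
  "defect_trace q = (\<Sum>a\<in>mdegs k n q. \<Sum>u\<in>E. real (multi_num k a) * (lam u * (norm (tw (rep_word k a) u))\<^sup>2))"

lemma norm_kap_sq:
  "u \<in> E \<Longrightarrow> (norm (kap a u))\<^sup>2 / real (multi_num k a) = real (multi_num k a) * (lam u * (norm (tw (rep_word k a) u))\<^sup>2)"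
  using multi_num_pos[of k a] lam_pos[of u]
  by (simp add: kap_def norm_scaleC norm_mult power_mult_distrib power2_eq_square field_simps)

lemma trace_kernel:
  "trace_on UNIV (\<lambda>h. adj K (ampliation S D (multidegree_proj k n q) (K h))) = complex_of_real (defect_trace q)"
proof -
  let ?I = "mdegs k n q \<times> E"
  let ?N = "\<lambda>a. inverse (of_nat (multi_num k a)) :: complex"
  have "adj K (ampliation S D (multidegree_proj k n q) (K h))
      = (\<Sum>p\<in>?I. cinner h (kap (fst p) (snd p)) *\<^sub>C (?N (fst p) *\<^sub>C kap (fst p) (snd p)))" for h
  proof -
    have "ampliation S D (multidegree_proj k n q) (K h)
        = (\<Sum>p\<in>?I. (cinner (K h) (basis_vec (fst p) (snd p)) * ?N (fst p)) *\<^sub>C basis_vec (fst p) (snd p))"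
      using ampliation_multidegree_proj[where L = E and e = id, OF finE _ _ K_in] E_in_D D_expansion
      by (simp add: basis_vec_def case_prod_beta)
    then have "adj K (ampliation S D (multidegree_proj k n q) (K h))
        = (\<Sum>p\<in>?I. (cinner (K h) (basis_vec (fst p) (snd p)) * ?N (fst p)) *\<^sub>C adj K (basis_vec (fst p) (snd p)))"
      by (simp add: bounded_opD[OF bounded_op_adj[OF bounded_op_K]])
    also have "\<dots> = (\<Sum>p\<in>?I. cinner h (kap (fst p) (snd p)) *\<^sub>C (?N (fst p) *\<^sub>C kap (fst p) (snd p)))"
      by (rule sum.cong) (auto simp: cinner_K_basis_vec adj_K_basis_vec scaleC_scaleC)
    finally show ?thesis .
  qed
  then have "trace_on UNIV (\<lambda>h. adj K (ampliation S D (multidegree_proj k n q) (K h)))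
      = (\<Sum>p\<in>?I. cinner (?N (fst p) *\<^sub>C kap (fst p) (snd p)) (kap (fst p) (snd p)))"
    by (intro trace_on_finite_sum[OF csubspace_UNIV closed_UNIV]) (auto simp: finite_mdegs finE)
  also have "\<dots> = (\<Sum>p\<in>?I. complex_of_real ((norm (kap (fst p) (snd p)))\<^sup>2 / real (multi_num k (fst p))))"
    by (rule sum.cong) (auto simp: cinner_scaleC_left cinner_self field_simps)
  also have "\<dots> = (\<Sum>p\<in>?I. complex_of_real (real (multi_num k (fst p)) * (lam (snd p) * (norm (tw (rep_word k (fst p)) (snd p)))\<^sup>2)))"
  proof (rule sum.cong[OF refl])
    fix p assume "p \<in> ?I"
    then have "snd p \<in> E" by auto
    then show "complex_of_real ((norm (kap (fst p) (snd p)))\<^sup>2 / real (multi_num k (fst p)))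
        = complex_of_real (real (multi_num k (fst p)) * (lam (snd p) * (norm (tw (rep_word k (fst p)) (snd p)))\<^sup>2))"
      by (simp only: norm_kap_sq)
  qed
  also have "\<dots> = complex_of_real (defect_trace q)"
    by (simp add: defect_trace_def sum.cartesian_product case_prod_beta)
  finally show ?thesis .
qed

lemma defect_conjugate:
  assumes "\<beta> \<in> all_words"
  shows "tw \<beta> (\<Delta> (adj (tw \<beta>) h)) = (\<Sum>u\<in>E. cinner h (tw \<beta> u) *\<^sub>C (complex_of_real (lam u) *\<^sub>C tw \<beta> u))"
  by (simp add: defect_expansion[of "adj (tw \<beta>) h"] bounded_opD[OF tw_bounded[OF assms]]
      cinner_adj'[OF tw_bounded[OF assms]] scaleC_scaleC mult.commute)

lemma sum_graded_trace:
  "(\<Sum>\<beta>\<in>graded_words q. \<Sum>u\<in>E. lam u * (norm (tw \<beta> u))\<^sup>2) = defect_trace q"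
proof -
  have "(\<Sum>\<beta>\<in>graded_words q. \<Sum>u\<in>E. lam u * (norm (tw \<beta> u))\<^sup>2)
      = (\<Sum>a\<in>mdegs k n q. real (multi_num k a) * (\<Sum>u\<in>E. lam u * (norm (tw (rep_word k a) u))\<^sup>2))"
    by (rule sum_graded_words) (simp add: tw_multi_words)
  then show ?thesis by (simp add: defect_trace_def sum_distrib_left)
qed

text \<open>Stated for a finite sum, which bypasses additivity of \<open>trace_on\<close>: a
  singleton \<open>P\<close> gives one multidegree, a box gives the last asymptotic formula.\<close>

lemma trace_sum_iterated_defect:
  assumes "finite P"
  shows "trace_on UNIV (\<lambda>h. \<Sum>s\<in>P. iterated_defect k n T s h) = complex_of_real (\<Sum>s\<in>P. defect_trace s)"
proof -
  let ?I = "Sigma P (\<lambda>s. graded_words s \<times> E)"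
  let ?v = "\<lambda>p. tw (fst (snd p)) (snd (snd p))"
  let ?l = "\<lambda>p. complex_of_real (lam (snd (snd p)))"
  have unfold: "(\<Sum>s\<in>P. \<Sum>\<beta>\<in>graded_words s. \<Sum>u\<in>E. f \<beta> u) = (\<Sum>p\<in>?I. f (fst (snd p)) (snd (snd p)))"
    for f :: "(nat \<Rightarrow> nat list) \<Rightarrow> 'h \<Rightarrow> 'x :: comm_monoid_add"
    unfolding sum.cartesian_product using assms finE
    by (subst sum.Sigma) (auto simp: case_prod_beta intro!: finite_cartesian_product finite_PiE finite_words)
  have "(\<Sum>s\<in>P. iterated_defect k n T s h) = (\<Sum>p\<in>?I. cinner h (?v p) *\<^sub>C (?l p *\<^sub>C ?v p))" for h
    unfolding unfold[symmetric, of "\<lambda>\<beta> u. cinner h (tw \<beta> u) *\<^sub>C (complex_of_real (lam u) *\<^sub>C tw \<beta> u)"]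
      iterated_defect_words
  proof (intro sum.cong refl)
    fix s \<beta> assume "\<beta> \<in> graded_words s"
    then show "tw \<beta> (\<Delta> (adj (tw \<beta>) h)) = (\<Sum>u\<in>E. cinner h (tw \<beta> u) *\<^sub>C (complex_of_real (lam u) *\<^sub>C tw \<beta> u))"
      using graded_words_subset by (intro defect_conjugate) blast
  qed
  then have "trace_on UNIV (\<lambda>h. \<Sum>s\<in>P. iterated_defect k n T s h) = (\<Sum>p\<in>?I. cinner (?l p *\<^sub>C ?v p) (?v p))"
    using assms finE by (intro trace_on_finite_sum[OF csubspace_UNIV closed_UNIV])
      (auto intro!: finite_SigmaI finite_cartesian_product finite_PiE finite_words)
  also have "\<dots> = (\<Sum>s\<in>P. \<Sum>\<beta>\<in>graded_words s. \<Sum>u\<in>E. cinner (complex_of_real (lam u) *\<^sub>C tw \<beta> u) (tw \<beta> u))"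
    by (rule unfold[symmetric])
  also have "\<dots> = complex_of_real (\<Sum>s\<in>P. \<Sum>\<beta>\<in>graded_words s. \<Sum>u\<in>E. lam u * (norm (tw \<beta> u))\<^sup>2)"
    by (simp add: cinner_scaleC_left cinner_self)
  finally show ?thesis by (simp only: sum_graded_trace)
qed

lemma trace_iterated_defect: "trace_on UNIV (iterated_defect k n T q) = complex_of_real (defect_trace q)"
  using trace_sum_iterated_defect[of "{q}"] by simp

end

section \<open>Monotonicity from the characteristic function\<close>

lemma sum_count_msets:
  assumes "A \<in> msets n q" shows "(\<Sum>j=1..n. count A j) = q"
proof -
  have "(\<Sum>j=1..n. count A j) = (\<Sum>j\<in>set_mset A. count A j)"
    by (rule sum.mono_neutral_right) (use assms in \<open>auto simp: msets_def not_in_iff\<close>)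
  then show ?thesis using assms by (simp add: msets_def size_multiset_overloaded_eq)
qed

lemma multi_num_add:
  assumes "i \<in> {1..k}"
  shows "multi_num k (b(i := b i + {#j#})) * (count (b i) j + 1) = (size (b i) + 1) * multi_num k b"
proof -
  have split: "multi_num k (b(i := A)) = multinom A * (\<Prod>l\<in>{1..k} - {i}. multinom (b l))" for A
    unfolding multi_num_def using assms by (subst prod.remove[of _ i]) (auto intro!: prod.cong)
  let ?P = "\<Prod>l\<in>{1..k} - {i}. multinom (b l)"
  have aux: "multinom (b i + {#j#}) * (count (b i) j + 1) = (size (b i) + 1) * multinom (b i)"
    unfolding multinom_def by (rule card_permutations_of_multiset_insert_aux)
  have "multi_num k (b(i := b i + {#j#})) * (count (b i) j + 1)
      = multinom (b i + {#j#}) * (count (b i) j + 1) * ?P"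
    unfolding split by (simp only: mult_ac)
  also have "\<dots> = (size (b i) + 1) * multi_num k b"
    unfolding aux using split[of "b i"] by (simp only: fun_upd_triv mult.assoc)
  finally show ?thesis .
qed

lemma mdegs_mem: "a \<in> mdegs k n q \<Longrightarrow> i \<in> {1..k} \<Longrightarrow> a i \<in> msets (n i) (q i)"
  unfolding mdegs_def by (rule PiE_mem)

text \<open>
  The growth factor arises because \<open>N\<^bsub>b+j\<^esub> (b\<^sub>i(j) + 1) = N\<^sub>b (q\<^sub>i + 1)\<close> and the numbers \<open>b\<^sub>i(j) + 1\<close> sum up
  to \<open>q\<^sub>i + n\<^sub>i\<close>.
\<close>

lemma sum_mdegs_remove:
  fixes Y :: "(nat \<Rightarrow> nat multiset) \<Rightarrow> real"
  assumes i: "i \<in> {1..k}"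
  shows "(\<Sum>a\<in>mdegs k n (q(i := Suc (q i))). \<Sum>j\<in>set_mset (a i). Y (a(i := a i - {#j#})) / real (multi_num k a))
    = real (q i + n i) / real (q i + 1) * (\<Sum>b\<in>mdegs k n q. Y b / real (multi_num k b))"
proof -
  let ?q = "q(i := Suc (q i))"
  have fin: "\<forall>a\<in>mdegs k n ?q. finite (set_mset (a i))" by simp
  have up: "b(i := b i + {#j#}) \<in> mdegs k n ?q" if "b \<in> mdegs k n q" "j \<in> {1..n i}" for b j
    using that i by (auto simp: mdegs_def PiE_iff msets_def extensional_def)
  have down: "a(i := a i - {#j#}) \<in> mdegs k n q" "j \<in> {1..n i}" if "a \<in> mdegs k n ?q" "j \<in># a i" for a j
  proof -
    have ai: "set_mset (a i) \<subseteq> {1..n i}" "size (a i) = Suc (q i)"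
      using mdegs_mem[OF that(1) i] by (simp_all add: msets_def)
    then show "j \<in> {1..n i}" using that(2) by blast
    have "set_mset (a i - {#j#}) \<subseteq> {1..n i}" using ai(1) by (meson in_diffD subset_iff)
    moreover have "size (a i - {#j#}) = q i" using ai(2) that(2) by (simp add: size_Diff_singleton)
    ultimately show "a(i := a i - {#j#}) \<in> mdegs k n q"
      using that(1) i by (auto simp: mdegs_def PiE_iff msets_def extensional_def split: if_splits)
  qed
  have "(\<Sum>a\<in>mdegs k n ?q. \<Sum>j\<in>set_mset (a i). Y (a(i := a i - {#j#})) / real (multi_num k a))
      = (\<Sum>(a, j)\<in>Sigma (mdegs k n ?q) (\<lambda>a. set_mset (a i)). Y (a(i := a i - {#j#})) / real (multi_num k a))"
    by (rule sum.Sigma[OF finite_mdegs fin])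
  \<comment> \<open>Removing the letter from slot \<open>i\<close> and adding it back are inverse to
    each other; this matches the pairs (a, j) with \<open>j\<close> in \<open>a i\<close> with the
    pairs (b, j) for arbitrary \<open>j\<close> in \<open>{1..n i}\<close>.\<close>
  also have "\<dots> = (\<Sum>(b, j)\<in>mdegs k n q \<times> {1..n i}. Y b / real (multi_num k (b(i := b i + {#j#}))))"
    by (rule sum.reindex_bij_witness[where i = "\<lambda>(b, j). (b(i := b i + {#j#}), j)" and j = "\<lambda>(a, j). (a(i := a i - {#j#}), j)"])
      (use up down in \<open>auto simp del: atLeastAtMost_iff\<close>)
  also have "\<dots> = (\<Sum>b\<in>mdegs k n q. \<Sum>j=1..n i. Y b / real (multi_num k (b(i := b i + {#j#}))))"
    by (simp only: sum.cartesian_product)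
  also have "\<dots> = (\<Sum>b\<in>mdegs k n q. real (q i + n i) / real (q i + 1) * (Y b / real (multi_num k b)))"
  proof (rule sum.cong[OF refl])
    fix b assume "b \<in> mdegs k n q"
    then have bi: "b i \<in> msets (n i) (q i)" using i unfolding mdegs_def by (rule PiE_mem)
    have inv: "1 / real (multi_num k (b(i := b i + {#j#})))
        = (real (count (b i) j) + 1) / (real (q i + 1) * real (multi_num k b))" for j
    proof -
      have "multi_num k (b(i := b i + {#j#})) * (count (b i) j + 1) = (q i + 1) * multi_num k b"
        using multi_num_add[OF i, of b j] bi by (simp add: msets_def)
      then have "real (multi_num k (b(i := b i + {#j#}))) * (real (count (b i) j) + 1)
          = real (q i + 1) * real (multi_num k b)"
        by (metis of_nat_mult of_nat_add of_nat_1)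
      moreover have "real (count (b i) j) + 1 \<noteq> 0" using of_nat_0_le_iff[of "count (b i) j"] by linarith
      ultimately show ?thesis using nonzero_divide_mult_cancel_right by metis
    qed
    have "(\<Sum>j=1..n i. Y b / real (multi_num k (b(i := b i + {#j#}))))
        = Y b * (\<Sum>j=1..n i. (real (count (b i) j) + 1) / (real (q i + 1) * real (multi_num k b)))"
      unfolding sum_distrib_left by (rule sum.cong) (use inv in \<open>simp_all add: divide_inverse\<close>)
    also have "(\<Sum>j=1..n i. (real (count (b i) j) + 1) / (real (q i + 1) * real (multi_num k b)))
        = (real (\<Sum>j=1..n i. count (b i) j) + real (n i)) / (real (q i + 1) * real (multi_num k b))"
      by (simp add: sum_divide_distrib[symmetric] sum.distrib)
    also have "(\<Sum>j=1..n i. count (b i) j) = q i" by (rule sum_count_msets[OF bi])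
    finally have eq: "(\<Sum>j=1..n i. Y b / real (multi_num k (b(i := b i + {#j#}))))
        = Y b * ((real (q i) + real (n i)) / (real (q i + 1) * real (multi_num k b)))" .
    show "(\<Sum>j=1..n i. Y b / real (multi_num k (b(i := b i + {#j#}))))
        = real (q i + n i) / real (q i + 1) * (Y b / real (multi_num k b))"
      unfolding eq by simp
  qed
  finally show ?thesis by (simp only: sum_distrib_left)
qed

text \<open>Take \<open>multi_num k\<close> for \<open>Y\<close> in \<open>sum_mdegs_remove\<close>.
  The inner sums are then 1, since the words with content \<open>a i\<close> that start with
  \<open>j\<close> form the fraction \<open>count (a i) j\<close> over the size. So the dimension
  grows by the same factor as the weighted sums.\<close>

lemma card_mdegs_Suc:
  assumes i: "i \<in> {1..k}"
  shows "real (card (mdegs k n (q(i := Suc (q i))))) = real (q i + n i) / real (q i + 1) * real (card (mdegs k n q))"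
proof -
  let ?q = "q(i := Suc (q i))"
  have "(\<Sum>j\<in>set_mset (a i). real (multi_num k (a(i := a i - {#j#}))) / real (multi_num k a)) = 1"
    if a: "a \<in> mdegs k n ?q" for a
  proof -
    have ai: "size (a i) = Suc (q i)"
      using mdegs_mem[OF a i] by (simp add: msets_def)
    have "real (multi_num k (a(i := a i - {#j#}))) / real (multi_num k a) = real (count (a i) j) / real (Suc (q i))"
      if j: "j \<in># a i" for j
    proof -
      let ?b = "a(i := a i - {#j#})"
      have "multi_num k (?b(i := ?b i + {#j#})) * (count (?b i) j + 1) = (size (?b i) + 1) * multi_num k ?b"
        by (rule multi_num_add[OF i])
      moreover have "?b(i := ?b i + {#j#}) = a" "count (?b i) j + 1 = count (a i) j" "size (?b i) + 1 = Suc (q i)"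
        using j ai by (auto simp: size_Diff_singleton)
      ultimately have "multi_num k a * count (a i) j = Suc (q i) * multi_num k ?b" by (simp only:)
      then have "real (multi_num k a) * real (count (a i) j) = real (Suc (q i)) * real (multi_num k ?b)"
        by (metis of_nat_mult)
      then show ?thesis using multi_num_pos[of k a] by (simp add: field_simps)
    qed
    then have eq: "(\<Sum>j\<in>set_mset (a i). real (multi_num k (a(i := a i - {#j#}))) / real (multi_num k a))
        = real (\<Sum>j\<in>set_mset (a i). count (a i) j) / real (Suc (q i))"
      by (simp add: sum_divide_distrib)
    have "(\<Sum>j\<in>set_mset (a i). count (a i) j) = Suc (q i)" using ai by (simp add: size_multiset_overloaded_eq)
    then show ?thesis unfolding eq by (simp only:) simp
  qed
  then have "real (card (mdegs k n ?q))
      = (\<Sum>a\<in>mdegs k n ?q. \<Sum>j\<in>set_mset (a i). real (multi_num k (a(i := a i - {#j#}))) / real (multi_num k a))"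
    by simp
  also have "\<dots> = real (q i + n i) / real (q i + 1) * (\<Sum>b\<in>mdegs k n q. real (multi_num k b) / real (multi_num k b))"
    by (rule sum_mdegs_remove[OF i])
  also have "(\<Sum>b\<in>mdegs k n q. real (multi_num k b) / real (multi_num k b)) = (\<Sum>b\<in>mdegs k n q. 1)"
  proof (rule sum.cong[OF refl])
    fix b show "real (multi_num k b) / real (multi_num k b) = 1" using multi_num_pos[of k b] by simp
  qed
  finally show ?thesis by (simp only: sum_constant mult_1_right)
qed

lemma card_msets_Suc: "real (card (msets n (Suc q))) = real (q + n) / real (q + 1) * real (card (msets n q))"
  using card_mdegs_Suc[of 1 1 "\<lambda>_. n" "\<lambda>_. q"] by (simp add: card_mdegs)

text \<open>Stars and bars, by induction on the degree through the growth factor.\<close>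

lemma card_msets:
  assumes "n \<ge> 1" shows "card (msets n q) = (q + n - 1) choose (n - 1)"
proof -
  obtain m where n: "n = Suc m" using assms by (cases n) auto
  have "real (card (msets n q)) = real ((q + m) choose m)"
  proof (induction q)
    case 0
    have "msets n 0 = {{#}}" by (auto simp: msets_def)
    then show ?case by simp
  next
    case (Suc q)
    have "(q + m + 1) * ((q + m) choose q) = ((q + m + 1) choose (q + 1)) * (q + 1)"
      using Suc_times_binomial_eq[of "q + m" q] by simp
    moreover have "(q + m) choose q = (q + m) choose m" "(q + m + 1) choose (q + 1) = (Suc q + m) choose m"
      using binomial_symmetric[of q "q + m"] binomial_symmetric[of "Suc q" "Suc q + m"] by simp_all
    ultimately have "real (q + m + 1) * real ((q + m) choose m) = real ((Suc q + m) choose m) * real (q + 1)"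
      by (metis of_nat_mult)
    moreover have "real (card (msets n (Suc q))) = real (q + m + 1) * real ((q + m) choose m) / real (q + 1)"
      using Suc card_msets_Suc[of n q] by (simp add: n)
    ultimately show ?case by simp
  qed
  then show ?thesis by (simp add: n)
qed

context finite_rank_tuple
begin

lemma mdegs_extensional: "a \<in> mdegs k n q \<Longrightarrow> a \<in> extensional {1..k}"
  by (simp add: mdegs_def PiE_def)

lemma norm_basis_vec:
  assumes "a \<in> mdegs k n q" "u \<in> E"
  shows "cinner (basis_vec a u) (basis_vec a u) = of_nat (multi_num k a)"
  using orthonormalD[OF orthE assms(2) assms(2)] mdegs_extensional[OF assms(1)]
  by (simp add: basis_vec_def cinner_etensor cinner_multi_vec)

lemma defect_trace_nonneg: "defect_trace q \<ge> 0"
  unfolding defect_trace_def by (intro sum_nonneg mult_nonneg_nonneg) (auto intro: less_imp_le lam_pos)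

text \<open>The quotient in question is \<open>card E\<close> minus \<open>g q\<close> over the
  dimension. It decreases because \<open>g\<close> grows at least by the factor by which the
  dimension grows exactly.\<close>

lemma defect_trace_decreasing:
  assumes char_fun: "has_constrained_char_fun TYPE('e :: chilbert_space) k n T" and i: "i \<in> {1..k}"
  shows "defect_trace (q(i := Suc (q i))) / real (card (mdegs k n (q(i := Suc (q i)))))
    \<le> defect_trace q / real (card (mdegs k n q))"
proof -
  let ?M = "tensor_space S (UNIV :: 'e set)"
  note M = csubspace_tensor_space[of S "UNIV :: 'e set"]
  obtain \<Theta> :: "(nat \<Rightarrow> nat list, 'e) ell2 \<Rightarrow> (nat \<Rightarrow> nat list, 'h) ell2" where
    \<Theta>: "bounded_op_on ?M (tensor_space S D) \<Theta>"
    and intertwine: "\<And>i j x. i \<in> {1..k} \<Longrightarrow> j \<in> {1..n i} \<Longrightarrow> x \<in> ?M \<Longrightarrow>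
        \<Theta> (ampliation S UNIV (sym_shift k n i j) x) = ampliation S D (sym_shift k n i j) (\<Theta> x)"
    and complement: "\<And>y. y \<in> tensor_space S D \<Longrightarrow> K (adj K y) + \<Theta> (adj_on ?M \<Theta> y) = y"
    using char_fun unfolding has_constrained_char_fun_def Let_def by blast
  define y where "y a u = adj_on ?M \<Theta> (basis_vec a u)" for a u
  have y_in: "y a u \<in> ?M" and \<Theta>_y: "z \<in> ?M \<Longrightarrow> cinner (\<Theta> z) (basis_vec a u) = cinner z (y a u)" for a u z
    unfolding y_def by (rule adj_on_in[OF M \<Theta>], rule cinner_adj_on[OF M \<Theta>])
  have norms: "(norm (kap a u))\<^sup>2 + (norm (y a u))\<^sup>2 = real (multi_num k a)"
    if a: "a \<in> mdegs k n r" and u: "u \<in> E" for a u r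
  proof -
    have "cinner (K (kap a u) + \<Theta> (y a u)) (basis_vec a u) = of_nat (multi_num k a)"
      using complement[OF basis_vec_in[OF a u]] norm_basis_vec[OF a u]
      by (simp add: adj_K_basis_vec[OF a u] y_def)
    then have "cinner (kap a u) (kap a u) + cinner (y a u) (y a u) = of_nat (multi_num k a)"
      by (simp add: cinner_add_left cinner_K_basis_vec[OF a u] \<Theta>_y[OF y_in])
    then have "complex_of_real ((norm (kap a u))\<^sup>2 + (norm (y a u))\<^sup>2) = complex_of_real (real (multi_num k a))"
      by (simp only: cinner_self of_real_add of_real_of_nat_eq)
    then show ?thesis by (simp only: of_real_eq_iff)
  qed
  \<comment> \<open>The weak form of the backward shift relation between the vectors
    \<open>y\<close>; testing against every \<open>x\<close> avoids computing the adjoint of the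
    compressed shift.\<close>
  have shift: "cinner (proj ?M (push (cons_at i j) x)) (y a u) = cinner x (y (a(i := a i - {#j#})) u)"
    if x: "x \<in> ?M" and a: "a \<in> mdegs k n r" and u: "u \<in> E" and j: "j \<in># a i" for x a u r j
  proof -
    have jn: "j \<in> {1..n i}" using mdegsD(1)[OF a i] j by blast
    have amp: "ampliation S D' (sym_shift k n i j) z = proj (tensor_space S D') (push (cons_at i j) z)"
      if "z \<in> tensor_space S D'" for z and D' :: "'f :: chilbert_space set"
      by (rule ampliation_proj_push[OF csubspace_sym_fock_tensor inj_cons_at sym_shift_eq[OF i] that])
    have \<Theta>x: "\<Theta> x \<in> tensor_space S D" by (rule bounded_op_onD(1)[OF \<Theta> x])
    have "cinner (proj ?M (push (cons_at i j) x)) (y a u)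
        = cinner (\<Theta> (proj ?M (push (cons_at i j) x))) (basis_vec a u)"
      by (rule \<Theta>_y[symmetric]) (rule proj_in[OF M])
    also have "\<Theta> (proj ?M (push (cons_at i j) x)) = proj (tensor_space S D) (push (cons_at i j) (\<Theta> x))"
      using intertwine[OF i jn x] by (simp only: amp[OF x] amp[OF \<Theta>x])
    also have "cinner \<dots> (basis_vec a u) = cinner (push (cons_at i j) (\<Theta> x)) (basis_vec a u)"
      by (rule cinner_proj[OF csubspace_tensor_space basis_vec_in[OF a u]])
    also have "\<dots> = cinner (\<Theta> x) (basis_vec (a(i := a i - {#j#})) u)"
      unfolding basis_vec_def cinner_push_multi_vec[OF i] using j by simp
    also have "\<dots> = cinner x (y (a(i := a i - {#j#})) u)" by (rule \<Theta>_y[OF x])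
    finally show ?thesis .
  qed
  have row: "(\<Sum>j\<in>set_mset (a i). (norm (y (a(i := a i - {#j#})) u))\<^sup>2) \<le> (norm (y a u))\<^sup>2"
    if a: "a \<in> mdegs k n r" and u: "u \<in> E" for a u r
  proof -
    define z where "z j = y (a(i := a i - {#j#})) u" for j
    \<comment> \<open>Pairing the compression of \<open>G\<close> with \<open>y a u\<close> gives
      the sum of the squared norms of the \<open>z j\<close>, which is also the squared norm of
      \<open>G\<close>. Since compression does not increase norms, Cauchy-Schwarz bounds the norm of
      \<open>G\<close> by that of \<open>y a u\<close>.\<close>
    define G where "G = (\<Sum>j\<in>set_mset (a i). push (cons_at i j) (z j))"
    have proj_sum: "proj ?M G = (\<Sum>j\<in>set_mset (a i). proj ?M (push (cons_at i j) (z j)))"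
    proof -
      have "bounded_op_on UNIV ?M (proj ?M)" by (rule bounded_op_on_proj[OF M])
      then have "bounded_op (proj ?M)" unfolding bounded_op_on_def by blast
      then show ?thesis unfolding G_def by (rule bounded_opD(5))
    qed
    have norm_G: "(norm G)\<^sup>2 = (\<Sum>j\<in>set_mset (a i). (norm (z j))\<^sup>2)"
      unfolding G_def
      by (subst norm_sum_sq_orth)
        (auto simp: norm_push[OF inj_cons_at] intro!: cinner_push_disjoint inj_cons_at range_cons_at_disjoint)
    have "cinner (proj ?M G) (y a u) = (\<Sum>j\<in>set_mset (a i). cinner (z j) (z j))"
      unfolding proj_sum cinner_sum_left
      by (rule sum.cong[OF refl]) (use shift[OF y_in a u] in \<open>simp add: z_def\<close>)
    also have "\<dots> = complex_of_real ((norm G)\<^sup>2)"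
      by (simp only: norm_G cinner_self of_real_sum)
    finally have "(norm G)\<^sup>2 = cmod (cinner (proj ?M G) (y a u))"
      by (simp only: norm_of_real abs_power2)
    also have "\<dots> \<le> norm (proj ?M G) * norm (y a u)" by (rule cmod_cinner_le)
    also have "\<dots> \<le> norm G * norm (y a u)" by (intro mult_right_mono norm_proj_le[OF M]) simp
    finally have "norm G * norm G \<le> norm G * norm (y a u)" by (simp add: power2_eq_square)
    then have "norm G \<le> norm (y a u)"
      by (cases "norm G = 0") (auto dest: mult_left_le_imp_le)
    then have "(norm G)\<^sup>2 \<le> (norm (y a u))\<^sup>2" by (intro power_mono) auto
    then show ?thesis by (simp add: norm_G z_def)
  qed
  \<comment> \<open>The share of the characteristic function in the trace: by \<open>norms\<close>
    every pair (a, u) contributes 1 minus its summand here.\<close>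
  define g where "g r = (\<Sum>u\<in>E. \<Sum>a\<in>mdegs k n r. (norm (y a u))\<^sup>2 / real (multi_num k a))" for r
  have trace_g: "defect_trace r = real (card E) * real (card (mdegs k n r)) - g r" for r
  proof -
    have "defect_trace r = (\<Sum>a\<in>mdegs k n r. \<Sum>u\<in>E. 1 - (norm (y a u))\<^sup>2 / real (multi_num k a))"
      unfolding defect_trace_def
    proof (intro sum.cong refl)
      fix a u assume a: "a \<in> mdegs k n r" and u: "u \<in> E"
      have "real (multi_num k a) * (lam u * (norm (tw (rep_word k a) u))\<^sup>2) = (norm (kap a u))\<^sup>2 / real (multi_num k a)"
        by (rule norm_kap_sq[OF u, symmetric])
      also have "\<dots> = 1 - (norm (y a u))\<^sup>2 / real (multi_num k a)"
        using norms[OF a u] multi_num_pos[of k a] by (simp add: field_simps)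
      finally show "real (multi_num k a) * (lam u * (norm (tw (rep_word k a) u))\<^sup>2)
          = 1 - (norm (y a u))\<^sup>2 / real (multi_num k a)" .
    qed
    also have "\<dots> = (\<Sum>u\<in>E. \<Sum>a\<in>mdegs k n r. 1 - (norm (y a u))\<^sup>2 / real (multi_num k a))"
      by (rule sum.swap)
    finally show ?thesis by (simp add: g_def sum_subtractf)
  qed
  let ?q = "q(i := Suc (q i))" and ?c = "real (q i + n i) / real (q i + 1)"
  have "?c * g q = (\<Sum>u\<in>E. \<Sum>a\<in>mdegs k n ?q. \<Sum>j\<in>set_mset (a i). (norm (y (a(i := a i - {#j#})) u))\<^sup>2 / real (multi_num k a))"
    unfolding g_def sum_distrib_left[of ?c _ E]
    by (rule sum.cong[OF refl]) (rule sum_mdegs_remove[OF i, symmetric])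
  also have "\<dots> \<le> g ?q"
    unfolding g_def sum_divide_distrib[symmetric]
    by (intro sum_mono divide_right_mono row) auto
  finally have g_le: "?c * g q \<le> g ?q" .
  show ?thesis
  proof (cases "card (mdegs k n q) = 0 \<or> q i + n i = 0")
    \<comment> \<open>The left quotient is 0 here, since division by zero yields 0.\<close>
    case True
    then have "card (mdegs k n ?q) = 0" using card_mdegs_Suc[OF i, of n q] by auto
    then show ?thesis using defect_trace_nonneg[of q] by simp
  next
    case False
    then have pos: "real (card (mdegs k n q)) > 0" "?c > 0" by auto
    have "g q / real (card (mdegs k n q)) = (?c * g q) / (?c * real (card (mdegs k n q)))"
      using pos(2) by (subst mult_divide_mult_cancel_left) auto
    also have "\<dots> \<le> g ?q / real (card (mdegs k n ?q))"
      unfolding card_mdegs_Suc[OF i] using pos g_le by (intro divide_right_mono) auto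
    finally have "g q / real (card (mdegs k n q)) \<le> g ?q / real (card (mdegs k n ?q))" .
    moreover have "real (card (mdegs k n ?q)) > 0"
      unfolding card_mdegs_Suc[OF i] by (rule mult_pos_pos[OF pos(2,1)])
    ultimately show ?thesis using pos(1) unfolding trace_g by (simp add: diff_divide_distrib)
  qed
qed

end

section \<open>Limits of monotone functions of several integer arguments\<close>

text \<open>Toeplitz averaging: the deviation accumulated before \<open>N\<close> is a constant
  \<open>C\<close>, which the growing total weight makes negligible.\<close>

lemma weighted_mean_tendsto:
  fixes w a :: "nat \<Rightarrow> real"
  assumes w: "\<And>j. w j \<ge> 0" and W: "filterlim (\<lambda>m. \<Sum>j\<le>m. w j) at_top sequentially" and a: "a \<longlonglongrightarrow> l"
  shows "(\<lambda>m. (\<Sum>j\<le>m. w j * a j) / (\<Sum>j\<le>m. w j)) \<longlonglongrightarrow> l"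
proof (rule LIMSEQ_I)
  fix e :: real assume e: "e > 0"
  obtain N where N: "\<And>j. j \<ge> N \<Longrightarrow> \<bar>a j - l\<bar> < e / 2"
    using LIMSEQ_D[OF a, of "e / 2"] e by auto
  define C where "C = (\<Sum>j<N. w j * \<bar>a j - l\<bar>)"
  have "\<forall>\<^sub>F m in sequentially. (\<Sum>j\<le>m. w j) > 2 * C / e"
    using W by (simp add: filterlim_at_top_dense)
  moreover have "\<forall>\<^sub>F m in sequentially. (\<Sum>j\<le>m. w j) > 0"
    using W by (simp add: filterlim_at_top_dense)
  moreover have "\<forall>\<^sub>F m in sequentially. m \<ge> N" by (rule eventually_ge_at_top)
  ultimately have "\<forall>\<^sub>F m in sequentially. norm ((\<Sum>j\<le>m. w j * a j) / (\<Sum>j\<le>m. w j) - l) < e"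
  proof eventually_elim
    case (elim m)
    let ?W = "\<Sum>j\<le>m. w j"
    have "(\<Sum>j\<le>m. w j * a j) / ?W - l = (\<Sum>j\<le>m. w j * (a j - l)) / ?W"
      using elim(2) by (simp add: field_simps sum_distrib_left sum_subtractf)
    then have "norm ((\<Sum>j\<le>m. w j * a j) / ?W - l) = \<bar>\<Sum>j\<le>m. w j * (a j - l)\<bar> / ?W"
      using elim(2) by simp
    also have "\<dots> \<le> (C + ?W * (e / 2)) / ?W"
    proof (rule divide_right_mono)
      have "\<bar>\<Sum>j\<le>m. w j * (a j - l)\<bar> \<le> (\<Sum>j\<le>m. w j * \<bar>a j - l\<bar>)"
        by (rule order_trans[OF sum_abs]) (simp add: abs_mult w)
      also have "\<dots> = C + (\<Sum>j\<in>{N..m}. w j * \<bar>a j - l\<bar>)"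
      proof -
        have "{..m} = {..<N} \<union> {N..m}" using elim(3) by auto
        then show ?thesis unfolding C_def by (simp add: sum.union_disjoint ivl_disj_int)
      qed
      also have "(\<Sum>j\<in>{N..m}. w j * \<bar>a j - l\<bar>) \<le> (\<Sum>j\<in>{N..m}. w j * (e / 2))"
        by (intro sum_mono mult_left_mono w) (use N in \<open>auto intro: less_imp_le\<close>)
      also have "\<dots> \<le> (\<Sum>j\<le>m. w j * (e / 2))"
        using e w by (intro sum_mono2) auto
      also have "\<dots> = ?W * (e / 2)" by (rule sum_distrib_right[symmetric])
      finally show "\<bar>\<Sum>j\<le>m. w j * (a j - l)\<bar> \<le> C + ?W * (e / 2)" by simp
    qed (use elim(2) in simp)
    also have "\<dots> < e" using elim(1,2) e by (simp add: field_simps)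
    finally show ?case .
  qed
  then show "\<exists>no. \<forall>m\<ge>no. norm ((\<Sum>j\<le>m. w j * a j) / (\<Sum>j\<le>m. w j) - l) < e"
    by (simp add: eventually_sequentially)
qed

text \<open>The numerator is a polynomial in \<open>q\<close> of degree \<open>n\<close> with
  leading coefficient 1 / n!. The factorials of the last asymptotic formula originate here.\<close>

lemma binomial_over_power_tendsto:
  "(\<lambda>q. real ((q + n) choose n) / real q ^ n) \<longlonglongrightarrow> 1 / fact n"
proof (induction n)
  case 0
  show ?case by simp
next
  case (Suc n)
  have "(\<lambda>q. 1 + real (Suc n) / real q) \<longlonglongrightarrow> 1 + 0"
    by (intro tendsto_add tendsto_const lim_const_over_n)
  then have "(\<lambda>q. real ((q + n) choose n) / real q ^ n * (1 + real (Suc n) / real q) / real (Suc n))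
      \<longlonglongrightarrow> 1 / fact n * (1 + 0) / real (Suc n)"
    by (intro tendsto_divide tendsto_mult Suc tendsto_const) auto
  then have "(\<lambda>q. real ((q + n) choose n) / real q ^ n * (1 + real (Suc n) / real q) / real (Suc n))
      \<longlonglongrightarrow> 1 / fact (Suc n)"
    by (simp add: mult.commute)
  moreover have "\<forall>\<^sub>F q in sequentially. real ((q + n) choose n) / real q ^ n * (1 + real (Suc n) / real q) / real (Suc n)
      = real ((q + Suc n) choose (Suc n)) / real q ^ Suc n"
    using eventually_gt_at_top[of 0]
  proof eventually_elim
    case (elim q)
    have "Suc (q + n) * ((q + n) choose n) = (Suc (q + n) choose Suc n) * Suc n"
      by (rule Suc_times_binomial_eq)
    then have eq: "real (Suc (q + n)) * real ((q + n) choose n) = real (Suc (q + n) choose Suc n) * real (Suc n)"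
      by (metis of_nat_mult)
    have "real ((q + n) choose n) / real q ^ n * (1 + real (Suc n) / real q) / real (Suc n)
        = (real (Suc (q + n)) * real ((q + n) choose n)) / (real q ^ Suc n * real (Suc n))"
      using elim by (simp add: field_simps)
    also have "\<dots> = real ((q + Suc n) choose (Suc n)) / real q ^ Suc n"
      unfolding eq by simp
    finally show ?case .
  qed
  ultimately show ?case by (rule Lim_transform_eventually)
qed

lemma binomial_at_top:
  assumes "n \<ge> 1" shows "filterlim (\<lambda>m. real ((m + n) choose n)) at_top sequentially"
proof (rule filterlim_at_top_mono[OF filterlim_real_sequentially always_eventually], rule allI)
  fix m
  have "m + 1 \<le> (m + n) choose n"
    using assms
  proof (induction n rule: dec_induct)
    case (step n)
    then show ?case by simp
  qed simp
  then show "real m \<le> real ((m + n) choose n)" by simp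
qed

section \<open>Counting weak compositions of an integer\<close>

definition compositions :: "nat \<Rightarrow> nat \<Rightarrow> nat list set" where
  "compositions k m = {l. length l = k \<and> sum_list l = m}"

lemma card_compositions: "card (compositions k m) = (m + k - 1) choose m"
  unfolding compositions_def by (rule card_length_sum_list)

lemma finite_compositions: "finite (compositions k m)"
proof (rule finite_subset)
  show "compositions k m \<subseteq> {l. set l \<subseteq> {..m} \<and> length l = k}"
    by (auto simp: compositions_def intro: member_le_sum_list)
  show "finite {l. set l \<subseteq> {..m} \<and> length l = k}" by (rule finite_lists_length_eq) simp
qed

lemma card_compositions_pos: "k \<ge> 1 \<Longrightarrow> card (compositions k m) > 0"
  by (simp add: card_compositions)

text \<open>The strict inequality matters for \<open>k = 0\<close>, where \<open>v = m\<close> would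
  compare the one empty composition of 0 with no composition of a positive \<open>m\<close>. This
  case occurs, because the lemma is applied to \<open>k - 1\<close>.\<close>

lemma card_compositions_mono:
  assumes "v < m" shows "card (compositions k (m - v)) \<le> card (compositions k m)"
proof (cases "k = 0")
  case True
  then show ?thesis using assms by (simp add: card_compositions binomial_eq_0)
next
  case False
  have "card (compositions k m) \<le> card (compositions k (Suc m))" for m
    unfolding compositions_def using card_length_sum_list_rec[of k "Suc m"] False by simp
  then show ?thesis by (rule lift_Suc_mono_le[of "\<lambda>m. card (compositions k m)"]) simp
qed

text \<open>One part fewer costs a factor of order 1/m, so a face of the simplex is negligible
  against the simplex.\<close>

lemma card_compositions_ratio:
  assumes "k \<ge> 1"
  shows "real (card (compositions (k - 1) m)) * real (m + k - 1) = real (k - 1) * real (card (compositions k m))"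
proof -
  have "(m + k - 1 - m) * ((m + k - 1) choose m) = (m + k - 1) * ((m + k - 1 - 1) choose m)"
    by (rule binomial_absorb_comp)
  moreover have "m + k - 1 - m = k - 1" using assms by simp
  moreover have "m + (k - 1) - 1 = m + k - 1 - 1" using assms by simp
  ultimately have "card (compositions (k - 1) m) * (m + k - 1) = (k - 1) * card (compositions k m)"
    by (simp only: card_compositions mult.commute)
  then show ?thesis by (metis of_nat_mult)
qed

text \<open>Deleting entry \<open>i\<close> is injective once its value is prescribed.\<close>

lemma card_compositions_fixed_entry:
  assumes i: "i < k"
  shows "card {l \<in> compositions k m. l ! i = v} \<le> card (compositions (k - 1) (m - v))"
proof (rule card_inj_on_le[where f = "\<lambda>l. take i l @ drop (Suc i) l"])
  have dec: "l = take i l @ v # drop (Suc i) l" if "l \<in> {l \<in> compositions k m. l ! i = v}" for l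
    using that i id_take_nth_drop[of i l] by (auto simp: compositions_def)
  show "inj_on (\<lambda>l. take i l @ drop (Suc i) l) {l \<in> compositions k m. l ! i = v}"
  proof (rule inj_onI)
    fix l l' assume l: "l \<in> {l \<in> compositions k m. l ! i = v}" and l': "l' \<in> {l \<in> compositions k m. l ! i = v}"
      and eq: "take i l @ drop (Suc i) l = take i l' @ drop (Suc i) l'"
    have "length (take i l) = length (take i l')" using l l' by (auto simp: compositions_def)
    then have "take i l = take i l'" "drop (Suc i) l = drop (Suc i) l'" using eq by auto
    then show "l = l'" using dec[OF l] dec[OF l'] by metis
  qed
  show "(\<lambda>l. take i l @ drop (Suc i) l) ` {l \<in> compositions k m. l ! i = v} \<subseteq> compositions (k - 1) (m - v)"
  proof clarify
    fix l assume l: "l \<in> compositions k m" "v = l ! i"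
    have "sum_list l = sum_list (take i l @ v # drop (Suc i) l)" using dec[of l] l by simp
    then have "m = sum_list (take i l) + v + sum_list (drop (Suc i) l)" using l by (simp add: compositions_def)
    then show "take i l @ drop (Suc i) l \<in> compositions (k - 1) (m - l ! i)"
      using l i by (simp add: compositions_def)
  qed
qed (rule finite_compositions)

section \<open>Means of antitone functions over compositions\<close>

locale antitone_lists =
  fixes k :: nat and f :: "nat list \<Rightarrow> real"
  assumes anti: "length l' = k \<Longrightarrow> list_all2 (\<le>) l l' \<Longrightarrow> f l' \<le> f l"
    and nonneg: "length l = k \<Longrightarrow> 0 \<le> f l"
begin

text \<open>An infimum over all arguments, not a limit inferior; for an antitone function it is the
  value of every limit below.\<close>

definition lim_inf :: real where "lim_inf = (INF l\<in>{l. length l = k}. f l)"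

lemma lim_inf_le: "length l = k \<Longrightarrow> lim_inf \<le> f l"
  unfolding lim_inf_def by (rule cINF_lower) (use nonneg in \<open>auto simp: bdd_below_def\<close>)

lemma lim_inf_approx:
  assumes "e > 0" obtains p where "length p = k" "f p < lim_inf + e"
proof -
  have "replicate k 0 \<in> {l :: nat list. length l = k}" by simp
  then have ne: "{l :: nat list. length l = k} \<noteq> {}" by blast
  have bdd: "bdd_below (f ` {l. length l = k})" using nonneg by (auto simp: bdd_below_def)
  have "\<exists>p\<in>{l. length l = k}. f p < lim_inf + e"
    using cINF_less_iff[OF ne bdd, of "lim_inf + e"] assms by (simp add: lim_inf_def)
  then show ?thesis using that by blast
qed

lemma lim_inf_bound:
  assumes "length p = k" "length l = k" "\<And>i. i < k \<Longrightarrow> p ! i \<le> l ! i" "f p < lim_inf + e"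
  shows "\<bar>f l - lim_inf\<bar> < e"
proof -
  have "f l \<le> f p" using assms by (intro anti) (auto simp: list_all2_conv_all_nth)
  then show ?thesis using assms(4) lim_inf_le[OF assms(2)] by linarith
qed

text \<open>Choose \<open>p\<close> with value close to the infimum. Compositions above
  \<open>p\<close> in every coordinate are at least as close; the remaining ones have a small entry
  and form a fraction of order at most 1/m, for which the uniform bound \<open>M\<close> on the
  deviation suffices.\<close>

lemma mean_compositions_tendsto:
  assumes k: "k \<ge> 1"
  shows "(\<lambda>m. (\<Sum>l\<in>compositions k m. f l) / real (card (compositions k m))) \<longlonglongrightarrow> lim_inf"
proof (rule LIMSEQ_I)
  fix e :: real assume e: "e > 0"
  obtain p where p: "length p = k" "f p < lim_inf + e / 2" using lim_inf_approx[of "e / 2"] e by auto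
  \<comment> \<open>A bound exceeding every entry of \<open>p\<close>: a composition with all
    entries at least \<open>P\<close> lies above \<open>p\<close>.\<close>
  define P where "P = Suc (sum_list p)"
  have P: "p ! i < P" if "i < k" for i
    unfolding P_def using p(1) that by (simp add: less_Suc_eq_le member_le_sum_list)
  define M where "M = f (replicate k 0) - lim_inf"
  have M: "f l - lim_inf \<le> M" if "length l = k" for l
    unfolding M_def using anti[of l "replicate k 0"] that by (auto simp: list_all2_conv_all_nth)
  have M0: "M \<ge> 0" unfolding M_def using lim_inf_le[of "replicate k 0"] by simp
  define bad where "bad m = {l \<in> compositions k m. \<exists>i<k. l ! i < P}" for m
  have bad_card: "card (bad m) \<le> k * P * card (compositions (k - 1) m)" if mP: "m \<ge> P" for m
  proof -
    have "bad m = (\<Union>(i, v)\<in>{..<k} \<times> {..<P}. {l \<in> compositions k m. l ! i = v})"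
      by (auto simp: bad_def)
    also have "card \<dots> \<le> (\<Sum>(i, v)\<in>{..<k} \<times> {..<P}. card {l \<in> compositions k m. l ! i = v})"
      unfolding case_prod_beta by (rule card_UN_le) simp
    also have "\<dots> \<le> (\<Sum>(i, v)\<in>{..<k} \<times> {..<P}. card (compositions (k - 1) m))"
    proof (rule sum_mono)
      fix x assume "x \<in> {..<k} \<times> {..<P}"
      then obtain i v where x: "x = (i, v)" "i < k" "v < m" using mP by auto
      have "card {l \<in> compositions k m. l ! i = v} \<le> card (compositions (k - 1) (m - v))"
        by (rule card_compositions_fixed_entry[OF x(2)])
      also have "\<dots> \<le> card (compositions (k - 1) m)" by (rule card_compositions_mono[OF x(3)])
      finally show "(case x of (i, v) \<Rightarrow> card {l \<in> compositions k m. l ! i = v})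
          \<le> (case x of (i, v) \<Rightarrow> card (compositions (k - 1) m))" using x(1) by simp
    qed
    finally show ?thesis by simp
  qed
  \<comment> \<open>This bounds the contribution of the bad compositions to the mean:
    \<open>k * P\<close> choices of a position and a small value, each class having relative size at
    most (k - 1) / (m + k - 1).\<close>
  have "(\<lambda>m. M * real (k * P) * real (k - 1) * inverse (real (m + k - 1))) \<longlonglongrightarrow> M * real (k * P) * real (k - 1) * 0"
  proof (intro tendsto_mult tendsto_const)
    have "(\<lambda>m. inverse (real (m + (k - 1)))) \<longlonglongrightarrow> 0"
      by (rule LIMSEQ_ignore_initial_segment[OF lim_inverse_n])
    then show "(\<lambda>m. inverse (real (m + k - 1))) \<longlonglongrightarrow> 0" using k by simp
  qed
  then have "\<forall>\<^sub>F m in sequentially. M * real (k * P) * real (k - 1) * inverse (real (m + k - 1)) < e / 2"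
    using e by (intro order_tendstoD(2)) auto
  moreover have "\<forall>\<^sub>F m in sequentially. m \<ge> P" by (rule eventually_ge_at_top)
  ultimately have "\<forall>\<^sub>F m in sequentially. norm ((\<Sum>l\<in>compositions k m. f l) / real (card (compositions k m)) - lim_inf) < e"
  proof eventually_elim
    case (elim m)
    let ?c = "real (card (compositions k m))"
    have c: "?c > 0" using card_compositions_pos[OF k] by simp
    have mk: "real (m + k - 1) > 0" using elim(2) k by (simp add: P_def)
    have len: "length l = k" if "l \<in> compositions k m" for l using that by (simp add: compositions_def)
    have "(\<Sum>l\<in>compositions k m. f l) / ?c - lim_inf = (\<Sum>l\<in>compositions k m. f l - lim_inf) / ?c"
      using c by (simp add: sum_subtractf field_simps)
    moreover have "0 \<le> (\<Sum>l\<in>compositions k m. f l - lim_inf)"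
      by (rule sum_nonneg) (use lim_inf_le len in auto)
    moreover have "(\<Sum>l\<in>compositions k m. f l - lim_inf) \<le> (\<Sum>l\<in>compositions k m. e / 2 + (if l \<in> bad m then M else 0))"
    proof (rule sum_mono)
      fix l assume l: "l \<in> compositions k m"
      show "f l - lim_inf \<le> e / 2 + (if l \<in> bad m then M else 0)"
      proof (cases "l \<in> bad m")
        case True
        then show ?thesis using M[OF len[OF l]] e by simp
      next
        case False
        then have "\<And>i. i < k \<Longrightarrow> p ! i \<le> l ! i" using l P by (force simp: bad_def)
        from lim_inf_bound[OF p(1) len[OF l] this p(2)] have "f l - lim_inf \<le> e / 2" by linarith
        then show ?thesis using False by simp
      qed
    qed
    moreover have "(\<Sum>l\<in>compositions k m. e / 2 + (if l \<in> bad m then M else 0)) = ?c * (e / 2) + M * real (card (bad m))"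
    proof -
      have "(\<Sum>l\<in>compositions k m. if l \<in> bad m then M else 0) = (\<Sum>l\<in>bad m. M)"
        by (rule sum.mono_neutral_cong_right) (auto simp: finite_compositions bad_def)
      then show ?thesis by (simp add: sum.distrib mult.commute)
    qed
    moreover have "M * real (card (bad m)) < ?c * (e / 2)"
    proof -
      have "M * real (card (bad m)) \<le> M * real (k * P * card (compositions (k - 1) m))"
        using bad_card[OF elim(2)] M0 by (intro mult_left_mono) (simp_all only: of_nat_le_iff)
      also have "\<dots> = M * real (k * P) * (real (k - 1) * ?c) * inverse (real (m + k - 1))"
        unfolding card_compositions_ratio[OF k, symmetric] using mk by (simp add: field_simps)
      also have "\<dots> = (M * real (k * P) * real (k - 1) * inverse (real (m + k - 1))) * ?c" by (simp only: mult_ac)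
      also have "\<dots> < e / 2 * ?c" by (rule mult_strict_right_mono[OF elim(1) c])
      finally show ?thesis by (simp only: mult.commute)
    qed
    ultimately have "0 \<le> (\<Sum>l\<in>compositions k m. f l - lim_inf)" "(\<Sum>l\<in>compositions k m. f l - lim_inf) < ?c * e"
      "(\<Sum>l\<in>compositions k m. f l) / ?c - lim_inf = (\<Sum>l\<in>compositions k m. f l - lim_inf) / ?c"
      by (auto simp: field_simps)
    then show ?case using c by (simp add: field_simps)
  qed
  then show "\<exists>no. \<forall>m\<ge>no. norm ((\<Sum>l\<in>compositions k m. f l) / real (card (compositions k m)) - lim_inf) < e"
    by (simp add: eventually_sequentially)
qed

text \<open>The mean over the simplex is an average of the diagonal means, weighted by the numbers
  of compositions, which add up to the normalising binomial coefficient.\<close>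

lemma mean_simplex_tendsto:
  assumes k: "k \<ge> 1"
  shows "(\<lambda>m. (\<Sum>j\<le>m. \<Sum>l\<in>compositions k j. f l) / real ((m + k) choose k)) \<longlonglongrightarrow> lim_inf"
proof -
  have W: "(\<Sum>j\<le>m. real (card (compositions k j))) = real ((m + k) choose k)" for m
  proof -
    have "(\<Sum>j\<le>m. card (compositions k j)) = (\<Sum>j\<le>m. (k - 1 + j) choose j)"
    proof (rule sum.cong[OF refl])
      fix j
      have "j + k - 1 = k - 1 + j" using k by simp
      then show "card (compositions k j) = (k - 1 + j) choose j" by (simp only: card_compositions)
    qed
    also have "\<dots> = Suc (k - 1 + m) choose m" by (rule sum_choose_lower)
    also have "\<dots> = (m + k) choose k" using k binomial_symmetric[of m "m + k"] by (simp add: add.commute)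
    finally show ?thesis by (metis of_nat_sum)
  qed
  have "(\<lambda>m. (\<Sum>j\<le>m. real (card (compositions k j)) * ((\<Sum>l\<in>compositions k j. f l) / real (card (compositions k j))))
      / (\<Sum>j\<le>m. real (card (compositions k j)))) \<longlonglongrightarrow> lim_inf"
    by (rule weighted_mean_tendsto[OF _ _ mean_compositions_tendsto[OF k]]) (simp_all add: W binomial_at_top[OF k])
  moreover have "card (compositions k j) \<noteq> 0" for j using card_compositions_pos[OF k, of j] by simp
  ultimately show ?thesis by (simp add: W)
qed

end

subsection \<open>Iterated limits\<close>

lemma has_iterated_limit_cong:
  assumes "\<And>l. length l = k \<Longrightarrow> F l = G l" "has_iterated_limit k F L"
  shows "has_iterated_limit k G L"
  using assms
proof (induction k arbitrary: F G L)
  case (Suc k)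
  from Suc.prems(2) obtain g where
    g: "\<forall>\<^sub>F q in sequentially. has_iterated_limit k (\<lambda>qs. F (q # qs)) (g q)" "g \<longlonglongrightarrow> L" by auto
  have "\<forall>\<^sub>F q in sequentially. has_iterated_limit k (\<lambda>qs. G (q # qs)) (g q)"
    using g(1)
  proof eventually_elim
    case (elim q)
    show ?case by (rule Suc.IH[OF _ elim]) (use Suc.prems(1) in auto)
  qed
  then show ?case using g(2) by auto
qed simp

text \<open>Finiteness of \<open>A\<close> lets the eventual statements for the single
  \<open>s\<close> hold simultaneously.\<close>

lemma has_iterated_limit_sum:
  assumes "finite A" "\<And>s. s \<in> A \<Longrightarrow> has_iterated_limit k (F s) (L s)"
  shows "has_iterated_limit k (\<lambda>q. \<Sum>s\<in>A. c s * F s q) (\<Sum>s\<in>A. c s * L s)"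
  using assms(2)
proof (induction k arbitrary: F L)
  case (Suc k)
  then have "\<forall>s\<in>A. \<exists>g. (\<forall>\<^sub>F q in sequentially. has_iterated_limit k (\<lambda>qs. F s (q # qs)) (g q)) \<and> g \<longlonglongrightarrow> L s"
    by auto
  then obtain g where g: "\<And>s. s \<in> A \<Longrightarrow> \<forall>\<^sub>F q in sequentially. has_iterated_limit k (\<lambda>qs. F s (q # qs)) (g s q)"
    "\<And>s. s \<in> A \<Longrightarrow> g s \<longlonglongrightarrow> L s" by metis
  have "\<forall>\<^sub>F q in sequentially. \<forall>s\<in>A. has_iterated_limit k (\<lambda>qs. F s (q # qs)) (g s q)"
    using assms(1) g(1) by (simp add: eventually_ball_finite)
  then have "\<forall>\<^sub>F q in sequentially. has_iterated_limit k (\<lambda>qs. \<Sum>s\<in>A. c s * F s (q # qs)) (\<Sum>s\<in>A. c s * g s q)"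
    by eventually_elim (rule Suc.IH, blast)
  moreover have "(\<lambda>q. \<Sum>s\<in>A. c s * g s q) \<longlonglongrightarrow> (\<Sum>s\<in>A. c s * L s)"
    by (intro tendsto_sum tendsto_mult tendsto_const g(2))
  ultimately show ?case by auto
qed simp

text \<open>The quotient of the last asymptotic formula in a recursive form that follows the nesting
  of \<open>has_iterated_limit\<close>. The weights are dimensions of homogeneous components;
  divided by the powers of the \<open>q\<close>, their total tends to 1 over the product of the
  factorials, so this is a mean only up to that constant.\<close>

fun weighted_box_mean :: "nat list \<Rightarrow> (nat list \<Rightarrow> real) \<Rightarrow> nat list \<Rightarrow> real" where
  "weighted_box_mean (n # ns) f (q # qs) =
    (\<Sum>s\<le>q. real ((s + n - 1) choose (n - 1)) / real q ^ n * weighted_box_mean ns (\<lambda>l. f (s # l)) qs)"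
| "weighted_box_mean _ f _ = f []"

text \<open>Fixing the first entry leaves an antitone function, so by induction the inner limit is
  governed by its infimum \<open>g s\<close>. These infima converge to the overall infimum, and
  averaging with total weight asymptotic to q^n / n! carries this over to the outer limit.\<close>

lemma has_iterated_limit_weighted_box_mean:
  assumes "antitone_lists (length ns) f" "\<And>n. n \<in> set ns \<Longrightarrow> n \<ge> 1"
  shows "has_iterated_limit (length ns) (\<lambda>q. complex_of_real (weighted_box_mean ns f q))
    (complex_of_real (antitone_lists.lim_inf (length ns) f / prod_list (map fact ns)))"
  using assms
proof (induction ns arbitrary: f)
  case Nil
  then show ?case by (simp add: antitone_lists.lim_inf_def)
next
  case (Cons n ns)
  interpret f: antitone_lists "Suc (length ns)" f using Cons.prems(1) by simp
  have tail: "antitone_lists (length ns) (\<lambda>l. f (s # l))" for s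
    by unfold_locales (auto intro: f.anti f.nonneg)
  define g where "g s = antitone_lists.lim_inf (length ns) (\<lambda>l. f (s # l))" for s
  let ?p = "prod_list (map fact ns) :: real"
  let ?w = "\<lambda>s. real ((s + n - 1) choose (n - 1))"
  have n: "n \<ge> 1" using Cons.prems(2) by simp
  \<comment> \<open>Valid for every \<open>q\<close>, including \<open>q = 0\<close>, where division
    by zero makes all weights vanish.\<close>
  have "has_iterated_limit (length ns)
      (\<lambda>qs. \<Sum>s\<le>q. complex_of_real (?w s / real q ^ n) * complex_of_real (weighted_box_mean ns (\<lambda>l. f (s # l)) qs))
      (\<Sum>s\<le>q. complex_of_real (?w s / real q ^ n) * complex_of_real (g s / ?p))" for q
    unfolding g_def
    by (intro has_iterated_limit_sum Cons.IH tail) (use Cons.prems(2) in auto)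
  then have inner: "has_iterated_limit (length ns) (\<lambda>qs. complex_of_real (weighted_box_mean (n # ns) f (q # qs)))
      (complex_of_real (\<Sum>s\<le>q. ?w s / real q ^ n * (g s / ?p)))" for q
    by simp
  \<comment> \<open>The tail \<open>l0\<close> of one near-optimal list \<open>s0 # l0\<close>
    serves for all \<open>s\<close> from \<open>s0\<close> on, by antitonicity in the first
    entry.\<close>
  have "g \<longlonglongrightarrow> f.lim_inf"
  proof (rule LIMSEQ_I)
    fix e :: real assume "e > 0"
    then obtain p where p: "length p = Suc (length ns)" "f p < f.lim_inf + e"
      using f.lim_inf_approx by blast
    then obtain s0 l0 where p_eq: "p = s0 # l0" by (cases p) auto
    have "norm (g s - f.lim_inf) < e" if s: "s \<ge> s0" for s
    proof -
      have "f.lim_inf \<le> g s"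
        unfolding g_def antitone_lists.lim_inf_def[OF tail]
        by (rule cINF_greatest) (auto intro: f.lim_inf_le exI[of _ "replicate (length ns) 0"])
      moreover have "g s \<le> f (s # l0)"
        unfolding g_def by (rule antitone_lists.lim_inf_le[OF tail]) (use p(1) p_eq in simp)
      moreover have "f (s # l0) \<le> f p"
        unfolding p_eq by (rule f.anti) (use p(1) p_eq s in \<open>auto simp: list_all2_refl\<close>)
      ultimately show ?thesis using p(2) by simp
    qed
    then show "\<exists>no. \<forall>s\<ge>no. norm (g s - f.lim_inf) < e" by blast
  qed
  moreover have W: "(\<Sum>s\<le>q. ?w s) = real ((q + n) choose n)" for q
  proof -
    have "(\<Sum>s\<le>q. (s + n - 1) choose (n - 1)) = (\<Sum>s\<le>q. (n - 1 + s) choose s)"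
    proof (rule sum.cong[OF refl])
      fix s
      have "(s + n - 1) choose (n - 1) = (n - 1 + s) choose (n - 1)" using n by (simp add: add.commute)
      also have "\<dots> = (n - 1 + s) choose s" using binomial_symmetric[of "n - 1" "n - 1 + s"] by simp
      finally show "(s + n - 1) choose (n - 1) = (n - 1 + s) choose s" .
    qed
    also have "\<dots> = Suc (n - 1 + q) choose q" by (rule sum_choose_lower)
    also have "\<dots> = (q + n) choose n" using n binomial_symmetric[of q "q + n"] by (simp add: add.commute)
    finally show ?thesis by (metis of_nat_sum)
  qed
  ultimately have mean: "(\<lambda>q. (\<Sum>s\<le>q. ?w s * g s) / real ((q + n) choose n)) \<longlonglongrightarrow> f.lim_inf"
    using weighted_mean_tendsto[of ?w g] binomial_at_top[OF n] by simp
  have p0: "?p \<noteq> 0" by (induction ns) auto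
  from tendsto_divide[OF tendsto_mult[OF mean binomial_over_power_tendsto[of n]] tendsto_const[of ?p]]
  have "(\<lambda>q. (\<Sum>s\<le>q. ?w s * g s) / real ((q + n) choose n) * (real ((q + n) choose n) / real q ^ n) / ?p)
      \<longlonglongrightarrow> f.lim_inf * (1 / fact n) / ?p"
    using p0 by blast
  moreover have "(\<Sum>s\<le>q. ?w s * g s) / real ((q + n) choose n) * (real ((q + n) choose n) / real q ^ n) / ?p
      = (\<Sum>s\<le>q. ?w s / real q ^ n * (g s / ?p))" for q
  proof -
    have "(\<Sum>s\<le>q. ?w s * g s) / real ((q + n) choose n) * (real ((q + n) choose n) / real q ^ n) / ?p
        = (\<Sum>s\<le>q. ?w s * g s) / (real q ^ n * ?p)" by simp
    also have "\<dots> = (\<Sum>s\<le>q. ?w s * g s / (real q ^ n * ?p))" by (rule sum_divide_distrib)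
    finally show ?thesis by simp
  qed
  ultimately have "(\<lambda>q. \<Sum>s\<le>q. ?w s / real q ^ n * (g s / ?p)) \<longlonglongrightarrow> f.lim_inf / prod_list (map fact (n # ns))"
    by simp
  then have "(\<lambda>q. complex_of_real (\<Sum>s\<le>q. ?w s / real q ^ n * (g s / ?p)))
      \<longlonglongrightarrow> complex_of_real (f.lim_inf / prod_list (map fact (n # ns)))"
    by (rule tendsto_of_real)
  then show ?case
    unfolding list.size(4) add_Suc_right add_0_right has_iterated_limit.simps
    using inner by (intro exI[of _ "\<lambda>q. complex_of_real (\<Sum>s\<le>q. ?w s / real q ^ n * (g s / ?p))"] conjI always_eventually allI)
qed

lemma weighted_box_mean_eq:
  assumes "length ns = length qs"
  shows "weighted_box_mean ns f qs
    = (\<Sum>l | list_all2 (\<le>) l qs. f l * (\<Prod>i<length qs. real ((l ! i + ns ! i - 1) choose (ns ! i - 1))))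
      / (\<Prod>i<length qs. real (qs ! i) ^ (ns ! i))"
  using assms
proof (induction ns qs arbitrary: f rule: list_induct2)
  case Nil
  have "{l. list_all2 (\<le>) l ([] :: nat list)} = {[]}" by auto
  then show ?case by simp
next
  case (Cons n ns q qs)
  let ?w = "\<lambda>n s. real ((s + n - 1) choose (n - 1))"
  let ?B = "{l. list_all2 (\<le>) l qs}"
  have box: "{l. list_all2 (\<le>) l (q # qs)} = (\<lambda>(s, l). s # l) ` ({..q} \<times> ?B)"
    by (auto simp: list_all2_Cons2 image_iff)
  have "inj_on (\<lambda>(s, l). s # l) ({..q} \<times> ?B)" by (auto simp: inj_on_def)
  then have split: "(\<Sum>l | list_all2 (\<le>) l (q # qs). G l) = (\<Sum>s\<le>q. \<Sum>l\<in>?B. G (s # l))" for G :: "nat list \<Rightarrow> real"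
    unfolding box by (simp only: sum.reindex sum.cartesian_product o_def) (simp add: case_prod_beta)
  let ?P = "\<lambda>l. \<Prod>i<length qs. ?w (ns ! i) (l ! i)" and ?Q = "\<Prod>i<length qs. real (qs ! i) ^ (ns ! i)"
  have "weighted_box_mean (n # ns) f (q # qs)
      = (\<Sum>s\<le>q. \<Sum>l\<in>?B. f (s # l) * (?w n s * ?P l) / (real q ^ n * ?Q))"
    by (simp add: Cons.IH sum_distrib_left sum_divide_distrib mult_ac)
  also have "\<dots> = (\<Sum>s\<le>q. \<Sum>l\<in>?B. f (s # l) * (?w n s * ?P l)) / (real q ^ n * ?Q)"
    by (simp only: sum_divide_distrib)
  also have "\<dots> = (\<Sum>l | list_all2 (\<le>) l (q # qs). f l * (\<Prod>i<length (q # qs). ?w ((n # ns) ! i) (l ! i)))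
      / (\<Prod>i<length (q # qs). real ((q # qs) ! i) ^ ((n # ns) ! i))"
    unfolding split by (simp add: prod.lessThan_Suc_shift del: prod.lessThan_Suc)
  finally show ?case .
qed

section \<open>Curvature\<close>

text \<open>Passage between tuples indexed from 1 and lists indexed from 0, whence
  \<open>l ! (i - 1)\<close>; \<open>restrict\<close> keeps the tuples extensional.\<close>

lemma sum_multi_indices:
  "(\<Sum>q | q \<in> multi_indices k \<and> P (map q [1..<Suc k]). F q)
    = (\<Sum>l | length l = k \<and> P l. F (restrict (\<lambda>i. l ! (i - 1)) {1..k}))"
proof (rule sum.reindex_bij_witness[where i = "\<lambda>l. restrict (\<lambda>i. l ! (i - 1)) {1..k}" and j = "\<lambda>q. map q [1..<Suc k]"])
  have list: "map (restrict (\<lambda>i. l ! (i - 1)) {1..k}) [1..<Suc k] = l" if "length l = k" for l :: "nat list"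
    by (rule nth_equalityI) (use that in \<open>auto simp del: upt_Suc\<close>)
  have idx: "restrict (\<lambda>i. map q [1..<Suc k] ! (i - 1)) {1..k} = q" if "q \<in> multi_indices k" for q
    using that by (auto simp: multi_indices_def PiE_def extensional_def fun_eq_iff simp del: upt_Suc)
  show "restrict (\<lambda>i. map q [1..<Suc k] ! (i - 1)) {1..k} = q" if "q \<in> {q. q \<in> multi_indices k \<and> P (map q [1..<Suc k])}" for q
    using idx that by blast
  show "map q [1..<Suc k] \<in> {l. length l = k \<and> P l}" if "q \<in> {q. q \<in> multi_indices k \<and> P (map q [1..<Suc k])}" for q
    using that by simp
  show "map (restrict (\<lambda>i. l ! (i - 1)) {1..k}) [1..<Suc k] = l" if "l \<in> {l. length l = k \<and> P l}" for l
    using list that by blast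
  show "restrict (\<lambda>i. l ! (i - 1)) {1..k} \<in> {q. q \<in> multi_indices k \<and> P (map q [1..<Suc k])}"
    if "l \<in> {l. length l = k \<and> P l}" for l
    using list[of l] that by (simp add: multi_indices_def del: upt_Suc)
  show "F (restrict (\<lambda>i. map q [1..<Suc k] ! (i - 1)) {1..k}) = F q"
    if "q \<in> {q. q \<in> multi_indices k \<and> P (map q [1..<Suc k])}" for q
    using idx[of q] that by simp
qed

lemma sum_list_map_upt: "sum_list (map q [1..<Suc k]) = (\<Sum>i=1..k. q i :: nat)"
  by (simp only: interv_sum_list_conv_sum_set_nat set_upt atLeastLessThanSuc_atLeastAtMost)

lemma prod_list_fact_upt: "prod_list (map fact (map n [1..<Suc k])) = (\<Prod>i=1..k. fact (n i) :: real)"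
proof -
  have "(\<Prod>i=1..k. fact (n i) :: real) = prod_list (map (\<lambda>i. fact (n i)) [1..<Suc k])"
    using prod.distinct_set_conv_list[of "[1..<Suc k]" "\<lambda>i. fact (n i) :: real"]
    by (simp only: set_upt atLeastLessThanSuc_atLeastAtMost distinct_upt)
  then show ?thesis by (simp only: map_map o_def)
qed

lemma sum_lists_sum_le:
  "(\<Sum>l | length l = k \<and> sum_list l \<le> m. F l) = (\<Sum>j\<le>m. \<Sum>l\<in>compositions k j. F l)"
proof -
  let ?S = "{l. length l = k \<and> sum_list l \<le> m}"
  have S: "?S = (\<Union>j\<le>m. compositions k j)" by (auto simp: compositions_def)
  have "(\<Sum>l\<in>?S. F l) = (\<Sum>j\<in>{..m}. \<Sum>l | l \<in> ?S \<and> sum_list l = j. F l)"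
  proof (rule sum.group[symmetric])
    show "finite ?S" unfolding S by (intro finite_UN_I finite_compositions) simp
  qed auto
  also have "\<dots> = (\<Sum>j\<le>m. \<Sum>l\<in>compositions k j. F l)"
    by (intro sum.cong) (auto simp: compositions_def)
  finally show ?thesis .
qed

section \<open>The quotient of traces as an antitone function of the multidegree\<close>

context finite_rank_tuple
begin

definition ratio :: "(nat \<Rightarrow> nat) \<Rightarrow> real" where
  "ratio q = defect_trace q / real (card (mdegs k n q))"

text \<open>Functions built from lists are arbitrary outside \<open>{1..k}\<close>, so independence
  of those values is needed to move between tuples and lists.\<close>

lemma ratio_cong: "(\<And>i. i \<in> {1..k} \<Longrightarrow> q i = q' i) \<Longrightarrow> ratio q = ratio q'"
proof -
  assume "\<And>i. i \<in> {1..k} \<Longrightarrow> q i = q' i"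
  then have "mdegs k n q = mdegs k n q'" unfolding mdegs_def by (intro PiE_cong) simp
  then show ?thesis by (simp add: ratio_def defect_trace_def)
qed

lemma defect_ratio_eq: "defect_ratio k n T q = complex_of_real (ratio q)"
  by (simp add: defect_ratio_def trace_iterated_defect trace_degree_proj ratio_def card_mdegs)

lemma curv_mean_eq:
  "curv_mean k n T m = 1 / of_nat ((m + k) choose k) *
    (\<Sum>q | q \<in> multi_indices k \<and> (\<Sum>i=1..k. q i) \<le> m. defect_ratio k n T q)"
  by (simp add: curv_mean_def trace_kernel trace_multidegree_proj defect_ratio_eq ratio_def)

lemma ratio_antimono:
  assumes char_fun: "has_constrained_char_fun TYPE('e :: chilbert_space) k n T"
    and le: "\<And>i. i \<in> {1..k} \<Longrightarrow> q i \<le> q' i"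
  shows "ratio q' \<le> ratio q"
proof -
  have raise: "ratio (p(i := m')) \<le> ratio (p(i := m))" if i: "i \<in> {1..k}" and "m \<le> m'" for p i m m'
    using \<open>m \<le> m'\<close>
  proof (induction m' rule: dec_induct)
    case (step m')
    have "ratio (p(i := Suc m')) \<le> ratio (p(i := m'))"
      using defect_trace_decreasing[OF char_fun i, of "p(i := m')"] by (simp add: ratio_def)
    then show ?case using step.IH by (rule order_trans)
  qed simp
  \<comment> \<open>The coordinates up to \<open>j\<close> are already raised, so consecutive
    \<open>p j\<close> differ in one coordinate only.\<close>
  define p where "p j i = (if i \<in> {1..j} then q' i else q i)" for j i
  have "ratio (p j) \<le> ratio q" if "j \<le> k" for j
    using that
  proof (induction j)
    case 0
    have "p 0 = q" by (auto simp: p_def)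
    then show ?case by simp
  next
    case (Suc j)
    have "p (Suc j) = (p j)(Suc j := q' (Suc j))" "(p j)(Suc j := q (Suc j)) = p j"
      by (auto simp: p_def fun_eq_iff)
    then have "ratio (p (Suc j)) \<le> ratio (p j)"
      using raise[of "Suc j" "q (Suc j)" "q' (Suc j)" "p j"] le[of "Suc j"] Suc.prems by simp
    then show ?case using Suc by simp
  qed
  moreover have "ratio (p k) = ratio q'" by (rule ratio_cong) (simp add: p_def)
  ultimately show ?thesis by (metis order_refl)
qed

definition list_ratio :: "nat list \<Rightarrow> real" where
  "list_ratio l = ratio (\<lambda>i. l ! (i - 1))"

lemma ratio_restrict: "ratio (restrict (\<lambda>i. l ! (i - 1)) {1..k}) = list_ratio l"
  unfolding list_ratio_def by (rule ratio_cong) simp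

lemma ratio_map: "ratio q = list_ratio (map q [1..<Suc k])"
  unfolding list_ratio_def by (rule ratio_cong) (auto simp del: upt_Suc)

lemma antitone_list_ratio:
  assumes "has_constrained_char_fun TYPE('e :: chilbert_space) k n T"
  shows "antitone_lists k list_ratio"
proof
  fix l l' :: "nat list"
  assume "length l' = k" "list_all2 (\<le>) l l'"
  then show "list_ratio l' \<le> list_ratio l"
    unfolding list_ratio_def by (intro ratio_antimono[OF assms]) (auto simp: list_all2_conv_all_nth)
next
  fix l :: "nat list"
  show "0 \<le> list_ratio l" by (simp add: list_ratio_def ratio_def defect_trace_nonneg)
qed

lemma defect_trace_ratio:
  assumes "\<forall>i\<in>{1..k}. n i \<ge> 1"
  shows "defect_trace q = ratio q * (\<Prod>i=1..k. real ((q i + n i - 1) choose (n i - 1)))"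
proof -
  have c: "real (card (mdegs k n q)) = (\<Prod>i=1..k. real ((q i + n i - 1) choose (n i - 1)))"
    using assms by (simp add: card_mdegs card_msets)
  have pos: "(\<Prod>i=1..k. real ((q i + n i - 1) choose (n i - 1))) > 0"
    using assms by (intro prod_pos) (simp add: zero_less_binomial_iff)
  show ?thesis
    unfolding ratio_def c
    by (rule iffD1[OF nonzero_divide_eq_eq[OF less_imp_neq[OF pos, THEN not_sym]] refl])
qed

text \<open>Telescoping turns the trace into a box sum of \<open>defect_trace\<close>, and each
  summand is \<open>list_ratio\<close> times a product of dimensions, which is the shape of
  \<open>weighted_box_mean\<close>.\<close>

lemma trace_box:
  assumes n: "\<forall>i\<in>{1..k}. n i \<ge> 1" and q: "length q = k"
  shows "trace_on UNIV (comp_upto k (\<lambda>i. id_minus (cp_map (n i) (T i) ^^ (q ! (i - 1) + 1))) id)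
      / (\<Prod>i=1..k. of_nat (q ! (i - 1)) ^ n i)
    = complex_of_real (weighted_box_mean (map n [1..<Suc k]) list_ratio q)"
proof -
  let ?P = "PiE {1..k} (\<lambda>i. {..q ! (i - 1)})" and ?ns = "map n [1..<Suc k]"
  let ?w = "\<lambda>l. \<Prod>i<k. real ((l ! i + ?ns ! i - 1) choose (?ns ! i - 1))"
  have "trace_on UNIV (comp_upto k (\<lambda>i. id_minus (cp_map (n i) (T i) ^^ (q ! (i - 1) + 1))) id)
      = trace_on UNIV (\<lambda>h. \<Sum>s\<in>?P. iterated_defect k n T s h)"
    by (rule arg_cong[where f = "trace_on UNIV"]) (rule ext, rule telescope_iterated_defect)
  also have "\<dots> = complex_of_real (\<Sum>s\<in>?P. defect_trace s)"
    by (rule trace_sum_iterated_defect) (intro finite_PiE, auto)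
  also have "(\<Sum>s\<in>?P. defect_trace s) = (\<Sum>s | s \<in> multi_indices k \<and> list_all2 (\<le>) (map s [1..<Suc k]) q. defect_trace s)"
  proof (rule sum.cong[OF _ refl])
    show "?P = {s. s \<in> multi_indices k \<and> list_all2 (\<le>) (map s [1..<Suc k]) q}"
    proof (intro equalityI subsetI)
      fix s assume s: "s \<in> ?P"
      have "list_all2 (\<le>) (map s [1..<Suc k]) q"
        unfolding list_all2_conv_all_nth
      proof (intro conjI allI impI)
        fix i assume "i < length (map s [1..<Suc k])"
        then have i: "Suc i \<in> {1..k}" "map s [1..<Suc k] ! i = s (Suc i)" by (auto simp del: upt_Suc)
        have "s (Suc i) \<in> {..q ! (Suc i - 1)}" by (rule PiE_mem[OF s i(1)])
        then show "map s [1..<Suc k] ! i \<le> q ! i" unfolding i(2) by simp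
      qed (use q in simp)
      then show "s \<in> {s. s \<in> multi_indices k \<and> list_all2 (\<le>) (map s [1..<Suc k]) q}"
        using s by (simp add: multi_indices_def PiE_iff del: upt_Suc)
    next
      fix s assume s: "s \<in> {s. s \<in> multi_indices k \<and> list_all2 (\<le>) (map s [1..<Suc k]) q}"
      have "s i \<le> q ! (i - 1)" if "i \<in> {1..k}" for i
      proof -
        have "list_all2 (\<le>) (map s [1..<Suc k]) q" using s by blast
        then have "map s [1..<Suc k] ! (i - 1) \<le> q ! (i - 1)"
          by (rule list_all2_nthD) (use that in \<open>auto simp del: upt_Suc\<close>)
        moreover have "map s [1..<Suc k] ! (i - 1) = s i"
          by (subst nth_map) (use that in \<open>auto simp del: upt_Suc\<close>)
        ultimately show ?thesis by simp
      qed
      then show "s \<in> ?P" using s by (simp add: multi_indices_def PiE_iff)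
    qed
  qed
  also have "\<dots> = (\<Sum>l | length l = k \<and> list_all2 (\<le>) l q. defect_trace (restrict (\<lambda>i. l ! (i - 1)) {1..k}))"
    by (rule sum_multi_indices)
  also have "\<dots> = (\<Sum>l | list_all2 (\<le>) l q. list_ratio l * ?w l)"
  proof (rule sum.cong)
    show "{l. length l = k \<and> list_all2 (\<le>) l q} = {l. list_all2 (\<le>) l q}"
      using q by (auto dest: list_all2_lengthD)
    fix l
    have "(\<Prod>i=1..k. real ((restrict (\<lambda>i. l ! (i - 1)) {1..k} i + n i - 1) choose (n i - 1)))
        = (\<Prod>i=1..k. real ((l ! (i - 1) + n i - 1) choose (n i - 1)))"
      by (rule prod.cong) auto
    also have "\<dots> = ?w l"
      unfolding One_nat_def prod.atLeast1_atMost_eq by (rule prod.cong) (auto simp del: upt_Suc)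
    finally show "defect_trace (restrict (\<lambda>i. l ! (i - 1)) {1..k}) = list_ratio l * ?w l"
      unfolding defect_trace_ratio[OF n] ratio_restrict by simp
  qed
  finally have trace: "trace_on UNIV (comp_upto k (\<lambda>i. id_minus (cp_map (n i) (T i) ^^ (q ! (i - 1) + 1))) id)
      = complex_of_real (\<Sum>l | list_all2 (\<le>) l q. list_ratio l * ?w l)" .
  have "(\<Prod>i=1..k. of_nat (q ! (i - 1)) ^ n i) = complex_of_real (\<Prod>i<k. real (q ! i) ^ (?ns ! i))"
    unfolding One_nat_def prod.atLeast1_atMost_eq of_real_prod
    by (rule prod.cong) (auto simp del: upt_Suc)
  moreover have "weighted_box_mean ?ns list_ratio q
      = (\<Sum>l | list_all2 (\<le>) l q. list_ratio l * ?w l) / (\<Prod>i<k. real (q ! i) ^ (?ns ! i))"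
    using weighted_box_mean_eq[of ?ns q list_ratio] q by (simp del: upt_Suc)
  ultimately show ?thesis unfolding trace by (simp only: of_real_divide)
qed

end

theorem theorem5p4:
  fixes k :: nat and n :: "nat \<Rightarrow> nat" and T :: "'h :: chilbert_space operator_tuple"
  assumes k: "k \<ge> 1"
    and n: "\<forall>i\<in>{1..k}. n i \<ge> 1" "\<exists>i\<in>{1..k}. n i \<ge> 2"
    and T: "T \<in> comm_polyball k n"
    and finite_rank: "has_finite_rank k n T"
    and char_fun: "has_constrained_char_fun TYPE('e :: chilbert_space) k n T"
  shows "convergent (curv_mean k n T)
    \<and> (\<lambda>m. 1 / of_nat ((m + k) choose k) *
          (\<Sum>q | q \<in> multi_indices k \<and> (\<Sum>i=1..k. q i) \<le> m. defect_ratio k n T q))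
        \<longlonglongrightarrow> curv_c k n T
    \<and> (\<lambda>m. 1 / of_nat ((m + k - 1) choose (k - 1)) *
          (\<Sum>q | q \<in> multi_indices k \<and> (\<Sum>i=1..k. q i) = m. defect_ratio k n T q))
        \<longlonglongrightarrow> curv_c k n T
    \<and> (defect_ratio k n T \<longlongrightarrow> curv_c k n T) (coordinatewise_at_top k)
    \<and> (\<exists>L. has_iterated_limit k
          (\<lambda>q. trace_on UNIV
                 (comp_upto k (\<lambda>i. id_minus (cp_map (n i) (T i) ^^ (q ! (i - 1) + 1))) id)
               / (\<Prod>i=1..k. of_nat (q ! (i - 1)) ^ n i)) L
        \<and> curv_c k n T = (\<Prod>i=1..k. fact (n i)) * L)"
proof -
  interpret comm_tuple k n T by unfold_locales (rule T)
  obtain E lam where E: "finite E" "orthonormal E" "\<And>u. u \<in> E \<Longrightarrow> lam u > (0 :: real)"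
    "\<And>u. u \<in> E \<Longrightarrow> defect_op k n T u = complex_of_real (lam u) *\<^sub>C u"
    "\<And>h. defect_op k n T h = (\<Sum>u\<in>E. (complex_of_real (lam u) * cinner h u) *\<^sub>C u)"
    using finite_rank_spectral[OF positive_op_defect finite_rank[unfolded has_finite_rank_def]] by blast
  interpret finite_rank_tuple k n T E lam by unfold_locales (fact E)+
  interpret antitone_lists k list_ratio by (rule antitone_list_ratio[OF char_fun])
  \<comment> \<open>By \<open>curv_mean_eq\<close> the mean defining the curvature is the mean of
    the first formula, so existence of the limit and this formula come together.\<close>
  have "(\<lambda>m. complex_of_real ((\<Sum>j\<le>m. \<Sum>l\<in>compositions k j. list_ratio l) / real ((m + k) choose k)))
      \<longlonglongrightarrow> complex_of_real lim_inf"
    by (intro tendsto_of_real mean_simplex_tendsto k)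
  moreover have "complex_of_real ((\<Sum>j\<le>m. \<Sum>l\<in>compositions k j. list_ratio l) / real ((m + k) choose k))
      = 1 / of_nat ((m + k) choose k) *
        (\<Sum>q | q \<in> multi_indices k \<and> (\<Sum>i=1..k. q i) \<le> m. defect_ratio k n T q)" for m
    unfolding sum_list_map_upt[symmetric] sum_multi_indices[where P = "\<lambda>l. sum_list l \<le> m"]
      defect_ratio_eq ratio_restrict sum_lists_sum_le by simp
  ultimately have simplex: "(\<lambda>m. 1 / of_nat ((m + k) choose k) *
        (\<Sum>q | q \<in> multi_indices k \<and> (\<Sum>i=1..k. q i) \<le> m. defect_ratio k n T q)) \<longlonglongrightarrow> complex_of_real lim_inf"
    by (simp only:)
  then have mean: "curv_mean k n T \<longlonglongrightarrow> complex_of_real lim_inf"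
    unfolding curv_mean_eq[abs_def] .
  then have curv: "curv_c k n T = complex_of_real lim_inf"
    unfolding curv_c_def by (rule limI)
  have "(\<lambda>m. complex_of_real ((\<Sum>l\<in>compositions k m. list_ratio l) / real (card (compositions k m))))
      \<longlonglongrightarrow> complex_of_real lim_inf"
    by (intro tendsto_of_real mean_compositions_tendsto k)
  moreover have "complex_of_real ((\<Sum>l\<in>compositions k m. list_ratio l) / real (card (compositions k m)))
      = 1 / of_nat ((m + k - 1) choose (k - 1)) *
        (\<Sum>q | q \<in> multi_indices k \<and> (\<Sum>i=1..k. q i) = m. defect_ratio k n T q)" for m
  proof -
    have "card (compositions k m) = (m + k - 1) choose (k - 1)"
      using k binomial_symmetric[of m "m + k - 1"] by (simp add: card_compositions)
    then show ?thesis
      unfolding sum_list_map_upt[symmetric] sum_multi_indices[where P = "\<lambda>l. sum_list l = m"]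
        defect_ratio_eq ratio_restrict compositions_def[symmetric] by simp
  qed
  ultimately have diagonal: "(\<lambda>m. 1 / of_nat ((m + k - 1) choose (k - 1)) *
        (\<Sum>q | q \<in> multi_indices k \<and> (\<Sum>i=1..k. q i) = m. defect_ratio k n T q)) \<longlonglongrightarrow> complex_of_real lim_inf"
    by (simp only:)
  have "(ratio \<longlongrightarrow> lim_inf) (coordinatewise_at_top k)"
    unfolding tendsto_iff
  proof (intro allI impI)
    fix e :: real assume "e > 0"
    then obtain p where p: "length p = k" "list_ratio p < lim_inf + e" using lim_inf_approx by blast
    show "\<forall>\<^sub>F q in coordinatewise_at_top k. dist (ratio q) lim_inf < e"
      unfolding coordinatewise_at_top_def
    \<comment> \<open>A single index suffices: all tuples above the near-optimal list
      \<open>p\<close>, read as a tuple, have values within \<open>e\<close> of the infimum.\<close>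
    proof (rule eventually_INF1)
      show "restrict (\<lambda>i. p ! (i - 1)) {1..k} \<in> multi_indices k" by (simp add: multi_indices_def)
      show "\<forall>\<^sub>F q in principal {q \<in> multi_indices k. \<forall>i\<in>{1..k}. restrict (\<lambda>i. p ! (i - 1)) {1..k} i \<le> q i}.
          dist (ratio q) lim_inf < e"
        unfolding eventually_principal
      proof
        fix q assume q: "q \<in> {q \<in> multi_indices k. \<forall>i\<in>{1..k}. restrict (\<lambda>i. p ! (i - 1)) {1..k} i \<le> q i}"
        have "p ! i \<le> map q [1..<Suc k] ! i" if "i < k" for i
          using q that by (auto simp del: upt_Suc dest: bspec[of _ _ "Suc i"])
        then show "dist (ratio q) lim_inf < e"
          unfolding ratio_map[of q] dist_real_def by (intro lim_inf_bound[OF p(1) _ _ p(2)]) auto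
      qed
    qed
  qed
  then have net: "(defect_ratio k n T \<longlongrightarrow> complex_of_real lim_inf) (coordinatewise_at_top k)"
    unfolding defect_ratio_eq[abs_def] by (rule tendsto_of_real)
  let ?ns = "map n [1..<Suc k]"
  have len: "length ?ns = k" by simp
  have "has_iterated_limit k (\<lambda>q. complex_of_real (weighted_box_mean ?ns list_ratio q))
      (complex_of_real (lim_inf / (\<Prod>i=1..k. fact (n i))))"
  proof -
    have "antitone_lists (length ?ns) list_ratio" unfolding len by (rule antitone_list_ratio[OF char_fun])
    moreover have "m \<ge> 1" if "m \<in> set ?ns" for m using n(1) that by (auto simp del: upt_Suc)
    ultimately show ?thesis
      using has_iterated_limit_weighted_box_mean[of ?ns list_ratio] unfolding len prod_list_fact_upt by blast
  qed
  \<comment> \<open>The two functions agree on lists of length \<open>k\<close>, and the iterated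
    limit evaluates them only there.\<close>
  then have "has_iterated_limit k
      (\<lambda>q. trace_on UNIV
             (comp_upto k (\<lambda>i. id_minus (cp_map (n i) (T i) ^^ (q ! (i - 1) + 1))) id)
           / (\<Prod>i=1..k. of_nat (q ! (i - 1)) ^ n i))
      (complex_of_real (lim_inf / (\<Prod>i=1..k. fact (n i))))"
    by (rule has_iterated_limit_cong[rotated]) (rule trace_box[OF n(1), symmetric])
  moreover have "curv_c k n T = (\<Prod>i=1..k. fact (n i)) * complex_of_real (lim_inf / (\<Prod>i=1..k. fact (n i)))"
    unfolding curv by simp
  ultimately show ?thesis
    using mean simplex diagonal net unfolding curv[symmetric] by (blast intro: convergentI)
qed

end
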